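(* Let $F:T\mathcal B\to T\mathcal E$ be a first-order placement map, $\gamma$ a connection on $\mathcal E$, $\vartheta$ a solder form on $\mathcal E$, $\mathbf g$ a metric on $\mathbb E$ and $\mathfrak g$ a pseudo-metric on $\mathcal E$ compatible with $\mathbf g,\gamma,\vartheta$. Let $\Gamma=F^*\gamma$, $\Theta=F^*\vartheta$, $\mathbf G=\bar F^*\mathbf g$ and $\mathfrak G=F^*\mathfrak g$ be their pull-backs by $F$. Then: 1. $\mathfrak G$ is compatible with $\Gamma$, $\Theta$ and $\mathbf G$; 2. $\ker\mathfrak G=H^{\Gamma-\Theta}\mathcal B$, i.e. $\ker_X\mathfrak G=(\Gamma_X-\Theta_X)(T_{\bar X}\mathbb B)$ for all $X\in\mathcal B$.
   Context: Smooth means at least $C^1$. Affine bundles. An affine bundle $\pi_{A}:A\to\mathbb A$ is a smooth surjection between smooth connected orientable manifolds which is locally trivial with typical fibre a finite-dimensional real affine space $F_A$, with transition maps affine on the fibres; its rank is $\dim F_A$; $\bar a=\pi_A(a)$. Affine trivialising coordinates are local coordinates $(\bar x,y)$ on $A$ with $\bar x$ coordinates on $\mathbb A$ and $y$ affine coordinates on each fibre; they induce coordinates $(\bar x,y,\delta\bar x,\delta y)$ on $TA$ ("vectorial coordinates" $(\delta \bar x,\delta y)$). $VA=\ker T\pi_A$. A connection on $A$ is a smooth map $\gamma:A\times_{\mathbb A}T\mathbb A\to TA$ such that each $\gamma_a:T_{\bar a}\mathbb A\to T_aA$ is linear with $T\pi_A\circ\gamma_a=\mathrm{Id}$, the vectorial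 coordinates of $\gamma(a,\bar u)$ being affine in the vertical coordinate $y$ of $a$. A solder form on $A$ is a smooth injective map $\vartheta:A\times_{\mathbb A}T\mathbb A\to TA$ with each $\vartheta_a:T_{\bar a}\mathbb A\to V_aA$ linear, the vectorial coordinates of $\vartheta(a,\bar u)$ being affine in $y$. A pseudo-metric on $A$ is a smooth field of symmetric positive semi-definite bilinear forms on the spaces $T_aA$; its kernel at $a$ is $\ker_a\mathfrak g=\{u:\langle u,w\rangle_{\mathfrak g}=0\ \forall w\in T_aA\}$. It is compatible with a metric $\mathbf g$ on $\mathbb A$, $\gamma$ and $\vartheta$ if $\langle\vartheta_a\bar u+\gamma_a\bar w,\vartheta_a\bar u'+\gamma_a\bar w'\rangle_{\mathfrak g}=\langle\bar u+\bar w,\bar u'+\bar w'\rangle_{\mathbf g}$ for all $a\in A$, $\bar u,\bar w,\bar u',\bar w'\in T_{\bar a}\mathbb A$. Spaces. $\pi_{\mathcal E}:\mathcal E\to\mathbb E$ is the ambient bundle: $\mathbb E=\mathbb R^3$, $\mathcal E=\mathbb R^3\times\mathbb R^3$, $\pi_{\mathcal E}(\bar x,y)=\bar x$. $\pi_{\mathcal B}:\mathcal B\to\mathbb B$ is the material bundle, an affine bundle of rank $3$ with $\dim\mathbb B\in\{1,2,3\}$. Placements. A first-order placement map is a smooth $F:T\mathcal B\to T\mathcal E$ such that: (1) $F$ is a vector bundle morphism over a map $\varphi:\mathcal B\to\mathcal E$ (its punctual shadow), where $\varphi$ is smooth, affine on each fibre and covers a smooth $\bar\varphi:\mathbb B\to\mathbb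 E$ ($\pi_{\mathcal E}\circ\varphi=\bar\varphi\circ\pi_{\mathcal B}$); (2) $T\pi_{\mathcal E}\circ F=\bar F\circ T\pi_{\mathcal B}$ with $\bar F:=T\bar\varphi$; (3) $F|_{V\mathcal B}=(T\varphi)|_{V\mathcal B}$; (4) in affine trivialising coordinates, the vectorial coordinates of $F_XU$ (for fixed vectorial coordinates of $U\in T_X\mathcal B$) are affine in the vertical coordinate of $X$; (5) $F$ and $\varphi$ are differential embeddings. Pull-backs. $(F^*\gamma)_X=F_X^{-1}\circ\gamma_{\varphi(X)}\circ\bar F$, $(F^*\vartheta)_X=F_X^{-1}\circ\vartheta_{\varphi(X)}\circ\bar F$ for $X\in\mathcal B$; $\langle U,W\rangle_{F^*\mathfrak g}=\langle FU,FW\rangle_{\mathfrak g}$; $\langle\bar U,\bar W\rangle_{\bar F^*\mathbf g}=\langle\bar F\bar U,\bar F\bar W\rangle_{\mathbf g}$. *)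

theory Defs
  imports "HOL-Analysis.Analysis"
begin

section \<open>Manifolds\<close>

text \<open>
  ``Smooth'' means (at least) $C^1$ for every map and tensor field.  Since smooth maps between
  tangent bundles are considered, the manifolds themselves (and the projection and the local
  trivialisations of an affine bundle, which belong to the manifold structure) are of class $C^2$,
  so that their tangent bundles are $C^1$ manifolds.
\<close>

text \<open>Class $C^k$ on \<open>S\<close>, which is meant to be open.\<close>

primrec Ck_on :: "nat \<Rightarrow> 'a::euclidean_space set \<Rightarrow> ('a \<Rightarrow> 'b::euclidean_space) \<Rightarrow> bool" where
  "Ck_on 0 S f \<longleftrightarrow> continuous_on S f"
| "Ck_on (Suc k) S f \<longleftrightarrow>
     (\<forall>x\<in>S. f differentiable (at x)) \<and> (\<forall>v. Ck_on k S (\<lambda>x. frechet_derivative f (at x) v))"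

text \<open>A chart is a domain together with a coordinate map, which is only relevant on the domain.\<close>

type_synonym ('p, 'e) chart = "'p set \<times> ('p \<Rightarrow> 'e)"

abbreviation cdom :: "('p, 'e) chart \<Rightarrow> 'p set" where "cdom \<equiv> fst"
abbreviation cmap :: "('p, 'e) chart \<Rightarrow> 'p \<Rightarrow> 'e" where "cmap \<equiv> snd"

record ('p, 'e) manifold_data =
  topo :: "'p topology"
  atlas :: "('p, 'e) chart set"

abbreviation carr :: "('p, 'e) manifold_data \<Rightarrow> 'p set" where
  "carr M \<equiv> topspace (topo M)"

definition is_chart :: "'p topology \<Rightarrow> ('p, 'e::euclidean_space) chart \<Rightarrow> bool" where
  "is_chart X c \<longleftrightarrow> openin X (cdom c) \<and> open (cmap c ` cdom c) \<and>
     homeomorphic_map (subtopology X (cdom c)) (top_of_set (cmap c ` cdom c)) (cmap c)"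

text \<open>The local representative of a map \<open>f\<close> in charts \<open>c\<close> (source) and \<open>d\<close> (target).\<close>

definition local_rep ::
  "('p, 'e) chart \<Rightarrow> ('q, 'f) chart \<Rightarrow> ('p \<Rightarrow> 'q) \<Rightarrow> 'e \<Rightarrow> 'f" where
  "local_rep c d f = cmap d \<circ> f \<circ> inv_into (cdom c) (cmap c)"

abbreviation transition :: "('p, 'e) chart \<Rightarrow> ('p, 'e) chart \<Rightarrow> 'e \<Rightarrow> 'e" where
  "transition c d \<equiv> local_rep c d (\<lambda>p. p)"

definition C2_compatible ::
  "('p, 'e::euclidean_space) chart \<Rightarrow> ('p, 'e) chart \<Rightarrow> bool" where
  "C2_compatible c d \<longleftrightarrow>
     Ck_on 2 (cmap c ` (cdom c \<inter> cdom d)) (transition c d) \<and>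
     Ck_on 2 (cmap d ` (cdom c \<inter> cdom d)) (transition d c)"

text \<open>The atlas of a manifold is required to be maximal, i.e. to be the set of all local
  coordinates of class $C^2$.\<close>

definition manifold :: "('p, 'e::euclidean_space) manifold_data \<Rightarrow> bool" where
  "manifold M \<longleftrightarrow>
     Hausdorff_space (topo M) \<and> second_countable (topo M) \<and>
     (\<forall>c\<in>atlas M. is_chart (topo M) c) \<and>
     (\<Union>c\<in>atlas M. cdom c) = carr M \<and>
     (\<forall>c\<in>atlas M. \<forall>d\<in>atlas M. C2_compatible c d) \<and>
     (\<forall>c. is_chart (topo M) c \<and> (\<forall>d\<in>atlas M. C2_compatible c d) \<longrightarrow> c \<in> atlas M)"

text \<open>The determinant of an endomorphism, by the Leibniz formula in the standard basis (the
  library determinant is restricted to matrices).\<close>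

definition lin_det :: "('e::euclidean_space \<Rightarrow> 'e) \<Rightarrow> real" where
  "lin_det f = (\<Sum>s | s permutes (Basis::'e set). of_int (sign s) * (\<Prod>b\<in>Basis. f b \<bullet> s b))"

definition orientable :: "('p, 'e::euclidean_space) manifold_data \<Rightarrow> bool" where
  "orientable M \<longleftrightarrow> (\<exists>C \<subseteq> atlas M. (\<Union>c\<in>C. cdom c) = carr M \<and>
     (\<forall>c\<in>C. \<forall>d\<in>C. \<forall>p \<in> cdom c \<inter> cdom d.
        lin_det (frechet_derivative (transition c d) (at (cmap c p))) > 0))"

definition smooth_map ::
  "nat \<Rightarrow> ('p, 'e::euclidean_space) manifold_data \<Rightarrow> ('q, 'f::euclidean_space) manifold_data \<Rightarrow>
   ('p \<Rightarrow> 'q) \<Rightarrow> bool" where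
  "smooth_map k M N f \<longleftrightarrow> continuous_map (topo M) (topo N) f \<and>
     (\<forall>c\<in>atlas M. \<forall>d\<in>atlas N.
        Ck_on k (cmap c ` (cdom c \<inter> f -` cdom d)) (local_rep c d f))"

definition euclidean_manifold :: "('e, 'e::euclidean_space) manifold_data" where
  "euclidean_manifold =
     \<lparr>topo = euclidean,
      atlas = {c. is_chart euclidean c \<and> C2_compatible c (UNIV, \<lambda>x. x)}\<rparr>"

section \<open>Tangent bundles\<close>

text \<open>
  A tangent vector is a base point together with the family of its components in all charts around
  that point, subject to the usual transformation law; components in other charts are set to 0.
\<close>

type_synonym ('p, 'e) tvector = "'p \<times> (('p, 'e) chart \<Rightarrow> 'e)"

definition charts_at :: "('p, 'e) manifold_data \<Rightarrow> 'p \<Rightarrow> ('p, 'e) chart set" where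
  "charts_at M p = {c \<in> atlas M. p \<in> cdom c}"

definition tspace ::
  "('p, 'e::euclidean_space) manifold_data \<Rightarrow> 'p \<Rightarrow> ('p, 'e) tvector set" where
  "tspace M p = {(q, v). q = p \<and> p \<in> carr M \<and>
     (\<forall>c \<in> charts_at M p. \<forall>d \<in> charts_at M p.
        v d = frechet_derivative (transition c d) (at (cmap c p)) (v c)) \<and>
     (\<forall>c. c \<notin> charts_at M p \<longrightarrow> v c = 0)}"

text \<open>The tangent vector at \<open>p\<close> with components \<open>v\<close> in the chart \<open>c\<close>.\<close>

definition tvec ::
  "('p, 'e::euclidean_space) manifold_data \<Rightarrow> ('p, 'e) chart \<Rightarrow> 'p \<Rightarrow> 'e \<Rightarrow> ('p, 'e) tvector" where
  "tvec M c p v = (p, \<lambda>d. if d \<in> charts_at M p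
                          then frechet_derivative (transition c d) (at (cmap c p)) v else 0)"

text \<open>Vector space operations; addition is only meaningful for vectors with equal base points.\<close>

definition tzero :: "'p \<Rightarrow> ('p, 'e::euclidean_space) tvector" where
  "tzero p = (p, \<lambda>c. 0)"

definition tadd ::
  "('p, 'e::euclidean_space) tvector \<Rightarrow> ('p, 'e) tvector \<Rightarrow> ('p, 'e) tvector" where
  "tadd u w = (fst u, \<lambda>c. snd u c + snd w c)"

definition tscale :: "real \<Rightarrow> ('p, 'e::euclidean_space) tvector \<Rightarrow> ('p, 'e) tvector" where
  "tscale r u = (fst u, \<lambda>c. r *\<^sub>R snd u c)"

definition tdiff ::
  "('p, 'e::euclidean_space) tvector \<Rightarrow> ('p, 'e) tvector \<Rightarrow> ('p, 'e) tvector" where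
  "tdiff u w = (fst u, \<lambda>c. snd u c - snd w c)"

definition tlinear ::
  "('p, 'e::euclidean_space) tvector set \<Rightarrow> ('q, 'f::euclidean_space) tvector set \<Rightarrow>
   (('p, 'e) tvector \<Rightarrow> ('q, 'f) tvector) \<Rightarrow> bool" where
  "tlinear V W L \<longleftrightarrow> L ` V \<subseteq> W \<and>
     (\<forall>u\<in>V. \<forall>w\<in>V. L (tadd u w) = tadd (L u) (L w)) \<and>
     (\<forall>r. \<forall>u\<in>V. L (tscale r u) = tscale r (L u))"

definition tangent_chart ::
  "('p, 'e::euclidean_space) manifold_data \<Rightarrow> ('p, 'e) chart \<Rightarrow>
   (('p, 'e) tvector, 'e \<times> 'e) chart" where
  "tangent_chart M c = ((\<Union>p\<in>cdom c. tspace M p), \<lambda>u. (cmap c (fst u), snd u c))"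

text \<open>The atlas of the tangent bundle consists of the induced charts only (not maximal).\<close>

definition tangent_bundle ::
  "('p, 'e::euclidean_space) manifold_data \<Rightarrow> (('p, 'e) tvector, 'e \<times> 'e) manifold_data" where
  "tangent_bundle M =
     \<lparr>topo = topology_generated_by
               {cdom C \<inter> cmap C -` W | C W. C \<in> tangent_chart M ` atlas M \<and> open W},
      atlas = tangent_chart M ` atlas M\<rparr>"

text \<open>The tangent map of \<open>f\<close>; the choice of the chart \<open>c\<close> is irrelevant for differentiable \<open>f\<close>.\<close>

definition tmap ::
  "('p, 'e::euclidean_space) manifold_data \<Rightarrow> ('q, 'f::euclidean_space) manifold_data \<Rightarrow>
   ('p \<Rightarrow> 'q) \<Rightarrow> ('p, 'e) tvector \<Rightarrow> ('q, 'f) tvector" where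
  "tmap M N f u = (let p = fst u; c = (SOME c. c \<in> charts_at M p) in
     (f p, \<lambda>d. if d \<in> charts_at N (f p)
               then frechet_derivative (local_rep c d f) (at (cmap c p)) (snd u c) else 0))"

definition diff_embedding ::
  "('p, 'e::euclidean_space) manifold_data \<Rightarrow> ('q, 'f::euclidean_space) manifold_data \<Rightarrow>
   ('p \<Rightarrow> 'q) \<Rightarrow> bool" where
  "diff_embedding M N f \<longleftrightarrow> smooth_map 1 M N f \<and> embedding_map (topo M) (topo N) f \<and>
     (\<forall>p \<in> carr M. inj_on (tmap M N f) (tspace M p))"

section \<open>Affine bundles\<close>

definition affine_map :: "('a::euclidean_space \<Rightarrow> 'b::euclidean_space) \<Rightarrow> bool" where
  "affine_map h \<longleftrightarrow> (\<exists>l b. linear l \<and> (\<forall>y. h y = l y + b))"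

text \<open>
  The typical fibre is a Euclidean space \<open>'f\<close>, regarded as an affine space.  A local trivialisation
  over \<open>U\<close> is given by \<open>(U, \<psi>)\<close>, where \<open>\<psi>\<close> is the fibre component of
  $\pi^{-1}(U) \to U \times F$; these determine the affine structure of the fibres.
\<close>

record ('a, 'p, 'b, 'f) bundle_data =
  total :: "('a, 'b \<times> 'f) manifold_data"
  base :: "('p, 'b) manifold_data"
  proj :: "'a \<Rightarrow> 'p"
  trivs :: "('p set \<times> ('a \<Rightarrow> 'f)) set"

definition fibre :: "('a, 'p, 'b, 'f) bundle_data \<Rightarrow> 'p \<Rightarrow> 'a set" where
  "fibre A p = {a \<in> carr (total A). proj A a = p}"

text \<open>Affine trivialising coordinates $(\bar x, y)$: \<open>c\<close> are coordinates on the base and \<open>\<psi>\<close> is the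
  fibre component of a local trivialisation defined over the domain of \<open>c\<close>.\<close>

definition trivialising ::
  "('a, 'p, 'b, 'f) bundle_data \<Rightarrow> ('p, 'b) chart \<Rightarrow> ('a \<Rightarrow> 'f) \<Rightarrow> bool" where
  "trivialising A c \<psi> \<longleftrightarrow> c \<in> atlas (base A) \<and> (\<exists>U. (U, \<psi>) \<in> trivs A \<and> cdom c \<subseteq> U)"

definition affine_chart ::
  "('a, 'p, 'b, 'f) bundle_data \<Rightarrow> ('p, 'b) chart \<Rightarrow> ('a \<Rightarrow> 'f) \<Rightarrow> ('a, 'b \<times> 'f) chart" where
  "affine_chart A c \<psi> =
     ({a \<in> carr (total A). proj A a \<in> cdom c}, \<lambda>a. (cmap c (proj A a), \<psi> a))"

definition affine_bundle ::
  "('a, 'p, 'b::euclidean_space, 'f::euclidean_space) bundle_data \<Rightarrow> bool" where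
  "affine_bundle A \<longleftrightarrow>
     manifold (total A) \<and> connected_space (topo (total A)) \<and> orientable (total A) \<and>
     manifold (base A) \<and> connected_space (topo (base A)) \<and> orientable (base A) \<and>
     smooth_map 2 (total A) (base A) (proj A) \<and> proj A ` carr (total A) = carr (base A) \<and>
     (\<Union>t\<in>trivs A. fst t) = carr (base A) \<and>
     (\<forall>(U, \<psi>)\<in>trivs A. openin (topo (base A)) U) \<and>
     (\<forall>c \<psi>. trivialising A c \<psi> \<longrightarrow>
        affine_chart A c \<psi> \<in> atlas (total A) \<and>
        cmap (affine_chart A c \<psi>) ` cdom (affine_chart A c \<psi>) = (cmap c ` cdom c) \<times> UNIV) \<and>
     (\<forall>(U, \<psi>)\<in>trivs A. \<forall>(U', \<psi>')\<in>trivs A. \<forall>p \<in> U \<inter> U'.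
        \<exists>h. affine_map h \<and> (\<forall>a \<in> fibre A p. \<psi>' a = h (\<psi> a)))"

definition tproj ::
  "('a, 'p, 'b::euclidean_space, 'f::euclidean_space) bundle_data \<Rightarrow>
   ('a, 'b \<times> 'f) tvector \<Rightarrow> ('p, 'b) tvector" where
  "tproj A = tmap (total A) (base A) (proj A)"

definition vertical ::
  "('a, 'p, 'b::euclidean_space, 'f::euclidean_space) bundle_data \<Rightarrow> 'a \<Rightarrow>
   ('a, 'b \<times> 'f) tvector set" where
  "vertical A a = {u \<in> tspace (total A) a. tproj A u = tzero (proj A a)}"

text \<open>The manifold $A \times_{\mathbb A} T\mathbb A$, with topology induced from
  $A \times T\mathbb A$ and coordinates $(\bar x, y, \delta\bar x)$.\<close>

definition fibre_product ::
  "('a, 'p, 'b::euclidean_space, 'f::euclidean_space) bundle_data \<Rightarrow>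
   ('a \<times> ('p, 'b) tvector, ('b \<times> 'f) \<times> 'b) manifold_data" where
  "fibre_product A =
     (let P = {(a, u). a \<in> carr (total A) \<and> u \<in> tspace (base A) (proj A a)} in
      \<lparr>topo = subtopology (prod_topology (topo (total A)) (topo (tangent_bundle (base A)))) P,
       atlas = {({(a, u) \<in> P. a \<in> cdom (affine_chart A c \<psi>)},
                 \<lambda>(a, u). (cmap (affine_chart A c \<psi>) a, snd u c)) | c \<psi>. trivialising A c \<psi>}\<rparr>)"

section \<open>Connections, solder forms and metrics\<close>

text \<open>In affine trivialising coordinates, the vectorial coordinates of \<open>\<gamma> a u\<close> are affine in the
  vertical coordinate of \<open>a\<close>, for \<open>a\<close> in a fixed fibre and fixed components of \<open>u\<close>.\<close>

definition vertically_affine ::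
  "('a, 'p, 'b::euclidean_space, 'f::euclidean_space) bundle_data \<Rightarrow>
   ('a \<Rightarrow> ('p, 'b) tvector \<Rightarrow> ('a, 'b \<times> 'f) tvector) \<Rightarrow> bool" where
  "vertically_affine A \<gamma> \<longleftrightarrow>
     (\<forall>c \<psi> p v. trivialising A c \<psi> \<and> p \<in> cdom c \<longrightarrow>
        (\<exists>h. affine_map h \<and>
          (\<forall>a \<in> fibre A p. snd (\<gamma> a (tvec (base A) c p v)) (affine_chart A c \<psi>) = h (\<psi> a))))"

definition connection ::
  "('a, 'p, 'b::euclidean_space, 'f::euclidean_space) bundle_data \<Rightarrow>
   ('a \<Rightarrow> ('p, 'b) tvector \<Rightarrow> ('a, 'b \<times> 'f) tvector) \<Rightarrow> bool" where
  "connection A \<gamma> \<longleftrightarrow>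
     smooth_map 1 (fibre_product A) (tangent_bundle (total A)) (\<lambda>(a, u). \<gamma> a u) \<and>
     (\<forall>a \<in> carr (total A).
        tlinear (tspace (base A) (proj A a)) (tspace (total A) a) (\<gamma> a) \<and>
        (\<forall>u \<in> tspace (base A) (proj A a). tproj A (\<gamma> a u) = u)) \<and>
     vertically_affine A \<gamma>"

definition solder_form ::
  "('a, 'p, 'b::euclidean_space, 'f::euclidean_space) bundle_data \<Rightarrow>
   ('a \<Rightarrow> ('p, 'b) tvector \<Rightarrow> ('a, 'b \<times> 'f) tvector) \<Rightarrow> bool" where
  "solder_form A \<theta> \<longleftrightarrow>
     smooth_map 1 (fibre_product A) (tangent_bundle (total A)) (\<lambda>(a, u). \<theta> a u) \<and>
     inj_on (\<lambda>(a, u). \<theta> a u) (carr (fibre_product A)) \<and>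
     (\<forall>a \<in> carr (total A).
        tlinear (tspace (base A) (proj A a)) (vertical A a) (\<theta> a)) \<and>
     vertically_affine A \<theta>"

definition pseudo_metric ::
  "('p, 'e::euclidean_space) manifold_data \<Rightarrow>
   (('p, 'e) tvector \<Rightarrow> ('p, 'e) tvector \<Rightarrow> real) \<Rightarrow> bool" where
  "pseudo_metric M g \<longleftrightarrow>
     (\<forall>p \<in> carr M.
        (\<forall>u \<in> tspace M p. \<forall>w \<in> tspace M p. g u w = g w u) \<and>
        (\<forall>u \<in> tspace M p. \<forall>u' \<in> tspace M p. \<forall>w \<in> tspace M p.
           g (tadd u u') w = g u w + g u' w) \<and>
        (\<forall>r. \<forall>u \<in> tspace M p. \<forall>w \<in> tspace M p. g (tscale r u) w = r * g u w) \<and>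
        (\<forall>u \<in> tspace M p. 0 \<le> g u u)) \<and>
     (\<forall>c \<in> atlas M. \<forall>v w.
        Ck_on 1 (cmap c ` cdom c)
          (\<lambda>x. let p = inv_into (cdom c) (cmap c) x in g (tvec M c p v) (tvec M c p w)))"

definition riemannian_metric ::
  "('p, 'e::euclidean_space) manifold_data \<Rightarrow>
   (('p, 'e) tvector \<Rightarrow> ('p, 'e) tvector \<Rightarrow> real) \<Rightarrow> bool" where
  "riemannian_metric M g \<longleftrightarrow> pseudo_metric M g \<and>
     (\<forall>p \<in> carr M. \<forall>u \<in> tspace M p. u \<noteq> tzero p \<longrightarrow> 0 < g u u)"

definition metric_kernel ::
  "('p, 'e::euclidean_space) manifold_data \<Rightarrow>
   (('p, 'e) tvector \<Rightarrow> ('p, 'e) tvector \<Rightarrow> real) \<Rightarrow> 'p \<Rightarrow> ('p, 'e) tvector set" where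
  "metric_kernel M g p = {u \<in> tspace M p. \<forall>w \<in> tspace M p. g u w = 0}"

text \<open>Compatibility is a relation between a pseudo-metric, a metric, a connection and a solder form;
  that the arguments are such objects is part of the definition.\<close>

definition compatible ::
  "('a, 'p, 'b::euclidean_space, 'f::euclidean_space) bundle_data \<Rightarrow>
   (('a, 'b \<times> 'f) tvector \<Rightarrow> ('a, 'b \<times> 'f) tvector \<Rightarrow> real) \<Rightarrow>
   (('p, 'b) tvector \<Rightarrow> ('p, 'b) tvector \<Rightarrow> real) \<Rightarrow>
   ('a \<Rightarrow> ('p, 'b) tvector \<Rightarrow> ('a, 'b \<times> 'f) tvector) \<Rightarrow>
   ('a \<Rightarrow> ('p, 'b) tvector \<Rightarrow> ('a, 'b \<times> 'f) tvector) \<Rightarrow> bool" where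
  "compatible A gA g \<gamma> \<theta> \<longleftrightarrow>
     pseudo_metric (total A) gA \<and> riemannian_metric (base A) g \<and> connection A \<gamma> \<and> solder_form A \<theta> \<and>
     (\<forall>a \<in> carr (total A).
        \<forall>u \<in> tspace (base A) (proj A a). \<forall>w \<in> tspace (base A) (proj A a).
        \<forall>u' \<in> tspace (base A) (proj A a). \<forall>w' \<in> tspace (base A) (proj A a).
          gA (tadd (\<theta> a u) (\<gamma> a w)) (tadd (\<theta> a u') (\<gamma> a w')) = g (tadd u w) (tadd u' w'))"

section \<open>Placements and pull-backs\<close>

definition ambient_bundle ::
  "((real^3) \<times> (real^3), real^3, real^3, real^3) bundle_data" where
  "ambient_bundle =
     \<lparr>total = euclidean_manifold, base = euclidean_manifold, proj = fst, trivs = {(UNIV, snd)}\<rparr>"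

definition affine_on_fibres ::
  "('a, 'p, 'b, 'f::euclidean_space) bundle_data \<Rightarrow> ('c, 'q, 'd, 'h::euclidean_space) bundle_data \<Rightarrow>
   ('a \<Rightarrow> 'c) \<Rightarrow> ('p \<Rightarrow> 'q) \<Rightarrow> bool" where
  "affine_on_fibres A B f fbar \<longleftrightarrow>
     (\<forall>(U, \<psi>)\<in>trivs A. \<forall>(U', \<psi>')\<in>trivs B. \<forall>p \<in> U. fbar p \<in> U' \<longrightarrow>
        (\<exists>h. affine_map h \<and> (\<forall>a \<in> fibre A p. \<psi>' (f a) = h (\<psi> a))))"

text \<open>\<open>\<phi>\<close> (the punctual shadow) and \<open>\<phi>bar\<close> are determined on the carriers by \<open>F\<close>.\<close>

definition first_order_placement ::
  "('a, 'p, 'b::euclidean_space, 'f::euclidean_space) bundle_data \<Rightarrow>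
   ('c, 'q, 'd::euclidean_space, 'h::euclidean_space) bundle_data \<Rightarrow>
   (('a, 'b \<times> 'f) tvector \<Rightarrow> ('c, 'd \<times> 'h) tvector) \<Rightarrow> ('a \<Rightarrow> 'c) \<Rightarrow> ('p \<Rightarrow> 'q) \<Rightarrow> bool" where
  "first_order_placement B E F \<phi> \<phi>bar \<longleftrightarrow>
     smooth_map 1 (tangent_bundle (total B)) (tangent_bundle (total E)) F \<and>
     (\<forall>X \<in> carr (total B). tlinear (tspace (total B) X) (tspace (total E) (\<phi> X)) F) \<and>
     smooth_map 1 (total B) (total E) \<phi> \<and>
     smooth_map 1 (base B) (base E) \<phi>bar \<and>
     (\<forall>X \<in> carr (total B). proj E (\<phi> X) = \<phi>bar (proj B X)) \<and>
     affine_on_fibres B E \<phi> \<phi>bar \<and>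
     (\<forall>X \<in> carr (total B). \<forall>U \<in> tspace (total B) X.
        tproj E (F U) = tmap (base B) (base E) \<phi>bar (tproj B U)) \<and>
     (\<forall>X \<in> carr (total B). \<forall>U \<in> vertical B X. F U = tmap (total B) (total E) \<phi> U) \<and>
     (\<forall>c \<psi> d \<eta> p v. trivialising B c \<psi> \<and> trivialising E d \<eta> \<and> p \<in> cdom c \<and> \<phi>bar p \<in> cdom d \<longrightarrow>
        (\<exists>h. affine_map h \<and>
          (\<forall>X \<in> fibre B p.
             snd (F (tvec (total B) (affine_chart B c \<psi>) X v)) (affine_chart E d \<eta>) = h (\<psi> X)))) \<and>
     diff_embedding (tangent_bundle (total B)) (tangent_bundle (total E)) F \<and>
     diff_embedding (total B) (total E) \<phi>"

text \<open>The pull-back $X \mapsto F_X^{-1} \circ \gamma_{\varphi(X)} \circ \bar F$ of a connection or a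
  solder form, where \<open>Fbar\<close> is the tangent map of \<open>\<phi>bar\<close> and $F_X$ the restriction of \<open>F\<close> to the
  tangent space at \<open>X\<close>.\<close>

definition pullback_form ::
  "('a, 'p, 'b::euclidean_space, 'f::euclidean_space) bundle_data \<Rightarrow>
   (('a, 'b \<times> 'f) tvector \<Rightarrow> ('c, 'd \<times> 'h) tvector) \<Rightarrow> ('a \<Rightarrow> 'c) \<Rightarrow>
   (('p, 'b) tvector \<Rightarrow> ('q, 'd) tvector) \<Rightarrow>
   ('c \<Rightarrow> ('q, 'd) tvector \<Rightarrow> ('c, 'd \<times> 'h) tvector) \<Rightarrow>
   ('a \<Rightarrow> ('p, 'b) tvector \<Rightarrow> ('a, 'b \<times> 'f) tvector)" where
  "pullback_form B F \<phi> Fbar \<gamma> = (\<lambda>X U. inv_into (tspace (total B) X) F (\<gamma> (\<phi> X) (Fbar U)))"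

definition pullback_metric ::
  "(('p, 'e) tvector \<Rightarrow> ('q, 'f) tvector) \<Rightarrow>
   (('q, 'f) tvector \<Rightarrow> ('q, 'f) tvector \<Rightarrow> real) \<Rightarrow>
   (('p, 'e) tvector \<Rightarrow> ('p, 'e) tvector \<Rightarrow> real)" where
  "pullback_metric F g = (\<lambda>U W. g (F U) (F W))"

definition horizontal ::
  "('a, 'p, 'b::euclidean_space, 'f::euclidean_space) bundle_data \<Rightarrow>
   ('a \<Rightarrow> ('p, 'b) tvector \<Rightarrow> ('a, 'b \<times> 'f) tvector) \<Rightarrow> 'a \<Rightarrow> ('a, 'b \<times> 'f) tvector set" where
  "horizontal A \<gamma> X = \<gamma> X ` tspace (base A) (proj A X)"

end

(*
  F restricts to an isomorphism between the vertical spaces of B and of the ambient bundle: it is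
  injective and both have dimension 3.  Hence its image at X consists of the vectors lying over the
  image of Fbar.  It follows that Fbar is injective and that Gamma and Theta are well defined; in
  trivialising coordinates they are obtained by solving a linear system in R^3 whose matrix is C^1
  and constant along the fibres, while the right-hand side is C^1 and affine along the fibres.

  For the kernel, every ambient vector is theta u + gamma w with w its projection, and its product
  with theta r is g(u + w, r).  All theta r lie in the image of F, so F Z is orthogonal to the image
  of F exactly if u = - w, i.e. F Z = (gamma - theta) w, where w = Fbar (T pi Z).
*)
theory Submission
  imports Defs
begin

section \<open>Maps of class $C^1$\<close>

text \<open>The map \<open>\<phi>bar\<close> is only of class C^1, so its tangent map is a priori
  merely continuous, whereas the pulled-back metric and forms must be C^1. The missing regularity
  comes from \<open>F\<close>: in trivialising coordinates \<open>Fbar\<close> is the base component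
  of \<open>F\<close>, which is C^1 as a map of tangent bundles. Affinity along the fibres meets
  another obstacle, since the inverse of a matrix depending affinely on the fibre point is in
  general not affine. The vertical block of \<open>F\<close> is that of the tangent map of
  \<open>\<phi>\<close>, and \<open>\<phi>\<close> is affine on fibres; this is why the block, and
  with it its inverse, does not vary along a fibre. That every ambient vector is of the form theta u
  + gamma w is again a dimension count: at each point theta is injective from a base tangent space
  to a vertical space, both of dimension 3. In the kernel computation the decisive test vector is
  theta r with r = u + w, and positive definiteness of the metric on the base forces r = 0.\<close>

lemma Ck_on_subset: "Ck_on k T f \<Longrightarrow> S \<subseteq> T \<Longrightarrow> Ck_on k S f"
proof (induction k arbitrary: f)
  case 0
  then show ?case by (simp add: continuous_on_subset)
next
  case (Suc k)
  have "Ck_on k S (\<lambda>x. frechet_derivative f (at x) v)" for v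
    by (rule Suc.IH) (use Suc.prems in simp_all)
  moreover have "f differentiable (at x)" if "x \<in> S" for x
    using Suc.prems that by auto
  ultimately show ?case by simp
qed

text \<open>Equality on an open set is equality near each of its points, so derivatives are
  inherited and coincide. Without openness the derivative \<open>at x\<close> would also see values
  outside \<open>S\<close>.\<close>

lemma Ck_on_cong:
  assumes "open S" "\<And>x. x \<in> S \<Longrightarrow> f x = g x" "Ck_on k S f"
  shows "Ck_on k S g"
  using assms(2,3)
proof (induction k arbitrary: f g)
  case 0
  then show ?case using continuous_on_cong[of S S f g] by simp
next
  case (Suc k)
  have der: "(g has_derivative frechet_derivative f (at x)) (at x)" if "x \<in> S" for x
  proof -
    have "(f has_derivative frechet_derivative f (at x)) (at x)"
      using Suc.prems that by (simp add: frechet_derivative_works)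
    then show ?thesis
      by (rule has_derivative_transform_within_open[OF _ \<open>open S\<close> that]) (rule Suc.prems(1))
  qed
  have eq: "frechet_derivative f (at x) = frechet_derivative g (at x)" if "x \<in> S" for x
    using frechet_derivative_at[OF der[OF that]] .
  have "Ck_on k S (\<lambda>x. frechet_derivative g (at x) v)" for v
  proof (rule Suc.IH)
    show "Ck_on k S (\<lambda>x. frechet_derivative f (at x) v)" using Suc.prems(2) by simp
  qed (simp add: eq)
  moreover have "g differentiable (at x)" if "x \<in> S" for x
    using der[OF that] by (rule differentiableI)
  ultimately show ?case by simp
qed

lemma continuous_on_locally:
  fixes f :: "'a::t2_space \<Rightarrow> 'b::topological_space"
  assumes "\<And>x. x \<in> S \<Longrightarrow> \<exists>T. open T \<and> x \<in> T \<and> continuous_on T f"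
  shows "continuous_on S f"
proof -
  have "isCont f x" if "x \<in> S" for x
    using assms[OF that] by (auto simp: continuous_on_eq_continuous_at)
  then show ?thesis by (simp add: continuous_at_imp_continuous_on)
qed

text \<open>Used where a property can be verified only in small trivialising charts. The
  neighbourhoods \<open>T\<close> may leave \<open>S\<close>.\<close>

lemma Ck_on_locally:
  assumes "\<And>x. x \<in> S \<Longrightarrow> \<exists>T. open T \<and> x \<in> T \<and> Ck_on k T f"
  shows "Ck_on k S f"
  using assms
proof (induction k arbitrary: f)
  case 0
  then show ?case using continuous_on_locally[of S f] by simp
next
  case (Suc k)
  have "f differentiable (at x)" if "x \<in> S" for x
    using Suc.prems[OF that] by auto
  moreover have "Ck_on k S (\<lambda>x. frechet_derivative f (at x) v)" for v
  proof (rule Suc.IH)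
    fix x assume "x \<in> S"
    from Suc.prems[OF this]
    show "\<exists>T. open T \<and> x \<in> T \<and> Ck_on k T (\<lambda>x. frechet_derivative f (at x) v)" by auto
  qed
  ultimately show ?case by simp
qed

text \<open>An opaque name: the simplifier would otherwise turn \<open>1\<close> into
  \<open>Suc 0\<close> and unfold \<open>Ck_on\<close> by its recursion.\<close>

definition C1_on :: "'a::euclidean_space set \<Rightarrow> ('a \<Rightarrow> 'b::euclidean_space) \<Rightarrow> bool" where
  "C1_on = Ck_on 1"

lemmas C1_on_subset = Ck_on_subset[of 1, folded C1_on_def]
lemmas C1_on_cong = Ck_on_cong[of _ _ _ 1, folded C1_on_def]
lemmas C1_on_locally = Ck_on_locally[of _ 1, folded C1_on_def]

text \<open>Uniqueness of the Frechet derivative allows any family of derivatives as a witness.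
  Continuity is asked for each fixed direction, as in \<open>Ck_on\<close>.\<close>

lemma C1_onI:
  assumes "\<And>x. x \<in> S \<Longrightarrow> (f has_derivative f' x) (at x)"
    and "\<And>v. continuous_on S (\<lambda>x. f' x v)"
  shows "C1_on S f"
proof -
  have "frechet_derivative f (at x) = f' x" if "x \<in> S" for x
    using frechet_derivative_at[OF assms(1)[OF that]] by simp
  then have "continuous_on S (\<lambda>x. frechet_derivative f (at x) v)" for v
    using assms(2)[of v] continuous_on_cong[of S S "\<lambda>x. frechet_derivative f (at x) v" "\<lambda>x. f' x v"]
    by simp
  then show ?thesis
    using assms(1) by (auto simp: C1_on_def intro: differentiableI)
qed

lemma C1_on_derivative:
  assumes "C1_on S f" "x \<in> S"
  shows "(f has_derivative frechet_derivative f (at x)) (at x)"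
  using assms by (simp add: C1_on_def frechet_derivative_works)

lemma C1_on_differentiable: "C1_on S f \<Longrightarrow> x \<in> S \<Longrightarrow> f differentiable (at x)"
  by (simp add: C1_on_def)

lemma C1_on_continuous_derivative:
  "C1_on S f \<Longrightarrow> continuous_on S (\<lambda>x. frechet_derivative f (at x) v)"
  by (simp add: C1_on_def)

lemma C1_on_continuous: "C1_on S f \<Longrightarrow> continuous_on S f"
  by (simp add: C1_on_def continuous_at_imp_continuous_on differentiable_imp_continuous_within)

lemma Ck_on_2_C1: "Ck_on 2 S f \<Longrightarrow> C1_on S f"
  by (simp add: C1_on_def numeral_2_eq_2 continuous_at_imp_continuous_on
      differentiable_imp_continuous_within)

lemma Ck_on_2_C1_derivative: "Ck_on 2 S f \<Longrightarrow> C1_on S (\<lambda>x. frechet_derivative f (at x) v)"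
  by (simp add: C1_on_def numeral_2_eq_2)

section \<open>Families of linear maps, and the algebra of C^1 maps\<close>

lemma linear_sum_Basis:
  fixes L :: "'a::euclidean_space \<Rightarrow> 'b::real_vector"
  assumes "linear L"
  shows "L w = (\<Sum>b\<in>Basis. (w \<bullet> b) *\<^sub>R L b)"
proof -
  have "L w = L (\<Sum>b\<in>Basis. (w \<bullet> b) *\<^sub>R b)" by (simp add: euclidean_representation)
  also have "\<dots> = (\<Sum>b\<in>Basis. (w \<bullet> b) *\<^sub>R L b)"
    by (simp add: linear_sum[OF assms] linear_cmul[OF assms])
  finally show ?thesis .
qed

text \<open>A linear map is determined by its finitely many values on the basis, so continuity for
  fixed arguments extends to arguments that vary with the point. This supplies the continuity of the
  composed derivative in the chain rule.\<close>

lemma continuous_on_linear_family: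
  fixes L :: "'c::topological_space \<Rightarrow> 'a::euclidean_space \<Rightarrow> 'b::real_normed_vector"
  assumes "\<And>x. x \<in> S \<Longrightarrow> linear (L x)" "\<And>b. continuous_on S (\<lambda>x. L x b)" "continuous_on S w"
  shows "continuous_on S (\<lambda>x. L x (w x))"
proof -
  have "continuous_on S (\<lambda>x. \<Sum>b\<in>Basis. (w x \<bullet> b) *\<^sub>R L x b)"
    by (intro continuous_intros assms)
  then show ?thesis
    by (rule continuous_on_eq) (rule linear_sum_Basis[OF assms(1), symmetric])
qed

lemma C1_on_compose:
  assumes f: "C1_on S f" and g: "C1_on T g" and "f ` S \<subseteq> T"
  shows "C1_on S (\<lambda>x. g (f x))"
proof (rule C1_onI)
  show "((\<lambda>x. g (f x)) has_derivative
      (\<lambda>v. frechet_derivative g (at (f x)) (frechet_derivative f (at x) v))) (at x)"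
    if "x \<in> S" for x
    by (rule has_derivative_compose[OF C1_on_derivative[OF f that] C1_on_derivative[OF g]])
      (use assms(3) that in auto)
  fix v
  have lin: "linear (frechet_derivative g (at (f x)))" if "x \<in> S" for x
    by (rule has_derivative_linear[OF C1_on_derivative[OF g]]) (use assms(3) that in auto)
  have cont: "continuous_on S (\<lambda>x. frechet_derivative g (at (f x)) b)" for b
    by (rule continuous_on_compose2[OF C1_on_continuous_derivative[OF g] C1_on_continuous[OF f]
          assms(3)])
  show "continuous_on S
      (\<lambda>x. frechet_derivative g (at (f x)) (frechet_derivative f (at x) v))"
    by (rule continuous_on_linear_family[OF lin cont C1_on_continuous_derivative[OF f]])
qed

lemma C1_on_const: "C1_on S (\<lambda>x. c)"
  by (rule C1_onI[where f' = "\<lambda>x v. 0"]) auto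

lemma C1_on_linear:
  assumes "linear L" "C1_on S f" shows "C1_on S (\<lambda>x. L (f x))"
proof -
  have "C1_on UNIV L"
    using assms(1) by (intro C1_onI[where f' = "\<lambda>x. L"])
      (auto intro: linear_imp_has_derivative)
  with C1_on_compose[OF assms(2) this] show ?thesis by simp
qed

lemma C1_on_id: "C1_on S (\<lambda>x. x)"
  by (rule C1_onI[where f' = "\<lambda>x v. v"]) auto

lemma C1_on_fst: "C1_on S f \<Longrightarrow> C1_on S (\<lambda>x. fst (f x))"
  by (rule C1_on_linear[OF linear_fst])

lemma C1_on_snd: "C1_on S f \<Longrightarrow> C1_on S (\<lambda>x. snd (f x))"
  by (rule C1_on_linear[OF linear_snd])

lemma C1_on_Pair:
  assumes "C1_on S f" "C1_on S g" shows "C1_on S (\<lambda>x. (f x, g x))"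
  by (rule C1_onI[where f' = "\<lambda>x v. (frechet_derivative f (at x) v, frechet_derivative g (at x) v)"])
    (auto intro!: has_derivative_Pair C1_on_derivative assms continuous_on_Pair
      C1_on_continuous_derivative)

lemma C1_on_add:
  assumes "C1_on S f" "C1_on S g" shows "C1_on S (\<lambda>x. f x + g x)"
  by (rule C1_onI[where f' = "\<lambda>x v. frechet_derivative f (at x) v + frechet_derivative g (at x) v"])
    (auto intro!: has_derivative_add C1_on_derivative assms continuous_on_add
      C1_on_continuous_derivative)

lemma C1_on_scaleR:
  assumes "C1_on S r" "C1_on S f" shows "C1_on S (\<lambda>x. r x *\<^sub>R f x)"
  by (rule C1_onI[where f' = "\<lambda>x v. r x *\<^sub>R frechet_derivative f (at x) v +
        frechet_derivative r (at x) v *\<^sub>R f x"])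
    (auto intro!: has_derivative_scaleR C1_on_derivative assms continuous_on_add
      continuous_on_scaleR C1_on_continuous_derivative intro: C1_on_continuous[OF assms(1)]
      C1_on_continuous[OF assms(2)])

lemma C1_on_mult:
  fixes f g :: "'a::euclidean_space \<Rightarrow> real"
  shows "C1_on S f \<Longrightarrow> C1_on S g \<Longrightarrow> C1_on S (\<lambda>x. f x * g x)"
  using C1_on_scaleR[of S f g] by simp

lemma C1_on_diff: "C1_on S f \<Longrightarrow> C1_on S g \<Longrightarrow> C1_on S (\<lambda>x. f x - g x)"
  using C1_on_add[of S f "\<lambda>x. (-1) *\<^sub>R g x"] C1_on_scaleR[OF C1_on_const, of S g "-1"] by simp

lemma C1_on_sum: "(\<And>i. i \<in> I \<Longrightarrow> C1_on S (f i)) \<Longrightarrow> C1_on S (\<lambda>x. \<Sum>i\<in>I. f i x)"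
  by (induction I rule: infinite_finite_induct) (auto intro: C1_on_const C1_on_add)

lemma C1_on_prod:
  fixes f :: "'i \<Rightarrow> 'a::euclidean_space \<Rightarrow> real"
  shows "(\<And>i. i \<in> I \<Longrightarrow> C1_on S (f i)) \<Longrightarrow> C1_on S (\<lambda>x. \<Prod>i\<in>I. f i x)"
  by (induction I rule: infinite_finite_induct) (auto intro: C1_on_const C1_on_mult)

lemma C1_on_inverse:
  fixes f :: "'a::euclidean_space \<Rightarrow> real"
  assumes "C1_on S f" "\<And>x. x \<in> S \<Longrightarrow> f x \<noteq> 0"
  shows "C1_on S (\<lambda>x. inverse (f x))"
proof (rule C1_onI)
  show "((\<lambda>x. inverse (f x)) has_derivative
      (\<lambda>v. - (inverse (f x) * frechet_derivative f (at x) v * inverse (f x)))) (at x)"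
    if "x \<in> S" for x
    by (rule Deriv.has_derivative_inverse[OF assms(2)[OF that] C1_on_derivative[OF assms(1) that]])
  show "continuous_on S (\<lambda>x. - (inverse (f x) * frechet_derivative f (at x) v * inverse (f x)))"
    for v
    using C1_on_continuous[OF assms(1)] C1_on_continuous_derivative[OF assms(1)] assms(2)
    by (intro continuous_intros) auto
qed

lemma C1_on_vec_nth:
  fixes f :: "'a::euclidean_space \<Rightarrow> real ^ 'n"
  shows "C1_on S f \<Longrightarrow> C1_on S (\<lambda>x. f x $ i)"
  by (rule C1_on_linear[of "\<lambda>v. v $ i"]) (auto simp: linear_iff)

lemma C1_on_vec_lambda:
  fixes f :: "'n::finite \<Rightarrow> 'a::euclidean_space \<Rightarrow> real"
  assumes "\<And>i. C1_on S (f i)"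
  shows "C1_on S (\<lambda>x. \<chi> i. f i x)"
proof -
  have "(\<chi> i. f i x) = (\<Sum>i\<in>UNIV. f i x *\<^sub>R axis i (1::real))" for x
    by (simp add: vec_eq_iff axis_def if_distrib cong: if_cong)
  then show ?thesis
    by (simp add: C1_on_sum C1_on_scaleR C1_on_const assms)
qed

text \<open>Linearity is available only at points of \<open>S\<close>, so the expansion in the basis
  is a possibly different function elsewhere; openness of \<open>S\<close> lets it stand in for the
  original one.\<close>

lemma C1_on_linear_family:
  assumes "open S" "\<And>x. x \<in> S \<Longrightarrow> linear (L x)" "\<And>b. C1_on S (\<lambda>x. L x b)" "C1_on S w"
  shows "C1_on S (\<lambda>x. L x (w x))"
proof -
  have "C1_on S (\<lambda>x. \<Sum>b\<in>Basis. (w x \<bullet> b) *\<^sub>R L x b)"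
    by (intro C1_on_sum C1_on_scaleR assms C1_on_linear[of "\<lambda>v. v \<bullet> _"])
      (auto simp: linear_iff inner_add_left)
  then show ?thesis
    by (rule C1_on_cong[OF assms(1), rotated]) (rule linear_sum_Basis[OF assms(2), symmetric])
qed

text \<open>Here class C^2 enters: one derivative is spent on forming the tangent map, and what
  remains is a family of linear maps depending on the base point in a C^1 way.\<close>

lemma C1_on_tangent_map:
  assumes "open S" "Ck_on 2 S f"
  shows "C1_on (S \<times> UNIV) (\<lambda>z. (f (fst z), frechet_derivative f (at (fst z)) (snd z)))"
proof (rule C1_on_Pair)
  have 1: "C1_on (S \<times> UNIV) fst" using C1_on_fst[OF C1_on_id] .
  show "C1_on (S \<times> UNIV) (\<lambda>z. f (fst z))"
    by (rule C1_on_compose[OF 1 Ck_on_2_C1[OF assms(2)]]) auto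
  show "C1_on (S \<times> UNIV) (\<lambda>z. frechet_derivative f (at (fst z)) (snd z))"
  proof (rule C1_on_linear_family[where L = "\<lambda>z. frechet_derivative f (at (fst z))" and w = snd])
    show "open (S \<times> (UNIV :: 'a set))" using assms(1) by (simp add: open_Times)
    show "linear (frechet_derivative f (at (fst z)))" if "z \<in> S \<times> UNIV" for z :: "'a \<times> 'a"
      using C1_on_derivative[OF Ck_on_2_C1[OF assms(2)], of "fst z"] that has_derivative_linear
      by (auto simp: mem_Times_iff)
    show "C1_on (S \<times> UNIV) (\<lambda>z. frechet_derivative f (at (fst z)) b)" for b
      by (rule C1_on_compose[OF 1 Ck_on_2_C1_derivative[OF assms(2)]]) auto
    show "C1_on (S \<times> UNIV) snd" using C1_on_snd[OF C1_on_id] .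
  qed
qed

section \<open>Linear systems with C^1 coefficients\<close>

lemma C1_on_det:
  fixes A :: "'a::euclidean_space \<Rightarrow> real ^ 'n ^ 'n"
  assumes "\<And>i j. C1_on S (\<lambda>x. A x $ i $ j)"
  shows "C1_on S (\<lambda>x. det (A x))"
  unfolding det_def by (intro C1_on_sum C1_on_mult C1_on_const C1_on_prod assms)

text \<open>By Cramer's rule.\<close>

lemma C1_on_linear_solution:
  fixes L :: "'a::euclidean_space \<Rightarrow> real ^ 'n \<Rightarrow> real ^ 'n"
  assumes "open S" "\<And>x. x \<in> S \<Longrightarrow> linear (L x)" "\<And>x. x \<in> S \<Longrightarrow> inj (L x)"
    and "\<And>b. C1_on S (\<lambda>x. L x b)" "C1_on S r" "\<And>x. x \<in> S \<Longrightarrow> L x (w x) = r x"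
  shows "C1_on S w"
proof -
  define A where "A x = matrix (L x)" for x
  have A: "C1_on S (\<lambda>x. A x $ i $ j)" for i j
    unfolding A_def matrix_def using C1_on_vec_nth[OF assms(4)] by simp
  \<comment> \<open>An injective endomorphism has non-zero determinant, so the divisor in Cramer's
    rule never vanishes on \<open>S\<close>.\<close>
  have det: "det (A x) \<noteq> 0" if "x \<in> S" for x
    using assms(2,3)[OF that] det_nz_iff_inj by (auto simp: A_def)
  have sol: "w x = (\<chi> k. det (\<chi> i j. if j = k then r x $ i else A x $ i $ j) * inverse (det (A x)))"
    if "x \<in> S" for x
  proof -
    have "A x *v w x = r x"
      using assms(2,6)[OF that] by (simp add: A_def matrix_works)
    with cramer[OF det[OF that], of "w x" "r x"] show ?thesis by (simp add: divide_inverse)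
  qed
  have ent: "C1_on S (\<lambda>x. (\<chi> i j. if j = k then r x $ i else A x $ i $ j) $ i $ j)" for i j k
    by (cases "j = k") (auto intro: A C1_on_vec_nth assms)
  have "C1_on S
      (\<lambda>x. \<chi> k. det (\<chi> i j. if j = k then r x $ i else A x $ i $ j) * inverse (det (A x)))"
    by (intro C1_on_vec_lambda C1_on_mult C1_on_inverse C1_on_det det A ent)
  then show ?thesis
    by (rule C1_on_cong[OF assms(1), rotated]) (simp add: sol)
qed

section \<open>Affine maps\<close>

lemma affine_map_comp: "affine_map f \<Longrightarrow> affine_map g \<Longrightarrow> affine_map (\<lambda>x. f (g x))"
proof -
  assume "affine_map f" "affine_map g"
  then obtain l b l' b' where "linear l" "\<And>y. f y = l y + b" "linear l'" "\<And>y. g y = l' y + b'"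
    unfolding affine_map_def by blast
  then show ?thesis
    unfolding affine_map_def
    by (intro exI[of _ "l \<circ> l'"] exI[of _ "l b' + b"]) (auto simp: linear_compose linear_add)
qed

lemma affine_map_linear: "linear l \<Longrightarrow> affine_map l"
  unfolding affine_map_def by (intro exI[of _ l] exI[of _ 0]) simp

lemma affine_map_const: "affine_map (\<lambda>x. c)"
  unfolding affine_map_def by (intro exI[of _ "\<lambda>x. 0"] exI[of _ c]) (simp add: linear_zero)

lemma affine_map_add: "affine_map f \<Longrightarrow> affine_map g \<Longrightarrow> affine_map (\<lambda>x. f x + g x)"
proof -
  assume "affine_map f" "affine_map g"
  then obtain l b l' b' where "linear l" "\<And>y. f y = l y + b" "linear l'" "\<And>y. g y = l' y + b'"
    unfolding affine_map_def by blast
  then show ?thesis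
    unfolding affine_map_def
    by (intro exI[of _ "\<lambda>x. l x + l' x"] exI[of _ "b + b'"]) (auto simp: linear_compose_add)
qed

lemma affine_map_Pair: "affine_map f \<Longrightarrow> affine_map g \<Longrightarrow> affine_map (\<lambda>x. (f x, g x))"
proof -
  assume "affine_map f" "affine_map g"
  then obtain l b l' b' where "linear l" "\<And>y. f y = l y + b" "linear l'" "\<And>y. g y = l' y + b'"
    unfolding affine_map_def by blast
  then show ?thesis
    unfolding affine_map_def
    by (intro exI[of _ "\<lambda>x. (l x, l' x)"] exI[of _ "(b, b')"])
      (auto simp: linear_iff)
qed

section \<open>Charts and tangent vectors\<close>

lemma is_chart_inj: "is_chart X c \<Longrightarrow> inj_on (cmap c) (cdom c)"
  using homeomorphic_imp_injective_map[of "subtopology X (cdom c)" _ "cmap c"] openin_subset[of X "cdom c"]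
  by (auto simp: is_chart_def Int_absorb1)

lemma is_chart_subset: "is_chart X c \<Longrightarrow> cdom c \<subseteq> topspace X"
  by (simp add: is_chart_def openin_subset)

lemma is_chart_openin_preimage:
  assumes "is_chart X c" "open W"
  shows "openin X (cdom c \<inter> cmap c -` W)"
proof -
  have cont: "continuous_map (subtopology X (cdom c)) (top_of_set (cmap c ` cdom c)) (cmap c)"
    using assms(1) homeomorphic_imp_continuous_map by (auto simp: is_chart_def)
  have "openin (top_of_set (cmap c ` cdom c)) (cmap c ` cdom c \<inter> W)"
    using assms(2) by (simp add: openin_open_Int)
  from openin_continuous_map_preimage[OF cont this]
  have "openin (subtopology X (cdom c)) (cdom c \<inter> cmap c -` W)"
    using is_chart_subset[OF assms(1)]
    by (auto elim!: back_subst[of "openin _"])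
  then show ?thesis
    using assms(1) by (auto simp: is_chart_def intro: openin_trans_full)
qed

lemma is_chart_open_image:
  assumes "is_chart X c" "openin X U"
  shows "open (cmap c ` (cdom c \<inter> U))"
proof -
  have "open_map (subtopology X (cdom c)) (top_of_set (cmap c ` cdom c)) (cmap c)"
    using assms(1) homeomorphic_imp_open_map by (auto simp: is_chart_def)
  moreover have "openin (subtopology X (cdom c)) (cdom c \<inter> U)"
    using assms(2) by (metis openin_subtopology_Int2)
  ultimately have "openin (top_of_set (cmap c ` cdom c)) (cmap c ` (cdom c \<inter> U))"
    by (simp add: open_map_def)
  then show ?thesis
    using assms(1) openin_open_trans by (auto simp: is_chart_def)
qed

text \<open>Openness of images and preimages replaces the homeomorphism onto the image. In this form
  restricted charts, tangent charts and charts of the fibre product can be checked.\<close>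

lemma is_chartI:
  assumes "openin X (cdom c)" "inj_on (cmap c) (cdom c)"
    and img: "\<And>U. openin X U \<Longrightarrow> open (cmap c ` (cdom c \<inter> U))"
    and pre: "\<And>W. open W \<Longrightarrow> openin X (cdom c \<inter> cmap c -` W)"
  shows "is_chart X c"
proof -
  have top: "topspace (subtopology X (cdom c)) = cdom c"
    using openin_subset[OF assms(1)] by auto
  have "homeomorphic_map (subtopology X (cdom c)) (top_of_set (cmap c ` cdom c)) (cmap c)"
  proof (rule bijective_open_imp_homeomorphic_map)
    show "continuous_map (subtopology X (cdom c)) (top_of_set (cmap c ` cdom c)) (cmap c)"
      unfolding continuous_map_def
    proof (intro conjI allI impI)
      fix V assume "openin (top_of_set (cmap c ` cdom c)) V"
      then obtain W where W: "open W" "V = cmap c ` cdom c \<inter> W"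
        by (auto simp: openin_open)
      have "{x \<in> topspace (subtopology X (cdom c)). cmap c x \<in> V} = cdom c \<inter> (cdom c \<inter> cmap c -` W)"
        unfolding top W by auto
      then show "openin (subtopology X (cdom c)) {x \<in> topspace (subtopology X (cdom c)). cmap c x \<in> V}"
        using pre[OF W(1)] by (metis openin_subtopology_Int2)
    qed (use top in auto)
    show "open_map (subtopology X (cdom c)) (top_of_set (cmap c ` cdom c)) (cmap c)"
      unfolding open_map_def
    proof (intro allI impI)
      fix V assume "openin (subtopology X (cdom c)) V"
      then obtain U where U: "openin X U" "V = cdom c \<inter> U"
        by (auto simp: openin_subtopology)
      then show "openin (top_of_set (cmap c ` cdom c)) (cmap c ` V)"
        using img[OF U(1)] by (auto intro: open_subset)
    qed
  qed (use top assms in auto)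
  moreover have "open (cmap c ` cdom c)"
    using img[OF assms(1)] by simp
  ultimately show ?thesis
    using assms(1) by (simp add: is_chart_def)
qed

lemma local_rep_eq:
  "inj_on (cmap c) (cdom c) \<Longrightarrow> p \<in> cdom c \<Longrightarrow> local_rep c d f (cmap c p) = cmap d (f p)"
  by (simp add: local_rep_def)

text \<open>The intermediate chart cancels only at points that \<open>f\<close> sends into its
  domain. Continuity of \<open>f\<close> makes this an open set of coordinates, so the derivative
  found by the chain rule carries over to the representative of the composite.\<close>

lemma has_derivative_local_rep_compose:
  assumes c: "is_chart X c" and d: "is_chart Y d" and f: "continuous_map X Y f"
    and p: "p \<in> cdom c" "f p \<in> cdom d"
    and D1: "(local_rep c d f has_derivative D1) (at (cmap c p))"
    and D2: "(local_rep d e g has_derivative D2) (at (cmap d (f p)))"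
  shows "(local_rep c e (\<lambda>q. g (f q)) has_derivative (\<lambda>v. D2 (D1 v))) (at (cmap c p))"
proof -
  define S where "S = cmap c ` (cdom c \<inter> {q \<in> topspace X. f q \<in> cdom d})"
  have "open S"
    unfolding S_def using d by (intro is_chart_open_image[OF c] openin_continuous_map_preimage[OF f])
      (simp add: is_chart_def)
  have "cmap c p \<in> S"
    using p is_chart_subset[OF c] by (auto simp: S_def)
  have eq: "local_rep c d f (cmap c p) = cmap d (f p)"
    by (rule local_rep_eq[OF is_chart_inj[OF c] p(1)])
  have "((\<lambda>z. local_rep d e g (local_rep c d f z)) has_derivative (\<lambda>v. D2 (D1 v))) (at (cmap c p))"
    by (rule has_derivative_compose[OF D1]) (simp add: eq D2)
  then show ?thesis
  proof (rule has_derivative_transform_within_open[OF _ \<open>open S\<close> \<open>cmap c p \<in> S\<close>])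
    fix z assume "z \<in> S"
    then obtain q where "q \<in> cdom c" "f q \<in> cdom d" "z = cmap c q" by (auto simp: S_def)
    then show "local_rep d e g (local_rep c d f z) = local_rep c e (\<lambda>q. g (f q)) z"
      using is_chart_inj[OF c] is_chart_inj[OF d] by (simp add: local_rep_eq)
  qed
qed

section \<open>Tangent spaces in charts\<close>

lemma tspaceD:
  assumes "u \<in> tspace M p"
  shows "fst u = p" "p \<in> carr M"
    "c \<in> charts_at M p \<Longrightarrow> d \<in> charts_at M p \<Longrightarrow>
      snd u d = frechet_derivative (transition c d) (at (cmap c p)) (snd u c)"
    "c \<notin> charts_at M p \<Longrightarrow> snd u c = 0"
  using assms unfolding tspace_def mem_Collect_eq case_prod_beta by blast+

text \<open>The part of \<open>manifold\<close> on which the vector space structure of tangent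
  spaces rests. For Euclidean space it is this part that is established below.\<close>

definition differentiable_manifold :: "('p, 'e::euclidean_space) manifold_data \<Rightarrow> bool" where
  "differentiable_manifold M \<longleftrightarrow>
     (\<forall>c\<in>atlas M. is_chart (topo M) c) \<and> (\<Union>c\<in>atlas M. cdom c) = carr M \<and>
     (\<forall>c\<in>atlas M. \<forall>d\<in>atlas M. \<forall>p \<in> cdom c \<inter> cdom d. transition c d differentiable at (cmap c p))"

lemma manifold_imp_differentiable: "manifold M \<Longrightarrow> differentiable_manifold M"
  unfolding manifold_def differentiable_manifold_def C2_compatible_def
  by (auto dest!: Ck_on_2_C1 intro!: C1_on_differentiable)

context
  fixes M :: "('p, 'e::euclidean_space) manifold_data"
  assumes M: "differentiable_manifold M"
begin

lemma charts_atD: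
  assumes "c \<in> charts_at M p"
  shows "c \<in> atlas M" "p \<in> cdom c" "is_chart (topo M) c" "inj_on (cmap c) (cdom c)" "p \<in> carr M"
proof -
  show *: "c \<in> atlas M" "p \<in> cdom c" using assms by (simp_all add: charts_at_def)
  then show ch: "is_chart (topo M) c" using M by (simp add: differentiable_manifold_def)
  show "inj_on (cmap c) (cdom c)" by (rule is_chart_inj[OF ch])
  show "p \<in> carr M" using is_chart_subset[OF ch] *(2) ..
qed

lemma charts_at_nonempty:
  assumes "p \<in> carr M"
  shows "\<exists>c. c \<in> charts_at M p"
proof -
  have "p \<in> (\<Union>c\<in>atlas M. cdom c)"
    using M assms by (simp add: differentiable_manifold_def)
  then show ?thesis by (auto simp: charts_at_def)
qed

lemma transition_derivative:
  assumes "c \<in> charts_at M p" "d \<in> charts_at M p"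
  shows "(transition c d has_derivative frechet_derivative (transition c d) (at (cmap c p)))
    (at (cmap c p))"
proof -
  have "transition c d differentiable at (cmap c p)"
    using M charts_atD(1,2)[OF assms(1)] charts_atD(1,2)[OF assms(2)]
    by (simp add: differentiable_manifold_def)
  then show ?thesis by (simp add: frechet_derivative_works)
qed

lemmas transition_linear = has_derivative_linear[OF transition_derivative]

text \<open>Cocycle rule for derivatives of transition maps; through it \<open>tvec\<close> obeys
  the transformation law in \<open>tspace\<close>.\<close>

lemma transition_chain:
  assumes "c \<in> charts_at M p" "d \<in> charts_at M p" "e \<in> charts_at M p"
  shows "frechet_derivative (transition d e) (at (cmap d p))
      (frechet_derivative (transition c d) (at (cmap c p)) v) =
    frechet_derivative (transition c e) (at (cmap c p)) v"
proof -
  have "(transition c e has_derivative (\<lambda>v. frechet_derivative (transition d e) (at (cmap d p))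
      (frechet_derivative (transition c d) (at (cmap c p)) v))) (at (cmap c p))"
    by (rule has_derivative_local_rep_compose[OF charts_atD(3)[OF assms(1)] charts_atD(3)[OF assms(2)]
          continuous_map_id[unfolded id_def] charts_atD(2)[OF assms(1)] charts_atD(2)[OF assms(2)]
          transition_derivative[OF assms(1,2)] transition_derivative[OF assms(2,3)]])
  from frechet_derivative_at[OF this] show ?thesis by metis
qed

lemma transition_self:
  assumes "c \<in> charts_at M p"
  shows "frechet_derivative (transition c c) (at (cmap c p)) v = v"
proof -
  have "open (cmap c ` cdom c)" "cmap c p \<in> cmap c ` cdom c"
    using charts_atD(2,3)[OF assms] by (auto simp: is_chart_def)
  then have "(transition c c has_derivative (\<lambda>v. v)) (at (cmap c p))"
    by (rule has_derivative_transform_within_open[OF has_derivative_ident])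
      (use charts_atD(4)[OF assms] in \<open>auto simp: local_rep_eq\<close>)
  from frechet_derivative_at[OF this] show ?thesis by metis
qed

lemma tvec_in_tspace: "c \<in> charts_at M p \<Longrightarrow> tvec M c p v \<in> tspace M p"
  using charts_atD(5) by (simp add: tvec_def tspace_def transition_chain)

lemma snd_tvec: "c \<in> charts_at M p \<Longrightarrow> snd (tvec M c p v) c = v"
  by (simp add: tvec_def transition_self)

lemma tvec_snd:
  assumes "u \<in> tspace M p" "c \<in> charts_at M p"
  shows "tvec M c p (snd u c) = u"
proof -
  have "(if d \<in> charts_at M p then frechet_derivative (transition c d) (at (cmap c p)) (snd u c) else 0)
    = snd u d" for d
    using tspaceD(3)[OF assms(1) assms(2), of d] tspaceD(4)[OF assms(1), of d] by simp
  moreover have "fst u = p" by (rule tspaceD(1)[OF assms(1)])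
  ultimately show ?thesis by (simp add: tvec_def prod_eq_iff)
qed

text \<open>One chart determines the components in all others, so equality of tangent vectors is
  always reduced to coordinates in a convenient chart.\<close>

lemma tspace_eqI:
  assumes "u \<in> tspace M p" "w \<in> tspace M p" "c \<in> charts_at M p" "snd u c = snd w c"
  shows "u = w"
  by (rule trans[OF sym[OF tvec_snd[OF assms(1,3)]]]) (simp only: assms(4) tvec_snd[OF assms(2,3)])

lemma tvec_add:
  assumes "c \<in> charts_at M p"
  shows "tvec M c p (v + w) = tadd (tvec M c p v) (tvec M c p w)"
  using linear_add[OF transition_linear[OF assms]] by (auto simp: tvec_def tadd_def)

lemma tvec_scale:
  assumes "c \<in> charts_at M p"
  shows "tvec M c p (r *\<^sub>R v) = tscale r (tvec M c p v)"
  using linear_cmul[OF transition_linear[OF assms]] by (auto simp: tvec_def tscale_def)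

end

lemma fst_tvec [simp]: "fst (tvec M c p v) = p"
  by (simp add: tvec_def)

lemma fst_tadd [simp]: "fst (tadd u w) = fst u"
  and snd_tadd [simp]: "snd (tadd u w) c = snd u c + snd w c"
  and fst_tscale [simp]: "fst (tscale r u) = fst u"
  and snd_tscale [simp]: "snd (tscale r u) c = r *\<^sub>R snd u c"
  and fst_tzero [simp]: "fst (tzero p) = p"
  and snd_tzero [simp]: "snd (tzero p) c = 0"
  and fst_tdiff [simp]: "fst (tdiff u w) = fst u"
  and snd_tdiff [simp]: "snd (tdiff u w) c = snd u c - snd w c"
  by (simp_all add: tadd_def tscale_def tzero_def tdiff_def)

context
  fixes M :: "('p, 'e::euclidean_space) manifold_data"
  assumes M: "differentiable_manifold M"
begin

lemma tspace_chart:
  assumes "u \<in> tspace M p"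
  obtains c where "c \<in> charts_at M p"
  using charts_at_nonempty[OF M tspaceD(2)[OF assms]] by blast

lemma tadd_in_tspace:
  assumes "u \<in> tspace M p" "w \<in> tspace M p"
  shows "tadd u w \<in> tspace M p"
proof -
  obtain c where c: "c \<in> charts_at M p" using tspace_chart[OF assms(1)] .
  have "tadd u w = tvec M c p (snd u c + snd w c)"
    by (simp add: tvec_add[OF M c] tvec_snd[OF M _ c] assms)
  then show ?thesis by (simp add: tvec_in_tspace[OF M c])
qed

lemma tscale_in_tspace:
  assumes "u \<in> tspace M p"
  shows "tscale r u \<in> tspace M p"
proof -
  obtain c where c: "c \<in> charts_at M p" using tspace_chart[OF assms(1)] .
  have "tscale r u = tvec M c p (r *\<^sub>R snd u c)"
    by (simp add: tvec_scale[OF M c] tvec_snd[OF M _ c] assms)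
  then show ?thesis by (simp add: tvec_in_tspace[OF M c])
qed

lemma tzero_in_tspace:
  assumes "p \<in> carr M"
  shows "tzero p \<in> tspace M p"
proof -
  obtain c where c: "c \<in> charts_at M p" using charts_at_nonempty[OF M assms] by blast
  have "tzero p = tscale 0 (tvec M c p 0)"
    by (simp add: prod_eq_iff fun_eq_iff)
  then show ?thesis by (simp add: tscale_in_tspace tvec_in_tspace[OF M c])
qed

end

lemma tscale_zero: "tscale 0 u = tzero (fst u)"
  by (simp add: prod_eq_iff fun_eq_iff)

lemma tdiff_eq: "tdiff u w = tadd u (tscale (-1) w)"
  by (simp add: prod_eq_iff fun_eq_iff)

text \<open>Meant for a chart and a restriction of it. They are different indices for the components
  of a tangent vector, but the derivative of the transition between them is the identity.\<close>

lemma tvec_same_coordinates: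
  assumes M: "differentiable_manifold M" and c: "c \<in> charts_at M p" and d: "d \<in> charts_at M p"
    and eq: "cmap d = cmap c"
  shows "tvec M c p v = tvec M d p v"
proof (rule tspace_eqI[OF M tvec_in_tspace[OF M c] tvec_in_tspace[OF M d] d])
  have "transition c d = transition c c" by (simp add: local_rep_def eq)
  then have "snd (tvec M c p v) d = v" using transition_self[OF M c, of v] d by (simp add: tvec_def)
  then show "snd (tvec M c p v) d = snd (tvec M d p v) d" by (simp add: snd_tvec[OF M d])
qed

text \<open>\<open>tmap\<close> is computed in an unspecified chart \<open>c0\<close>. Changing from
  \<open>c0\<close> to \<open>c\<close> before the derivative \<open>D\<close> and from
  \<open>d\<close> to \<open>e\<close> after it shows, by the chain rule, that the choice is
  immaterial.\<close>

lemma tmap_eq_tvec: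
  assumes M: "differentiable_manifold M" and N: "differentiable_manifold N"
    and f: "continuous_map (topo M) (topo N) f"
    and c: "c \<in> charts_at M p" and d: "d \<in> charts_at N (f p)"
    and D: "(local_rep c d f has_derivative D) (at (cmap c p))"
    and u: "u \<in> tspace M p"
  shows "tmap M N f u = tvec N d (f p) (D (snd u c))"
proof -
  define c0 where "c0 = (SOME c. c \<in> charts_at M p)"
  have c0: "c0 \<in> charts_at M p"
    unfolding c0_def using c by (rule someI)
  have "frechet_derivative (local_rep c0 e f) (at (cmap c0 p)) (snd u c0)
      = frechet_derivative (transition d e) (at (cmap d (f p))) (D (snd u c))"
    if e: "e \<in> charts_at N (f p)" for e
  proof -
    have 1: "(local_rep c0 d f has_derivative
        (\<lambda>v. D (frechet_derivative (transition c0 c) (at (cmap c0 p)) v))) (at (cmap c0 p))"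
      by (rule has_derivative_local_rep_compose[OF charts_atD(3)[OF M c0] charts_atD(3)[OF M c]
            continuous_map_id[unfolded id_def] charts_atD(2)[OF M c0] charts_atD(2)[OF M c]
            transition_derivative[OF M c0 c] D])
    have "(local_rep c0 e f has_derivative
        (\<lambda>v. frechet_derivative (transition d e) (at (cmap d (f p)))
          (D (frechet_derivative (transition c0 c) (at (cmap c0 p)) v)))) (at (cmap c0 p))"
      by (rule has_derivative_local_rep_compose[OF charts_atD(3)[OF M c0] charts_atD(3)[OF N d]
            f charts_atD(2)[OF M c0] charts_atD(2)[OF N d] 1 transition_derivative[OF N d e]])
    from frechet_derivative_at[OF this]
    have "frechet_derivative (local_rep c0 e f) (at (cmap c0 p)) (snd u c0) =
        frechet_derivative (transition d e) (at (cmap d (f p)))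
          (D (frechet_derivative (transition c0 c) (at (cmap c0 p)) (snd u c0)))"
      by metis
    moreover have "frechet_derivative (transition c0 c) (at (cmap c0 p)) (snd u c0) = snd u c"
      by (rule tspaceD(3)[OF u c0 c, symmetric])
    ultimately show ?thesis by simp
  qed
  then show ?thesis
    unfolding tmap_def tvec_def tspaceD(1)[OF u] Let_def c0_def[symmetric] by auto
qed

lemma tlinear_tmap:
  assumes M: "differentiable_manifold M" and N: "differentiable_manifold N"
    and f: "continuous_map (topo M) (topo N) f"
    and c: "c \<in> charts_at M p" and d: "d \<in> charts_at N (f p)"
    and D: "(local_rep c d f has_derivative D) (at (cmap c p))"
  shows "tlinear (tspace M p) (tspace N (f p)) (tmap M N f)"
proof -
  note eq = tmap_eq_tvec[OF M N f c d D]
  note lin = has_derivative_linear[OF D]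
  show ?thesis
    unfolding tlinear_def
    by (auto simp: eq tadd_in_tspace[OF M] tscale_in_tspace[OF M] tvec_in_tspace[OF N d]
        tvec_add[OF N d] tvec_scale[OF N d] linear_add[OF lin] linear_cmul[OF lin])
qed

text \<open>Maximality of the atlas admits the smaller chart once it is compatible with all others,
  and its transition maps are those of \<open>c\<close> on smaller open sets.\<close>

lemma restrict_chart_in_atlas:
  assumes M: "manifold M" and c: "c \<in> atlas M" and U: "openin (topo M) U"
  shows "(cdom c \<inter> U, cmap c) \<in> atlas M"
proof -
  let ?c = "(cdom c \<inter> U, cmap c)"
  have ch: "is_chart (topo M) c" using M c by (simp add: manifold_def)
  have "is_chart (topo M) ?c"
  proof (rule is_chartI)
    show "openin (topo M) (cdom ?c)" using ch U by (auto simp: is_chart_def)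
    show "inj_on (cmap ?c) (cdom ?c)" using is_chart_inj[OF ch] by (auto intro: inj_on_subset)
    show "open (cmap ?c ` (cdom ?c \<inter> V))" if "openin (topo M) V" for V
      using is_chart_open_image[OF ch openin_Int[OF U that]] by (simp add: Int_assoc)
    show "openin (topo M) (cdom ?c \<inter> cmap ?c -` W)" if "open W" for W
      using openin_Int[OF U is_chart_openin_preimage[OF ch that]]
      by (simp add: Int_ac)
  qed
  moreover have "C2_compatible ?c d" if d: "d \<in> atlas M" for d
  proof -
    have dch: "is_chart (topo M) d" using M d by (simp add: manifold_def)
    have comp: "Ck_on 2 (cmap c ` (cdom c \<inter> cdom d)) (transition c d)"
      "Ck_on 2 (cmap d ` (cdom c \<inter> cdom d)) (transition d c)"
      using M c d by (auto simp: manifold_def C2_compatible_def)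
    have op: "open (cmap c ` (cdom c \<inter> (U \<inter> cdom d)))"
      by (rule is_chart_open_image[OF ch]) (use U dch in \<open>auto simp: is_chart_def\<close>)
    have ck: "Ck_on 2 (cmap c ` (cdom c \<inter> (U \<inter> cdom d))) (transition c d)"
      by (rule Ck_on_subset[OF comp(1)]) auto
    \<comment> \<open>The inverse inside \<open>transition ?c d\<close> is taken on the smaller
      domain, so the two maps are compared pointwise on the image of that domain.\<close>
    have eq: "transition c d z = transition ?c d z" if "z \<in> cmap c ` (cdom c \<inter> (U \<inter> cdom d))" for z
    proof -
      obtain p where p: "p \<in> cdom c" "p \<in> U" "z = cmap c p" using \<open>z \<in> _\<close> by auto
      have "inj_on (cmap ?c) (cdom ?c)" using is_chart_inj[OF ch] by (auto intro: inj_on_subset)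
      from local_rep_eq[OF this, of p d "\<lambda>p. p"] local_rep_eq[OF is_chart_inj[OF ch] p(1), of d "\<lambda>p. p"]
      show ?thesis using p by simp
    qed
    have "Ck_on 2 (cmap c ` (cdom c \<inter> (U \<inter> cdom d))) (transition ?c d)"
      by (rule Ck_on_cong[OF op eq ck])
    moreover have "Ck_on 2 (cmap d ` (cdom ?c \<inter> cdom d)) (transition d ?c)"
      using Ck_on_subset[OF comp(2), of "cmap d ` (cdom ?c \<inter> cdom d)"] by (auto simp: local_rep_def)
    ultimately show ?thesis
      by (simp add: C2_compatible_def Int_assoc)
  qed
  ultimately have "is_chart (topo M) ?c \<and> (\<forall>d\<in>atlas M. C2_compatible ?c d)" by simp
  moreover have *: "\<forall>e. is_chart (topo M) e \<and> (\<forall>d\<in>atlas M. C2_compatible e d) \<longrightarrow> e \<in> atlas M"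
    using M unfolding manifold_def by (elim conjE)
  ultimately show ?thesis using mp[OF spec[OF *, of ?c]] by iprover
qed

section \<open>Euclidean space as a manifold\<close>

abbreviation std_chart :: "('e, 'e) chart" where
  "std_chart \<equiv> (UNIV, \<lambda>x. x)"

lemma std_chart_in_atlas: "std_chart \<in> atlas (euclidean_manifold :: ('e, 'e::euclidean_space) manifold_data)"
proof -
  have "is_chart euclidean (std_chart :: ('e, 'e) chart)"
    by (rule is_chartI) (auto simp: vimage_def)
  moreover have "Ck_on 2 UNIV (\<lambda>x::'e. x)"
    by (simp add: numeral_2_eq_2 frechet_derivative_ident frechet_derivative_const
        continuous_on_const)
  then have "C2_compatible (std_chart :: ('e, 'e) chart) std_chart"
    by (simp add: C2_compatible_def local_rep_def comp_def inv_into_def inv_def)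
  ultimately show ?thesis by (simp add: euclidean_manifold_def)
qed

lemma std_chart_charts_at: "std_chart \<in> charts_at euclidean_manifold p"
  using std_chart_in_atlas by (simp add: charts_at_def)

lemma topo_euclidean_manifold [simp]: "topo euclidean_manifold = euclidean"
  by (simp add: euclidean_manifold_def)

text \<open>Charts are by definition compatible with the identity chart, so a transition between two
  arbitrary charts is factored through \<open>std_chart\<close>.\<close>

lemma differentiable_euclidean_manifold:
  "differentiable_manifold (euclidean_manifold :: ('e, 'e::euclidean_space) manifold_data)"
  unfolding differentiable_manifold_def
proof (intro conjI ballI)
  let ?E = "euclidean_manifold :: ('e, 'e) manifold_data"
  show chart: "is_chart (topo ?E) c" if "c \<in> atlas ?E" for c
    using that by (simp add: euclidean_manifold_def)
  show "(\<Union>c\<in>atlas ?E. cdom c) = carr ?E"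
    using std_chart_in_atlas[where 'e = 'e] by auto
  fix c d p assume cd: "c \<in> atlas ?E" "d \<in> atlas ?E" "p \<in> cdom c \<inter> cdom d"
  have "transition c std_chart differentiable at (cmap c p)"
    using cd(1,3) by (auto simp: euclidean_manifold_def C2_compatible_def dest!: Ck_on_2_C1
        intro!: C1_on_differentiable)
  moreover have "transition std_chart d differentiable at p"
  proof -
    have "Ck_on 2 (cdom d) (transition std_chart d)"
      using cd(2) by (simp add: euclidean_manifold_def C2_compatible_def)
    then show ?thesis using cd(3) C1_on_differentiable Ck_on_2_C1 by blast
  qed
  ultimately obtain D1 D2 where D: "(transition c std_chart has_derivative D1) (at (cmap c p))"
    "(transition std_chart d has_derivative D2) (at (cmap std_chart p))"
    by (auto simp: differentiable_def)
  from has_derivative_local_rep_compose[OF chart[OF cd(1)] chart[OF std_chart_in_atlas]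
      continuous_map_id[unfolded id_def] _ _ D] cd(3)
  show "transition c d differentiable at (cmap c p)"
    by (auto intro: differentiableI)
qed

section \<open>Tangent bundles and fibre products\<close>

lemma in_cdom_tangent_chart:
  "u \<in> cdom (tangent_chart M c) \<longleftrightarrow> fst u \<in> cdom c \<and> u \<in> tspace M (fst u)"
  unfolding tangent_chart_def by (auto dest: tspaceD(1))

lemma cmap_tangent_chart: "cmap (tangent_chart M c) u = (cmap c (fst u), snd u c)"
  by (simp add: tangent_chart_def)

lemma atlas_tangent_bundle: "atlas (tangent_bundle M) = tangent_chart M ` atlas M"
  by (simp add: tangent_bundle_def)

lemma in_atlas_charts_at: "c \<in> atlas M \<Longrightarrow> p \<in> cdom c \<Longrightarrow> c \<in> charts_at M p"
  by (simp add: charts_at_def)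

context
  fixes M :: "('p, 'e::euclidean_space) manifold_data"
  assumes M: "differentiable_manifold M"
begin

lemma tangent_chart_inj:
  assumes "c \<in> atlas M"
  shows "inj_on (cmap (tangent_chart M c)) (cdom (tangent_chart M c))"
proof (rule inj_onI)
  fix u w assume *: "u \<in> cdom (tangent_chart M c)" "w \<in> cdom (tangent_chart M c)"
    "cmap (tangent_chart M c) u = cmap (tangent_chart M c) w"
  then have c: "c \<in> charts_at M (fst u)"
    using assms by (simp add: in_cdom_tangent_chart charts_at_def)
  have "fst u = fst w"
    using * inj_onD[OF charts_atD(4)[OF M c], of "fst u" "fst w"]
    by (simp add: in_cdom_tangent_chart cmap_tangent_chart)
  then show "u = w"
    using * by (intro tspace_eqI[OF M _ _ c]) (simp_all add: in_cdom_tangent_chart cmap_tangent_chart)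
qed

lemma tvec_in_cdom:
  "c \<in> atlas M \<Longrightarrow> p \<in> cdom c \<Longrightarrow> tvec M c p v \<in> cdom (tangent_chart M c)"
  by (simp add: in_cdom_tangent_chart tvec_in_tspace[OF M] charts_at_def)

lemma cmap_tangent_chart_tvec:
  "c \<in> atlas M \<Longrightarrow> p \<in> cdom c \<Longrightarrow> cmap (tangent_chart M c) (tvec M c p v) = (cmap c p, v)"
  by (simp add: cmap_tangent_chart snd_tvec[OF M] charts_at_def)

lemma local_rep_tangent_chart:
  assumes "c \<in> atlas M" "p \<in> cdom c"
  shows "local_rep (tangent_chart M c) D f (cmap c p, v) = cmap D (f (tvec M c p v))"
  using local_rep_eq[OF tangent_chart_inj[OF assms(1)] tvec_in_cdom[OF assms, of v], of D f]
  by (simp add: cmap_tangent_chart_tvec assms)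

lemma image_tangent_chart:
  assumes "c \<in> atlas M" "S \<subseteq> cdom c"
  shows "cmap (tangent_chart M c) ` {u \<in> cdom (tangent_chart M c). fst u \<in> S} = cmap c ` S \<times> UNIV"
proof (intro equalityI subsetI)
  fix z assume "z \<in> cmap c ` S \<times> (UNIV :: 'e set)"
  then obtain p v where "p \<in> S" "z = (cmap c p, v)" by auto
  moreover have "p \<in> cdom c" using assms(2) \<open>p \<in> S\<close> by auto
  ultimately show "z \<in> cmap (tangent_chart M c) ` {u \<in> cdom (tangent_chart M c). fst u \<in> S}"
    by (intro image_eqI[of _ _ "tvec M c p v"])
      (simp_all add: cmap_tangent_chart_tvec[OF assms(1)] tvec_in_cdom[OF assms(1)])
qed (auto simp: cmap_tangent_chart)

lemma in_carr_tangent_bundle: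
  assumes "u \<in> tspace M p"
  shows "u \<in> carr (tangent_bundle M)"
proof -
  obtain c where c: "c \<in> charts_at M p" using tspace_chart[OF M assms] .
  have "u \<in> cdom (tangent_chart M c) \<inter> cmap (tangent_chart M c) -` UNIV"
    using assms tspaceD(1)[OF assms] charts_atD(2)[OF M c] by (simp add: in_cdom_tangent_chart)
  moreover have "\<exists>C W. cdom (tangent_chart M c) \<inter> cmap (tangent_chart M c) -` UNIV = cdom C \<inter> cmap C -` W \<and>
      C \<in> tangent_chart M ` atlas M \<and> open W"
    using charts_atD(1)[OF M c] by blast
  ultimately show ?thesis
    unfolding tangent_bundle_def by (simp only: topology_generated_by_topspace manifold_data.simps) blast
qed

end

text \<open>In tangent charts the change of coordinates is the tangent map of a C^2 transition of
  the manifold.\<close>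

lemma tangent_transition_C1:
  assumes M: "manifold M" and c: "c \<in> atlas M" and d: "d \<in> atlas M"
  shows "open (cmap (tangent_chart M c) ` (cdom (tangent_chart M c) \<inter> cdom (tangent_chart M d)))"
    and "C1_on (cmap (tangent_chart M c) ` (cdom (tangent_chart M c) \<inter> cdom (tangent_chart M d)))
      (transition (tangent_chart M c) (tangent_chart M d))"
proof -
  note D = manifold_imp_differentiable[OF M]
  define S where "S = cmap c ` (cdom c \<inter> cdom d)"
  have c': "is_chart (topo M) c" and d': "is_chart (topo M) d"
    using D c d by (simp_all add: differentiable_manifold_def)
  have "open S"
    unfolding S_def using d' by (intro is_chart_open_image[OF c']) (simp add: is_chart_def)
  have "cdom (tangent_chart M c) \<inter> cdom (tangent_chart M d) =
      {u \<in> cdom (tangent_chart M c). fst u \<in> cdom c \<inter> cdom d}"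
    by (auto simp: in_cdom_tangent_chart)
  then have img: "cmap (tangent_chart M c) ` (cdom (tangent_chart M c) \<inter> cdom (tangent_chart M d)) =
      S \<times> UNIV"
    using image_tangent_chart[OF D c, of "cdom c \<inter> cdom d"] by (simp add: S_def)
  show "open (cmap (tangent_chart M c) ` (cdom (tangent_chart M c) \<inter> cdom (tangent_chart M d)))"
    unfolding img using \<open>open S\<close> by (simp add: open_Times)
  have "Ck_on 2 S (transition c d)"
    using M c d by (simp add: manifold_def C2_compatible_def S_def)
  note C1_on_tangent_map[OF \<open>open S\<close> this]
  then show "C1_on (cmap (tangent_chart M c) ` (cdom (tangent_chart M c) \<inter> cdom (tangent_chart M d)))
      (transition (tangent_chart M c) (tangent_chart M d))"
    unfolding img
  proof (rule C1_on_cong[rotated 2])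
    show "open (S \<times> (UNIV :: 'b set))" using \<open>open S\<close> by (simp add: open_Times)
    fix z :: "'b \<times> 'b" assume "z \<in> S \<times> UNIV"
    then obtain p v where p: "p \<in> cdom c" "p \<in> cdom d" "z = (cmap c p, v)" by (auto simp: S_def)
    show "(transition c d (fst z), frechet_derivative (transition c d) (at (fst z)) (snd z)) =
        transition (tangent_chart M c) (tangent_chart M d) z"
      unfolding p(3) local_rep_tangent_chart[OF D c p(1)]
      using local_rep_eq[OF is_chart_inj[OF c'] p(1), of d "\<lambda>p. p"] c d p
      by (simp add: cmap_tangent_chart) (simp add: tvec_def charts_at_def)
  qed
qed

text \<open>The topology is generated by preimages of open sets under such charts, so openness of
  preimages is immediate. Openness of images amounts to continuity of the inverse chart, which on a
  generating set is continuity of a transition map.\<close>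

lemma is_chart_tangent_chart:
  assumes M: "manifold M" and c: "c \<in> atlas M"
  shows "is_chart (topo (tangent_bundle M)) (tangent_chart M c)"
proof (rule is_chartI)
  let ?C = "tangent_chart M c"
  let ?G = "{cdom C \<inter> cmap C -` W | C W. C \<in> tangent_chart M ` atlas M \<and> open W}"
  note D = manifold_imp_differentiable[OF M]
  have top: "topo (tangent_bundle M) = topology_generated_by ?G"
    by (simp add: tangent_bundle_def)
  show pre: "openin (topo (tangent_bundle M)) (cdom ?C \<inter> cmap ?C -` W)" if "open W" for W
    unfolding top using c that by (intro topology_generated_by_Basis) blast
  show "openin (topo (tangent_bundle M)) (cdom ?C)"
    using pre[of UNIV] by simp
  show inj: "inj_on (cmap ?C) (cdom ?C)"
    by (rule tangent_chart_inj[OF D c])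
  define h where "h = inv_into (cdom ?C) (cmap ?C)"
  have op: "open (cmap ?C ` cdom ?C)"
    using tangent_transition_C1(1)[OF M c c] by simp
  have "continuous_map (top_of_set (cmap ?C ` cdom ?C)) (topology_generated_by ?G) h"
  proof (rule continuous_on_generated_topo)
    fix U assume "U \<in> ?G"
    then obtain d W where d: "d \<in> atlas M" "U = cdom (tangent_chart M d) \<inter> cmap (tangent_chart M d) -` W"
      "open W" by blast
    let ?S = "cmap ?C ` (cdom ?C \<inter> cdom (tangent_chart M d))"
    have "open (?S \<inter> transition ?C (tangent_chart M d) -` W)"
      by (rule continuous_open_preimage[OF C1_on_continuous tangent_transition_C1(1)[OF M c d(1)] d(3)])
        (rule tangent_transition_C1(2)[OF M c d(1)])
    moreover have "h -` U \<inter> topspace (top_of_set (cmap ?C ` cdom ?C)) =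
        ?S \<inter> transition ?C (tangent_chart M d) -` W"
      using inj by (auto simp: h_def d(2) local_rep_def)
    ultimately show "openin (top_of_set (cmap ?C ` cdom ?C))
        (h -` U \<inter> topspace (top_of_set (cmap ?C ` cdom ?C)))"
      using op by (subst openin_open_eq) auto
  next
    have "cdom ?C \<inter> cmap ?C -` UNIV \<in> ?G" using c by blast
    from Union_upper[OF this] have "cdom ?C \<subseteq> \<Union>?G" by (simp only: vimage_UNIV Int_UNIV_right)
    moreover have "h ` cmap ?C ` cdom ?C = cdom ?C"
      using inj by (force simp: h_def)
    ultimately show "h ` topspace (top_of_set (cmap ?C ` cdom ?C)) \<subseteq> \<Union>?G"
      by simp
  qed
  note cont = this[folded top]
  fix U assume "openin (topo (tangent_bundle M)) U"
  from openin_continuous_map_preimage[OF cont this]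
  have "open {z \<in> cmap ?C ` cdom ?C. h z \<in> U}"
    using op by (simp add: openin_open_eq)
  moreover have "{z \<in> cmap ?C ` cdom ?C. h z \<in> U} = cmap ?C ` (cdom ?C \<inter> U)"
    using inj by (auto simp: h_def)
  ultimately show "open (cmap ?C ` (cdom ?C \<inter> U))" by simp
qed

text \<open>One target chart per source chart suffices: a C^1 representative into a chart containing
  the whole image gives continuity, and composing it with transition maps reaches all the target
  charts over which \<open>smooth_map\<close> quantifies.\<close>

lemma smooth_map_1I:
  assumes M: "\<And>C. C \<in> atlas M \<Longrightarrow> is_chart (topo M) C" "carr M \<subseteq> (\<Union>C\<in>atlas M. cdom C)"
    and N: "\<And>D. D \<in> atlas N \<Longrightarrow> is_chart (topo N) D"
      "\<And>D D'. D \<in> atlas N \<Longrightarrow> D' \<in> atlas N \<Longrightarrow>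
        C1_on (cmap D ` (cdom D \<inter> cdom D')) (transition D D')"
    and f: "\<And>C. C \<in> atlas M \<Longrightarrow> \<exists>D\<in>atlas N. f ` cdom C \<subseteq> cdom D \<and>
      C1_on (cmap C ` cdom C) (local_rep C D f)"
  shows "smooth_map 1 M N f"
  unfolding smooth_map_def
proof (intro conjI ballI)
  \<comment> \<open>Openness is transported through coordinates: the preimage of \<open>U\<close>
    corresponds to the preimage of its open chart image under the continuous representative.\<close>
  have open_rep: "open (cmap C ` (cdom C \<inter> f -` U))"
    if C: "C \<in> atlas M" and D: "D \<in> atlas N" "f ` cdom C \<subseteq> cdom D" "C1_on (cmap C ` cdom C) (local_rep C D f)"
      and U: "openin (topo N) U" for C D U
  proof -
    have "open (cmap C ` cdom C \<inter> local_rep C D f -` (cmap D ` (cdom D \<inter> U)))"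
      by (rule continuous_open_preimage[OF C1_on_continuous[OF D(3)] _ is_chart_open_image[OF N(1)[OF D(1)] U]])
        (use M(1)[OF C] in \<open>simp add: is_chart_def\<close>)
    moreover have "local_rep C D f (cmap C p) \<in> cmap D ` (cdom D \<inter> U) \<longleftrightarrow> f p \<in> U" if p: "p \<in> cdom C" for p
    proof -
      have "f p \<in> cdom D" using D(2) p by auto
      then show ?thesis
        using is_chart_inj[OF N(1)[OF D(1)]]
        by (auto simp: local_rep_eq[OF is_chart_inj[OF M(1)[OF C]] p] dest: inj_onD)
    qed
    ultimately show ?thesis
      by (elim back_subst[of "open"]) auto
  qed
  show "continuous_map (topo M) (topo N) f"
    unfolding continuous_map_def
  proof (intro conjI allI impI)
    show "f \<in> carr M \<rightarrow> carr N"
    proof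
      fix p assume "p \<in> carr M"
      then obtain C where C: "C \<in> atlas M" "p \<in> cdom C" using M(2) by auto
      from f[OF C(1)] obtain D where D: "D \<in> atlas N" "f p \<in> cdom D" using C(2) by auto
      show "f p \<in> carr N" using is_chart_subset[OF N(1)[OF D(1)]] D(2) ..
    qed
    fix U assume U: "openin (topo N) U"
    show "openin (topo M) {p \<in> carr M. f p \<in> U}"
    proof (subst openin_subopen, rule ballI)
      fix p assume "p \<in> {p \<in> carr M. f p \<in> U}"
      then obtain C where C: "C \<in> atlas M" "p \<in> cdom C" "f p \<in> U" using M(2) by auto
      from f[OF C(1)] obtain D where D: "D \<in> atlas N" "f ` cdom C \<subseteq> cdom D"
        "C1_on (cmap C ` cdom C) (local_rep C D f)" by blast
      let ?T = "cdom C \<inter> cmap C -` (cmap C ` (cdom C \<inter> f -` U))"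
      have "openin (topo M) ?T"
        by (rule is_chart_openin_preimage[OF M(1)[OF C(1)] open_rep[OF C(1) D U]])
      moreover have "?T \<subseteq> {p \<in> carr M. f p \<in> U}"
        using is_chart_inj[OF M(1)[OF C(1)]] is_chart_subset[OF M(1)[OF C(1)]] by (auto dest: inj_onD)
      moreover have "p \<in> ?T" using C by auto
      ultimately show "\<exists>T. openin (topo M) T \<and> p \<in> T \<and> T \<subseteq> {p \<in> carr M. f p \<in> U}" by blast
    qed
  qed
  fix C D' assume C: "C \<in> atlas M" and D': "D' \<in> atlas N"
  from f[OF C(1)] obtain D where D: "D \<in> atlas N" "f ` cdom C \<subseteq> cdom D"
    "C1_on (cmap C ` cdom C) (local_rep C D f)" by blast
  let ?S = "cmap C ` (cdom C \<inter> f -` cdom D')"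
  have rep: "local_rep C E f (cmap C p) = cmap E (f p)" if "p \<in> cdom C" for p and E :: "('c, 'd) chart"
    by (rule local_rep_eq[OF is_chart_inj[OF M(1)[OF C]] that])
  have "open ?S"
    by (rule open_rep[OF C D]) (use N(1)[OF D'] in \<open>simp add: is_chart_def\<close>)
  moreover have "C1_on ?S (local_rep C D f)"
    by (rule C1_on_subset[OF D(3)]) auto
  have "C1_on ?S (\<lambda>z. transition D D' (local_rep C D f z))"
    by (rule C1_on_compose[OF \<open>C1_on ?S (local_rep C D f)\<close> N(2)[OF D(1) D']])
      (use D(2) in \<open>auto simp: rep\<close>)
  moreover have "transition D D' (local_rep C D f z) = local_rep C D' f z" if "z \<in> ?S" for z
  proof -
    obtain p where p: "p \<in> cdom C" "z = cmap C p" using \<open>z \<in> ?S\<close> by auto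
    have "f p \<in> cdom D" using D(2) p by auto
    then show ?thesis
      using local_rep_eq[OF is_chart_inj[OF N(1)[OF D(1)]], of "f p" D' "\<lambda>p. p"] p by (simp add: rep)
  qed
  ultimately have "C1_on ?S (local_rep C D' f)" using C1_on_cong by metis
  then show "Ck_on 1 ?S (local_rep C D' f)" by (simp only: C1_on_def)
qed

section \<open>Charts of the fibre product\<close>

definition fibre_product_chart ::
  "('a, 'p, 'b::euclidean_space, 'f::euclidean_space) bundle_data \<Rightarrow> ('p, 'b) chart \<Rightarrow> ('a \<Rightarrow> 'f) \<Rightarrow>
   ('a \<times> ('p, 'b) tvector, ('b \<times> 'f) \<times> 'b) chart" where
  "fibre_product_chart A c \<psi> =
     ({(a, u). a \<in> cdom (affine_chart A c \<psi>) \<and> u \<in> tspace (base A) (proj A a)},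
      \<lambda>(a, u). (cmap (affine_chart A c \<psi>) a, snd u c))"

lemma in_cdom_affine_chart:
  "a \<in> cdom (affine_chart A c \<psi>) \<longleftrightarrow> a \<in> carr (total A) \<and> proj A a \<in> cdom c"
  by (simp add: affine_chart_def)

lemma cmap_affine_chart: "cmap (affine_chart A c \<psi>) a = (cmap c (proj A a), \<psi> a)"
  by (simp add: affine_chart_def)

lemma trivialising_atlas: "trivialising A c \<psi> \<Longrightarrow> c \<in> atlas (base A)"
  by (simp add: trivialising_def)

text \<open>Membership in the carrier is already part of the domain of an affine chart, so the
  charts of \<open>fibre_product\<close> are the named ones.\<close>

lemma atlas_fibre_product:
  "atlas (fibre_product A) = {fibre_product_chart A c \<psi> | c \<psi>. trivialising A c \<psi>}"
proof -
  have "({(a, u) \<in> {(a, u). a \<in> carr (total A) \<and> u \<in> tspace (base A) (proj A a)}.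
      a \<in> cdom (affine_chart A c \<psi>)}, \<lambda>(a, u). (cmap (affine_chart A c \<psi>) a, snd u c)) =
    fibre_product_chart A c \<psi>" for c \<psi>
    by (auto simp: fibre_product_chart_def in_cdom_affine_chart)
  then show ?thesis by (simp add: fibre_product_def Let_def)
qed

lemma carr_fibre_productD:
  assumes "(a, u) \<in> carr (fibre_product A)"
  shows "a \<in> carr (total A)" "u \<in> tspace (base A) (proj A a)"
  using assms by (auto simp: fibre_product_def Let_def)

lemma carr_fibre_productI:
  assumes "differentiable_manifold (base A)" "a \<in> carr (total A)" "u \<in> tspace (base A) (proj A a)"
  shows "(a, u) \<in> carr (fibre_product A)"
  using assms in_carr_tangent_bundle[OF assms(1,3)] by (simp add: fibre_product_def Let_def)

context
  fixes A :: "('a, 'p, 'b::euclidean_space, 'f::euclidean_space) bundle_data"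
  assumes A: "affine_bundle A"
begin

lemma affine_bundleD:
  shows "manifold (total A)" "manifold (base A)" "smooth_map 2 (total A) (base A) (proj A)"
    "proj A ` carr (total A) = carr (base A)"
    and trivs_cover: "(\<Union>t\<in>trivs A. fst t) = carr (base A)"
    and trivs_open: "\<forall>(U, \<psi>)\<in>trivs A. openin (topo (base A)) U"
    and trivialising_charts: "\<forall>c \<psi>. trivialising A c \<psi> \<longrightarrow>
      affine_chart A c \<psi> \<in> atlas (total A) \<and>
      cmap (affine_chart A c \<psi>) ` cdom (affine_chart A c \<psi>) = (cmap c ` cdom c) \<times> UNIV"
  by (insert A[unfolded affine_bundle_def]) (elim conjE, assumption)+

lemma affine_bundle_differentiable:
  "differentiable_manifold (total A)" "differentiable_manifold (base A)"
  using affine_bundleD by (simp_all add: manifold_imp_differentiable)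

lemma affine_chart_image:
  assumes "trivialising A c \<psi>"
  shows "affine_chart A c \<psi> \<in> atlas (total A)"
    "cmap (affine_chart A c \<psi>) ` cdom (affine_chart A c \<psi>) = (cmap c ` cdom c) \<times> UNIV"
  using mp[OF spec[OF spec[OF trivialising_charts]] assms] by simp_all

text \<open>Affine coordinates need a base chart inside the domain of a local trivialisation.
  Restricting a given chart keeps its coordinate map, so coordinate expressions survive.\<close>

lemma trivialising_restriction:
  assumes c: "c \<in> atlas (base A)" and p: "p \<in> cdom c"
  obtains U \<psi> where "trivialising A (cdom c \<inter> U, cmap c) \<psi>" "p \<in> U"
proof -
  have "p \<in> carr (base A)"
    using affine_bundle_differentiable(2) c p in_atlas_charts_at charts_atD(5) by metis
  then obtain U \<psi> where U: "(U, \<psi>) \<in> trivs A" "p \<in> U" unfolding trivs_cover[symmetric] by auto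
  have "openin (topo (base A)) U"
    using trivs_open U(1) by auto
  from restrict_chart_in_atlas[OF affine_bundleD(2) c this]
  have "trivialising A (cdom c \<inter> U, cmap c) \<psi>"
    using U(1) unfolding trivialising_def by auto
  with U(2) show ?thesis using that by blast
qed

lemma trivialising_exists:
  assumes "p \<in> carr (base A)"
  obtains c \<psi> where "trivialising A c \<psi>" "p \<in> cdom c"
proof -
  obtain c where c: "c \<in> charts_at (base A) p"
    using charts_at_nonempty[OF affine_bundle_differentiable(2) assms] by blast
  note c = charts_atD(1,2)[OF affine_bundle_differentiable(2) c]
  from trivialising_restriction[OF c] obtain U \<psi>
    where "trivialising A (cdom c \<inter> U, cmap c) \<psi>" "p \<in> U" .
  then show ?thesis using that[of "(cdom c \<inter> U, cmap c)" \<psi>] c(2) by simp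
qed

lemma proj_in_base: "a \<in> carr (total A) \<Longrightarrow> proj A a \<in> carr (base A)"
  using affine_bundleD(4) by blast

lemma fibre_product_chart_inj:
  assumes "trivialising A c \<psi>"
  shows "inj_on (cmap (fibre_product_chart A c \<psi>)) (cdom (fibre_product_chart A c \<psi>))"
proof (rule inj_onI)
  note D = affine_bundle_differentiable
  fix x y assume *: "x \<in> cdom (fibre_product_chart A c \<psi>)" "y \<in> cdom (fibre_product_chart A c \<psi>)"
    "cmap (fibre_product_chart A c \<psi>) x = cmap (fibre_product_chart A c \<psi>) y"
  obtain a u b w where xy: "x = (a, u)" "y = (b, w)" by (cases x, cases y) 
  have ab: "a \<in> cdom (affine_chart A c \<psi>)" "b \<in> cdom (affine_chart A c \<psi>)"
    "cmap (affine_chart A c \<psi>) a = cmap (affine_chart A c \<psi>) b"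
    "u \<in> tspace (base A) (proj A a)" "w \<in> tspace (base A) (proj A b)" "snd u c = snd w c"
    using * by (simp_all add: xy fibre_product_chart_def)
  have "a = b"
    using inj_onD[OF charts_atD(4)[OF D(1) in_atlas_charts_at[OF affine_chart_image(1)[OF assms] ab(1)]]]
      ab by blast
  moreover have "c \<in> charts_at (base A) (proj A a)"
    using in_atlas_charts_at[OF trivialising_atlas[OF assms]] ab(1) by (simp add: in_cdom_affine_chart)
  ultimately show "x = y"
    using tspace_eqI[OF D(2) ab(4), of w c] ab by (simp add: xy)
qed

lemma fibre_product_chart_image:
  assumes "trivialising A c \<psi>"
  shows "cmap (fibre_product_chart A c \<psi>) ` cdom (fibre_product_chart A c \<psi>) =
    (cmap c ` cdom c \<times> UNIV) \<times> UNIV"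
  unfolding affine_chart_image(2)[OF assms, symmetric]
proof (intro equalityI subsetI)
  fix z assume "z \<in> (cmap (affine_chart A c \<psi>) ` cdom (affine_chart A c \<psi>)) \<times> (UNIV :: 'b set)"
  then obtain a v where a: "a \<in> cdom (affine_chart A c \<psi>)" "z = (cmap (affine_chart A c \<psi>) a, v)"
    by auto
  have c: "c \<in> charts_at (base A) (proj A a)"
    using in_atlas_charts_at[OF trivialising_atlas[OF assms]] a(1) by (simp add: in_cdom_affine_chart)
  show "z \<in> cmap (fibre_product_chart A c \<psi>) ` cdom (fibre_product_chart A c \<psi>)"
    by (rule image_eqI[of _ _ "(a, tvec (base A) c (proj A a) v)"])
      (simp_all add: fibre_product_chart_def a snd_tvec[OF affine_bundle_differentiable(2) c]
        tvec_in_tspace[OF affine_bundle_differentiable(2) c])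
qed (auto simp: fibre_product_chart_def)

text \<open>The base coordinate is shared by the two factors, so this is not a product chart.
  Openness is transported through the charts of \<open>a\<close> and of \<open>u\<close> separately,
  with the common component identified.\<close>

lemma is_chart_fibre_product_chart:
  assumes triv: "trivialising A c \<psi>"
  shows "is_chart (topo (fibre_product A)) (fibre_product_chart A c \<psi>)"
proof (rule is_chartI)
  note D = affine_bundle_differentiable
  let ?C = "fibre_product_chart A c \<psi>" and ?a = "affine_chart A c \<psi>"
    and ?t = "tangent_chart (base A) c"
  let ?P = "{(a, u). a \<in> carr (total A) \<and> u \<in> tspace (base A) (proj A a)}"
  let ?X = "prod_topology (topo (total A)) (topo (tangent_bundle (base A)))"
  have top: "topo (fibre_product A) = subtopology ?X ?P"
    by (simp add: fibre_product_def Let_def)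
  have a: "is_chart (topo (total A)) ?a"
    using D(1) affine_chart_image(1)[OF triv] by (simp add: differentiable_manifold_def)
  have t: "is_chart (topo (tangent_bundle (base A))) ?t"
    by (rule is_chart_tangent_chart[OF affine_bundleD(2) trivialising_atlas[OF triv]])
  have c: "inj_on (cmap c) (cdom c)"
    by (rule is_chart_inj[of "topo (base A)"])
      (use D(2) trivialising_atlas[OF triv] in \<open>simp add: differentiable_manifold_def\<close>)
  show "inj_on (cmap ?C) (cdom ?C)" by (rule fibre_product_chart_inj[OF triv])
  show pre: "openin (topo (fibre_product A)) (cdom ?C \<inter> cmap ?C -` W)" if W: "open W" for W
  proof (subst openin_subopen, rule ballI)
    fix x assume x: "x \<in> cdom ?C \<inter> cmap ?C -` W"
    obtain a u where [simp]: "x = (a, u)" by (cases x)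
    have "(cmap ?a a, snd u c) \<in> W" using x by (simp add: fibre_product_chart_def)
    then obtain W1 W2 where W12: "open W1" "open W2" "cmap ?a a \<in> W1" "snd u c \<in> W2" "W1 \<times> W2 \<subseteq> W"
      using open_prod_elim[OF W] by (metis mem_Sigma_iff)
    let ?U1 = "cdom ?a \<inter> cmap ?a -` W1" and ?U2 = "cdom ?t \<inter> cmap ?t -` (UNIV \<times> W2)"
    have "openin (topo (total A)) ?U1" by (rule is_chart_openin_preimage[OF a W12(1)])
    moreover have "openin (topo (tangent_bundle (base A))) ?U2"
      by (rule is_chart_openin_preimage[OF t]) (simp add: open_Times W12(2))
    ultimately have "openin ?X (?U1 \<times> ?U2)" by (simp add: openin_prod_Times_iff)
    then have "openin (topo (fibre_product A)) ((?U1 \<times> ?U2) \<inter> ?P)"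
      unfolding top by (auto simp: openin_subtopology)
    moreover have "x \<in> (?U1 \<times> ?U2) \<inter> ?P"
      using x W12 by (auto simp: fibre_product_chart_def in_cdom_affine_chart in_cdom_tangent_chart
          cmap_tangent_chart tspaceD(1))
    moreover have "(?U1 \<times> ?U2) \<inter> ?P \<subseteq> cdom ?C \<inter> cmap ?C -` W"
      using W12(5) by (auto simp: fibre_product_chart_def cmap_tangent_chart)
    ultimately show "\<exists>T. openin (topo (fibre_product A)) T \<and> x \<in> T \<and> T \<subseteq> cdom ?C \<inter> cmap ?C -` W"
      by blast
  qed
  show "openin (topo (fibre_product A)) (cdom ?C)" using pre[of UNIV] by simp
  fix V assume "openin (topo (fibre_product A)) V"
  then obtain U where U: "openin ?X U" "V = U \<inter> ?P"
    unfolding top by (auto simp: openin_subtopology)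
  show "open (cmap ?C ` (cdom ?C \<inter> V))"
  proof (subst open_subopen, rule ballI)
    fix z assume "z \<in> cmap ?C ` (cdom ?C \<inter> V)"
    then obtain a u where au: "(a, u) \<in> cdom ?C" "(a, u) \<in> U" "z = (cmap ?a a, snd u c)"
      by (auto simp: U fibre_product_chart_def)
    from mp[OF spec[OF spec[OF iffD1[OF openin_prod_topology_alt U(1)]]] au(2)]
    obtain U1 U2 where U12: "openin (topo (total A)) U1"
      "openin (topo (tangent_bundle (base A))) U2" "a \<in> U1" "u \<in> U2" "U1 \<times> U2 \<subseteq> U"
      by (elim exE conjE)
    define V1 where "V1 = cmap ?a ` (cdom ?a \<inter> U1)"
    define V2 where "V2 = cmap ?t ` (cdom ?t \<inter> U2)"
    have op: "open V1" "open V2"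
      unfolding V1_def V2_def using is_chart_open_image[OF a U12(1)] is_chart_open_image[OF t U12(2)] .
    \<comment> \<open>Coordinates (x, y, dx) with (x, y) coming from \<open>U1\<close> and (x, dx)
      from \<open>U2\<close>. The repeated x forces the vector found in \<open>U2\<close> to sit
      over the projection of the point found in \<open>U1\<close>.\<close>
    define T where "T = {y. fst y \<in> V1 \<and> (fst (fst y), snd y) \<in> V2}"
    have "open T"
    proof -
      have "T = (fst -` V1) \<inter> ((\<lambda>y. (fst (fst y), snd y)) -` V2)" by (auto simp: T_def)
      then show ?thesis
        using op by (auto intro!: open_Int open_vimage continuous_intros)
    qed
    moreover have "z \<in> T"
      using au U12 by (auto simp: T_def V1_def V2_def fibre_product_chart_def in_cdom_affine_chart
          cmap_affine_chart in_cdom_tangent_chart cmap_tangent_chart tspaceD(1)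
          intro!: image_eqI[of _ _ a] image_eqI[of _ _ u])
    moreover have "T \<subseteq> cmap ?C ` (cdom ?C \<inter> V)"
    proof
      fix y assume "y \<in> T"
      then obtain a' u' where *: "a' \<in> cdom ?a" "a' \<in> U1" "fst y = cmap ?a a'"
        "u' \<in> cdom ?t" "u' \<in> U2" "(fst (fst y), snd y) = cmap ?t u'"
        by (auto simp: T_def V1_def V2_def)
      have "cmap c (fst u') = cmap c (proj A a')"
        using * by (simp add: cmap_affine_chart cmap_tangent_chart)
      then have "fst u' = proj A a'"
        using inj_onD[OF c] *(1,4) by (simp add: in_cdom_affine_chart in_cdom_tangent_chart)
      then show "y \<in> cmap ?C ` (cdom ?C \<inter> V)"
        using * U12(5) by (intro image_eqI[of _ _ "(a', u')"])
          (auto simp: fibre_product_chart_def prod_eq_iff cmap_tangent_chart in_cdom_tangent_chart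
            in_cdom_affine_chart U(2))
    qed
    ultimately show "\<exists>T. open T \<and> z \<in> T \<and> T \<subseteq> cmap ?C ` (cdom ?C \<inter> V)" by blast
  qed
qed

text \<open>Such a map keeps the point \<open>a\<close>, so one affine chart serves for source and
  target, and the target chart contains the whole image.\<close>

lemma smooth_map_fibre_product_tangentI:
  fixes \<kappa> :: "'a \<Rightarrow> ('p, 'b) tvector \<Rightarrow> ('a, 'b \<times> 'f) tvector"
  assumes \<kappa>: "\<And>a u. a \<in> carr (total A) \<Longrightarrow> u \<in> tspace (base A) (proj A a) \<Longrightarrow> \<kappa> a u \<in> tspace (total A) a"
    and C1: "\<And>c \<psi>. trivialising A c \<psi> \<Longrightarrow> C1_on ((cmap c ` cdom c \<times> UNIV) \<times> UNIV)
      (local_rep (fibre_product_chart A c \<psi>) (tangent_chart (total A) (affine_chart A c \<psi>)) (\<lambda>(a, u). \<kappa> a u))"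
  shows "smooth_map 1 (fibre_product A) (tangent_bundle (total A)) (\<lambda>(a, u). \<kappa> a u)"
proof (rule smooth_map_1I)
  show "is_chart (topo (fibre_product A)) C" if "C \<in> atlas (fibre_product A)" for C
    using that is_chart_fibre_product_chart by (auto simp: atlas_fibre_product)
  show "is_chart (topo (tangent_bundle (total A))) C" if "C \<in> atlas (tangent_bundle (total A))" for C
    using that is_chart_tangent_chart[OF affine_bundleD(1)] by (auto simp: atlas_tangent_bundle)
  show "C1_on (cmap D ` (cdom D \<inter> cdom D')) (transition D D')"
    if "D \<in> atlas (tangent_bundle (total A))" "D' \<in> atlas (tangent_bundle (total A))" for D D'
    using that tangent_transition_C1(2)[OF affine_bundleD(1)] by (auto simp: atlas_tangent_bundle)
  show "carr (fibre_product A) \<subseteq> (\<Union>C\<in>atlas (fibre_product A). cdom C)"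
  proof
    fix x assume "x \<in> carr (fibre_product A)"
    moreover obtain a u where x: "x = (a, u)" by (cases x)
    ultimately have "(a, u) \<in> carr (fibre_product A)" by simp
    note au = carr_fibre_productD[OF this]
    obtain c \<psi> where "trivialising A c \<psi>" "proj A a \<in> cdom c"
      using trivialising_exists[OF proj_in_base[OF au(1)]] .
    moreover from this have "x \<in> cdom (fibre_product_chart A c \<psi>)"
      using au by (simp add: x fibre_product_chart_def in_cdom_affine_chart)
    ultimately show "x \<in> (\<Union>C\<in>atlas (fibre_product A). cdom C)"
      unfolding atlas_fibre_product by blast
  qed
  fix C assume "C \<in> atlas (fibre_product A)"
  then obtain c \<psi> where C: "C = fibre_product_chart A c \<psi>" and triv: "trivialising A c \<psi>"
    by (auto simp: atlas_fibre_product)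
  show "\<exists>D\<in>atlas (tangent_bundle (total A)). (\<lambda>(a, u). \<kappa> a u) ` cdom C \<subseteq> cdom D \<and>
      C1_on (cmap C ` cdom C) (local_rep C D (\<lambda>(a, u). \<kappa> a u))"
  proof (intro bexI conjI)
    show "tangent_chart (total A) (affine_chart A c \<psi>) \<in> atlas (tangent_bundle (total A))"
      using affine_chart_image(1)[OF triv] by (simp add: atlas_tangent_bundle)
    have "\<kappa> a u \<in> cdom (tangent_chart (total A) (affine_chart A c \<psi>))"
      if "a \<in> cdom (affine_chart A c \<psi>)" "u \<in> tspace (base A) (proj A a)" for a u
    proof -
      have "\<kappa> a u \<in> tspace (total A) a" using that by (intro \<kappa>) (simp_all add: in_cdom_affine_chart)
      then show ?thesis using that(1) by (simp add: in_cdom_tangent_chart tspaceD(1))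
    qed
    then show "(\<lambda>(a, u). \<kappa> a u) ` cdom C \<subseteq> cdom (tangent_chart (total A) (affine_chart A c \<psi>))"
      by (auto simp: C fibre_product_chart_def)
    show "C1_on (cmap C ` cdom C)
        (local_rep C (tangent_chart (total A) (affine_chart A c \<psi>)) (\<lambda>(a, u). \<kappa> a u))"
      unfolding C fibre_product_chart_image[OF triv] by (rule C1[OF triv])
  qed
qed

end

section \<open>Projectable forms\<close>

text \<open>In affine coordinates the projection is \<open>fst\<close>. The assumptions are chart
  memberships instead of \<open>affine_bundle\<close>, so that the ambient bundle is covered as
  well.\<close>

lemma tproj_local:
  assumes T: "differentiable_manifold (total A)" and D: "differentiable_manifold (base A)"
    and cont: "continuous_map (topo (total A)) (topo (base A)) (proj A)"
    and c: "c \<in> atlas (base A)" and ac: "affine_chart A c \<psi> \<in> atlas (total A)"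
    and a: "a \<in> cdom (affine_chart A c \<psi>)"
  shows "tlinear (tspace (total A) a) (tspace (base A) (proj A a)) (tproj A)"
    and "u \<in> tspace (total A) a \<Longrightarrow>
      tproj A u = tvec (base A) c (proj A a) (fst (snd u (affine_chart A c \<psi>)))"
proof -
  let ?a = "affine_chart A c \<psi>"
  have ca: "?a \<in> charts_at (total A) a" by (rule in_atlas_charts_at[OF ac a])
  have cc: "c \<in> charts_at (base A) (proj A a)"
    using in_atlas_charts_at[OF c] a by (simp add: in_cdom_affine_chart)
  have "open (cmap ?a ` cdom ?a)"
    using charts_atD(3)[OF T ca] by (simp add: is_chart_def)
  then have d: "(local_rep ?a c (proj A) has_derivative fst) (at (cmap ?a a))"
  proof (rule has_derivative_transform_within_open[OF bounded_linear_imp_has_derivative[OF bounded_linear_fst]])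
    show "cmap ?a a \<in> cmap ?a ` cdom ?a" using a by simp
    fix z assume "z \<in> cmap ?a ` cdom ?a"
    then obtain a' where "a' \<in> cdom ?a" "z = cmap ?a a'" by auto
    then show "fst z = local_rep ?a c (proj A) z"
      using local_rep_eq[OF charts_atD(4)[OF T ca], of a' c "proj A"] by (simp add: cmap_affine_chart)
  qed
  show "tlinear (tspace (total A) a) (tspace (base A) (proj A a)) (tproj A)"
    unfolding tproj_def by (rule tlinear_tmap[OF T D cont ca cc d])
  show "u \<in> tspace (total A) a \<Longrightarrow> tproj A u = tvec (base A) c (proj A a) (fst (snd u ?a))"
    unfolding tproj_def by (rule tmap_eq_tvec[OF T D cont ca cc d])
qed

lemma tlinearD:
  assumes "tlinear V W L"
  shows "u \<in> V \<Longrightarrow> L u \<in> W" "u \<in> V \<Longrightarrow> w \<in> V \<Longrightarrow> L (tadd u w) = tadd (L u) (L w)"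
    "u \<in> V \<Longrightarrow> L (tscale r u) = tscale r (L u)"
  using assms by (auto simp: tlinear_def)

context
  fixes A :: "('a, 'p, 'b::euclidean_space, 'f::euclidean_space) bundle_data"
  assumes A: "affine_bundle A"
begin

lemma proj_continuous: "continuous_map (topo (total A)) (topo (base A)) (proj A)"
  using affine_bundleD(3)[OF A] by (simp add: smooth_map_def)

lemma trivialising_at:
  assumes "a \<in> carr (total A)"
  obtains c \<psi> where "trivialising A c \<psi>" "a \<in> cdom (affine_chart A c \<psi>)"
    "affine_chart A c \<psi> \<in> charts_at (total A) a" "c \<in> charts_at (base A) (proj A a)"
proof -
  obtain c \<psi> where c: "trivialising A c \<psi>" "proj A a \<in> cdom c"
    using trivialising_exists[OF A proj_in_base[OF A assms]] .
  have a: "a \<in> cdom (affine_chart A c \<psi>)" using assms c(2) by (simp add: in_cdom_affine_chart)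
  show ?thesis
    by (rule that[OF c(1) a in_atlas_charts_at[OF affine_chart_image(1)[OF A c(1)] a]
          in_atlas_charts_at[OF trivialising_atlas[OF c(1)] c(2)]])
qed

lemma tproj_trivialising:
  assumes "trivialising A c \<psi>" "a \<in> cdom (affine_chart A c \<psi>)" "u \<in> tspace (total A) a"
  shows "tproj A u = tvec (base A) c (proj A a) (fst (snd u (affine_chart A c \<psi>)))"
  by (rule tproj_local(2)[OF affine_bundle_differentiable[OF A] proj_continuous
        trivialising_atlas[OF assms(1)] affine_chart_image(1)[OF A assms(1)] assms(2,3)])

lemma tproj_linear:
  assumes "a \<in> carr (total A)"
  shows "tlinear (tspace (total A) a) (tspace (base A) (proj A a)) (tproj A)"
proof -
  obtain c \<psi> where "trivialising A c \<psi>" "a \<in> cdom (affine_chart A c \<psi>)"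
    using trivialising_at[OF assms] .
  then show ?thesis
    using tproj_local(1)[OF affine_bundle_differentiable[OF A] proj_continuous
        trivialising_atlas affine_chart_image(1)[OF A]] by blast
qed

end

text \<open>Connections and solder forms are treated at once: they are the cases $\varepsilon = 1$ and
  $\varepsilon = 0$ of a form with $T\pi \circ \kappa = \varepsilon \, \mathrm{Id}$.\<close>

definition projectable_form ::
  "('a, 'p, 'b::euclidean_space, 'f::euclidean_space) bundle_data \<Rightarrow> real \<Rightarrow>
   ('a \<Rightarrow> ('p, 'b) tvector \<Rightarrow> ('a, 'b \<times> 'f) tvector) \<Rightarrow> bool" where
  "projectable_form A \<epsilon> \<kappa> \<longleftrightarrow>
     smooth_map 1 (fibre_product A) (tangent_bundle (total A)) (\<lambda>(a, u). \<kappa> a u) \<and>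
     (\<forall>a \<in> carr (total A).
        tlinear (tspace (base A) (proj A a)) (tspace (total A) a) (\<kappa> a) \<and>
        (\<forall>u \<in> tspace (base A) (proj A a). tproj A (\<kappa> a u) = tscale \<epsilon> u)) \<and>
     vertically_affine A \<kappa>"

lemma tscale_one: "tscale 1 u = u"
  by (simp add: prod_eq_iff fun_eq_iff)

lemma connection_iff: "connection A \<gamma> \<longleftrightarrow> projectable_form A 1 \<gamma>"
  by (simp only: connection_def projectable_form_def tscale_one)

text \<open>\<open>tscale 0 u\<close> is the zero vector at the base point of \<open>u\<close>, so
  projecting to it expresses verticality.\<close>

lemma solder_form_iff:
  "solder_form A \<theta> \<longleftrightarrow>
    projectable_form A 0 \<theta> \<and> inj_on (\<lambda>(a, u). \<theta> a u) (carr (fibre_product A))"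
proof -
  have "tlinear (tspace (base A) (proj A a)) (vertical A a) (\<theta> a) \<longleftrightarrow>
      tlinear (tspace (base A) (proj A a)) (tspace (total A) a) (\<theta> a) \<and>
      (\<forall>u \<in> tspace (base A) (proj A a). tproj A (\<theta> a u) = tscale 0 u)" for a
    unfolding tlinear_def vertical_def by (auto simp: tscale_zero tspaceD(1))
  then show ?thesis unfolding solder_form_def projectable_form_def by blast
qed

section \<open>The ambient bundle\<close>

abbreviation euc :: "('e, 'e::euclidean_space) manifold_data" where
  "euc \<equiv> euclidean_manifold"

abbreviation std_coords :: "('e, 'e::euclidean_space) tvector \<Rightarrow> 'e" where
  "std_coords u \<equiv> snd u std_chart"

lemmas euc_differentiable = differentiable_euclidean_manifold
lemmas tvec_euc = tvec_in_tspace[OF euc_differentiable std_chart_charts_at]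
  and std_coords_tvec [simp] = snd_tvec[OF euc_differentiable std_chart_charts_at]
  and tvec_std_coords = tvec_snd[OF euc_differentiable _ std_chart_charts_at]
  and tspace_euc_eqI = tspace_eqI[OF euc_differentiable _ _ std_chart_charts_at]

lemma ambient_simps [simp]:
  "total ambient_bundle = euc" "base ambient_bundle = euc" "proj ambient_bundle = fst"
  "trivs ambient_bundle = {(UNIV, snd)}"
  by (simp_all add: ambient_bundle_def)

lemma trivialising_ambient: "trivialising ambient_bundle std_chart snd"
  using std_chart_in_atlas by (simp add: trivialising_def)

lemma affine_chart_ambient: "affine_chart ambient_bundle std_chart snd = std_chart"
  by (simp add: affine_chart_def)

lemma tproj_ambient:
  assumes "u \<in> tspace euc a"
  shows "tproj ambient_bundle u = tvec euc std_chart (fst a) (fst (std_coords u))"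
  using tproj_local(2)[of ambient_bundle std_chart snd a u] assms
  by (simp add: affine_chart_ambient euc_differentiable std_chart_in_atlas continuous_on_fst
      continuous_on_id)

lemma std_coords_tproj_ambient:
  "u \<in> tspace euc a \<Longrightarrow> std_coords (tproj ambient_bundle u) = fst (std_coords u)"
  by (simp add: tproj_ambient)

section \<open>Metrics in coordinates and their pull-backs\<close>

lemma pseudo_metricD:
  assumes "pseudo_metric M g" "u \<in> tspace M p" "w \<in> tspace M p"
  shows "g u w = g w u" "u' \<in> tspace M p \<Longrightarrow> g (tadd u u') w = g u w + g u' w"
    "g (tscale r u) w = r * g u w" "0 \<le> g u u"
  using assms tspaceD(2)[OF assms(2)] unfolding pseudo_metric_def by simp_all

lemma pseudo_metric_components:
  fixes g :: "('e, 'e::euclidean_space) tvector \<Rightarrow> ('e, 'e) tvector \<Rightarrow> real"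
  assumes g: "pseudo_metric euc g"
  shows "linear (\<lambda>v. g (tvec euc std_chart p v) (tvec euc std_chart p w))"
    and "linear (\<lambda>w. g (tvec euc std_chart p v) (tvec euc std_chart p w))"
    and "C1_on UNIV (\<lambda>p. g (tvec euc std_chart p v) (tvec euc std_chart p w))"
proof -
  note add = tvec_add[OF euc_differentiable std_chart_charts_at]
    and scale = tvec_scale[OF euc_differentiable std_chart_charts_at]
  show 1: "linear (\<lambda>v. g (tvec euc std_chart p v) (tvec euc std_chart p w))" for w
    by (rule linearI) (simp_all add: add scale pseudo_metricD(2,3)[OF g tvec_euc tvec_euc] tvec_euc)
  have "(\<lambda>w. g (tvec euc std_chart p v) (tvec euc std_chart p w)) =
      (\<lambda>w. g (tvec euc std_chart p w) (tvec euc std_chart p v))"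
    by (rule ext) (rule pseudo_metricD(1)[OF g tvec_euc tvec_euc])
  then show "linear (\<lambda>w. g (tvec euc std_chart p v) (tvec euc std_chart p w))"
    using 1[of v] by simp
  have "\<forall>c\<in>atlas (euc :: ('e, 'e) manifold_data). \<forall>v w. Ck_on 1 (cmap c ` cdom c)
      (\<lambda>x. let p = inv_into (cdom c) (cmap c) x in g (tvec euc c p v) (tvec euc c p w))"
    by (insert g[unfolded pseudo_metric_def]) (elim conjE, assumption)
  from bspec[OF this std_chart_in_atlas]
  show "C1_on UNIV (\<lambda>p. g (tvec euc std_chart p v) (tvec euc std_chart p w))"
    by (simp add: Let_def inv_into_def C1_on_def del: Ck_on.simps One_nat_def)
qed

text \<open>For constant components this is smoothness of the metric coefficients; bilinearity lets
  the two arguments vary, one at a time.\<close>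

lemma C1_on_metric:
  fixes g :: "('e, 'e::euclidean_space) tvector \<Rightarrow> ('e, 'e) tvector \<Rightarrow> real"
  assumes g: "pseudo_metric euc g" and S: "open S"
    and f: "C1_on S f" and v: "C1_on S v" and w: "C1_on S w"
  shows "C1_on S (\<lambda>x. g (tvec euc std_chart (f x) (v x)) (tvec euc std_chart (f x) (w x)))"
proof (rule C1_on_linear_family[OF S _ _ w])
  show "linear (\<lambda>b. g (tvec euc std_chart (f x) (v x)) (tvec euc std_chart (f x) b))" for x
    by (rule pseudo_metric_components(2)[OF g])
  show "C1_on S (\<lambda>x. g (tvec euc std_chart (f x) (v x)) (tvec euc std_chart (f x) b))" for b
  proof (rule C1_on_linear_family[OF S _ _ v])
    show "linear (\<lambda>b'. g (tvec euc std_chart (f x) b') (tvec euc std_chart (f x) b))" for x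
      by (rule pseudo_metric_components(1)[OF g])
    show "C1_on S (\<lambda>x. g (tvec euc std_chart (f x) b') (tvec euc std_chart (f x) b))" for b'
      by (rule C1_on_compose[OF f pseudo_metric_components(3)[OF g]]) simp
  qed
qed

text \<open>Stated for a fibrewise linear \<open>K\<close> over \<open>f\<close> because it serves
  twice: for \<open>F\<close> over \<open>\<phi>\<close> and for \<open>Fbar\<close> over
  \<open>\<phi>bar\<close>.\<close>

lemma pseudo_metric_pullback:
  fixes M :: "('p, 'm::euclidean_space) manifold_data"
    and K :: "('p, 'm) tvector \<Rightarrow> ('e, 'e::euclidean_space) tvector"
  assumes M: "differentiable_manifold M" and g: "pseudo_metric euc g"
    and K: "\<And>p. p \<in> carr M \<Longrightarrow> tlinear (tspace M p) (tspace euc (f p)) K"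
    and f: "\<And>c. c \<in> atlas M \<Longrightarrow> C1_on (cmap c ` cdom c) (\<lambda>x. f (inv_into (cdom c) (cmap c) x))"
    and C1: "\<And>c v. c \<in> atlas M \<Longrightarrow> C1_on (cmap c ` cdom c)
      (\<lambda>x. std_coords (K (tvec M c (inv_into (cdom c) (cmap c) x) v)))"
  shows "pseudo_metric M (pullback_metric K g)"
  unfolding pseudo_metric_def pullback_metric_def
proof (intro conjI ballI allI)
  fix p u u' w r assume p: "p \<in> carr M" and u: "u \<in> tspace M p" "u' \<in> tspace M p" "w \<in> tspace M p"
  note K = tlinearD[OF K[OF p]]
  show "g (K u) (K w) = g (K w) (K u)" using pseudo_metricD(1)[OF g K(1) K(1)] u by simp
  show "g (K (tadd u u')) (K w) = g (K u) (K w) + g (K u') (K w)"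
    using pseudo_metricD(2)[OF g K(1) K(1) K(1)] u by (simp add: K(2))
  show "g (K (tscale r u)) (K w) = r * g (K u) (K w)"
    using pseudo_metricD(3)[OF g K(1) K(1)] u by (simp add: K(3))
  show "0 \<le> g (K u) (K u)" using pseudo_metricD(4)[OF g K(1) K(1)] u by simp
next
  fix c v w assume c: "c \<in> atlas M"
  then have ch: "is_chart (topo M) c" using M by (simp add: differentiable_manifold_def)
  let ?p = "\<lambda>x. inv_into (cdom c) (cmap c) x"
  have op: "open (cmap c ` cdom c)" using ch by (simp add: is_chart_def)
  from C1_on_metric[OF g op f[OF c] C1[OF c, of v] C1[OF c, of w]]
  have "C1_on (cmap c ` cdom c) (\<lambda>x. g (K (tvec M c (?p x) v)) (K (tvec M c (?p x) w)))"
  proof (rule C1_on_cong[OF op, rotated])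
    fix x assume "x \<in> cmap c ` cdom c"
    then have "?p x \<in> cdom c" by (rule inv_into_into)
    then have px: "c \<in> charts_at M (?p x)" by (rule in_atlas_charts_at[OF c])
    \<comment> \<open>Rebuilding the image vector from its standard coordinates turns smoothness of
      the components into smoothness of the metric coefficients.\<close>
    have "tvec euc std_chart (f (?p x)) (std_coords (K (tvec M c (?p x) v))) = K (tvec M c (?p x) v)"
      for v
      by (rule tvec_std_coords[OF tlinearD(1)[OF K[OF charts_atD(5)[OF M px]] tvec_in_tspace[OF M px]]])
    then show "g (tvec euc std_chart (f (?p x)) (std_coords (K (tvec M c (?p x) v))))
        (tvec euc std_chart (f (?p x)) (std_coords (K (tvec M c (?p x) w)))) =
      g (K (tvec M c (?p x) v)) (K (tvec M c (?p x) w))" by simp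
  qed
  then show "Ck_on 1 (cmap c ` cdom c) (\<lambda>x. let p = ?p x in g (K (tvec M c p v)) (K (tvec M c p w)))"
    by (simp only: C1_on_def Let_def)
qed

text \<open>The identity chart and the trivialisation \<open>snd\<close> are global, so forms on the
  ambient bundle become maps between vector spaces, without domain conditions.\<close>

lemma projectable_form_ambient:
  assumes "projectable_form ambient_bundle \<epsilon> \<kappa>"
  shows "tlinear (tspace euc (fst a)) (tspace euc a) (\<kappa> a)"
    and "u \<in> tspace euc (fst a) \<Longrightarrow> tproj ambient_bundle (\<kappa> a u) = tscale \<epsilon> u"
    and "C1_on UNIV (\<lambda>z. std_coords (\<kappa> (fst z) (tvec euc std_chart (fst (fst z)) (snd z))))"
    and "\<exists>h. affine_map h \<and> (\<forall>y. std_coords (\<kappa> (x, y) (tvec euc std_chart x v)) = h y)"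
proof -
  show lin: "tlinear (tspace euc (fst a)) (tspace euc a) (\<kappa> a)" for a
    using assms by (cases a) (simp add: projectable_form_def)
  show "u \<in> tspace euc (fst a) \<Longrightarrow> tproj ambient_bundle (\<kappa> a u) = tscale \<epsilon> u"
    using assms by (cases a) (simp add: projectable_form_def)
  let ?C = "fibre_product_chart ambient_bundle std_chart snd"
  let ?D = "tangent_chart (euc :: (_, (real^3) \<times> (real^3)) manifold_data) std_chart"
  have C: "?C \<in> atlas (fibre_product ambient_bundle)"
    unfolding atlas_fibre_product using trivialising_ambient by blast
  have D: "?D \<in> atlas (tangent_bundle euc)"
    unfolding atlas_tangent_bundle by (rule imageI[OF std_chart_in_atlas])
  have sm: "smooth_map 1 (fibre_product ambient_bundle) (tangent_bundle euc) (\<lambda>(a, u). \<kappa> a u)"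
    using assms by (simp add: projectable_form_def)
  note \<kappa> = tlinearD(1)[OF lin]
  have inj: "inj_on (cmap ?C) (cdom ?C)"
  proof (rule inj_onI)
    fix x y assume *: "x \<in> cdom ?C" "y \<in> cdom ?C" "cmap ?C x = cmap ?C y"
    obtain a u b w where xy: "x = (a, u)" "y = (b, w)" by (cases x, cases y)
    have ab: "a = b" "u \<in> tspace euc (fst a)" "w \<in> tspace euc (fst b)" "std_coords u = std_coords w"
      using * by (simp_all add: xy fibre_product_chart_def affine_chart_ambient)
    show "x = y"
      unfolding xy ab(1) using tspace_euc_eqI[OF ab(2) _ ab(4)] ab(3) by (simp only: ab(1))
  qed
  have rep: "z \<in> cmap ?C ` (cdom ?C \<inter> (\<lambda>(a, u). \<kappa> a u) -` cdom ?D)"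
    "snd (local_rep ?C ?D (\<lambda>(a, u). \<kappa> a u) z) =
      std_coords (\<kappa> (fst z) (tvec euc std_chart (fst (fst z)) (snd z)))" for z
  proof -
    let ?x = "(fst z, tvec euc std_chart (fst (fst z)) (snd z))"
    have x: "?x \<in> cdom ?C" "cmap ?C ?x = z"
      by (simp_all add: fibre_product_chart_def affine_chart_ambient tvec_euc)
    have "\<kappa> (fst z) (tvec euc std_chart (fst (fst z)) (snd z)) \<in> cdom ?D"
      using \<kappa>[OF tvec_euc] by (simp add: in_cdom_tangent_chart tspaceD(1)[OF \<kappa>[OF tvec_euc]])
    then show "z \<in> cmap ?C ` (cdom ?C \<inter> (\<lambda>(a, u). \<kappa> a u) -` cdom ?D)"
      by (intro image_eqI[of _ _ ?x]) (simp_all only: x Int_iff vimage_eq prod.case)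
    from local_rep_eq[OF inj x(1), of ?D "\<lambda>(a, u). \<kappa> a u"]
    show "snd (local_rep ?C ?D (\<lambda>(a, u). \<kappa> a u) z) =
      std_coords (\<kappa> (fst z) (tvec euc std_chart (fst (fst z)) (snd z)))"
      by (simp only: x(2) prod.case cmap_tangent_chart snd_conv)
  qed
  have "\<forall>c\<in>atlas (fibre_product ambient_bundle). \<forall>d\<in>atlas (tangent_bundle euc).
        Ck_on 1 (cmap c ` (cdom c \<inter> (\<lambda>(a, u). \<kappa> a u) -` cdom d)) (local_rep c d (\<lambda>(a, u). \<kappa> a u))"
    by (insert sm[unfolded smooth_map_def]) (elim conjE, assumption)
  from bspec[OF bspec[OF this C] D]
  have "C1_on UNIV (local_rep ?C ?D (\<lambda>(a, u). \<kappa> a u))"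
    unfolding C1_on_def[symmetric] by (rule C1_on_subset) (use rep(1) in blast)
  from C1_on_snd[OF this]
  show "C1_on UNIV (\<lambda>z. std_coords (\<kappa> (fst z) (tvec euc std_chart (fst (fst z)) (snd z))))"
    by (simp only: rep(2))
  have "vertically_affine ambient_bundle \<kappa>"
    using assms by (simp add: projectable_form_def)
  from this[unfolded vertically_affine_def, rule_format, OF conjI[OF trivialising_ambient], of x v]
  obtain h where "affine_map h" "\<And>a. a \<in> fibre ambient_bundle x \<Longrightarrow>
      std_coords (\<kappa> a (tvec euc std_chart x v)) = h (snd a)"
    by (auto simp: affine_chart_ambient)
  then show "\<exists>h. affine_map h \<and> (\<forall>y. std_coords (\<kappa> (x, y) (tvec euc std_chart x v)) = h y)"
    by (intro exI[of _ h]) (simp add: fibre_def)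
qed

section \<open>Placements\<close>

context
  fixes B :: "('a, 'p, 'b::euclidean_space, real^3) bundle_data"
    and F :: "('a, 'b \<times> (real^3)) tvector \<Rightarrow> ((real^3) \<times> (real^3), (real^3) \<times> (real^3)) tvector"
    and \<phi> :: "'a \<Rightarrow> (real^3) \<times> (real^3)"
    and \<phi>bar :: "'p \<Rightarrow> real^3"
  assumes B: "affine_bundle B" and P: "first_order_placement B ambient_bundle F \<phi> \<phi>bar"
begin

private abbreviation Fbar :: "('p, 'b) tvector \<Rightarrow> (real^3, real^3) tvector" where
  "Fbar \<equiv> tmap (base B) euc \<phi>bar"

lemma placementD:
  "smooth_map 1 (tangent_bundle (total B)) (tangent_bundle euc) F"
  "\<forall>X \<in> carr (total B). tlinear (tspace (total B) X) (tspace euc (\<phi> X)) F"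
  "smooth_map 1 (total B) euc \<phi>"
  "smooth_map 1 (base B) euc \<phi>bar"
  "\<forall>X \<in> carr (total B). fst (\<phi> X) = \<phi>bar (proj B X)"
  "affine_on_fibres B ambient_bundle \<phi> \<phi>bar"
  "\<forall>X \<in> carr (total B). \<forall>U \<in> tspace (total B) X. tproj ambient_bundle (F U) = Fbar (tproj B U)"
  "\<forall>X \<in> carr (total B). \<forall>U \<in> vertical B X. F U = tmap (total B) euc \<phi> U"
  "\<forall>c \<psi> d \<eta> p v. trivialising B c \<psi> \<and> trivialising ambient_bundle d \<eta> \<and> p \<in> cdom c \<and> \<phi>bar p \<in> cdom d \<longrightarrow>
    (\<exists>h. affine_map h \<and> (\<forall>X \<in> fibre B p.
      snd (F (tvec (total B) (affine_chart B c \<psi>) X v)) (affine_chart ambient_bundle d \<eta>) = h (\<psi> X)))"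
  "diff_embedding (tangent_bundle (total B)) (tangent_bundle euc) F"
  by (insert P[unfolded first_order_placement_def ambient_simps]) (elim conjE, assumption)+

lemmas differentiable_total = affine_bundle_differentiable(1)[OF B]
  and differentiable_base = affine_bundle_differentiable(2)[OF B]

lemmas F_linear = bspec[OF placementD(2)]
  and fst_\<phi> = bspec[OF placementD(5)]
  and tproj_F = bspec[OF bspec[OF placementD(7)]]

lemma F_in: "X \<in> carr (total B) \<Longrightarrow> U \<in> tspace (total B) X \<Longrightarrow> F U \<in> tspace euc (\<phi> X)"
  by (rule tlinearD(1)[OF F_linear])

text \<open>\<open>F\<close> is a topological embedding of the whole tangent bundle, hence injective
  on it.\<close>

lemma F_inj:
  assumes "U \<in> tspace (total B) X" "W \<in> tspace (total B) X" "F U = F W"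
  shows "U = W"
proof -
  have "embedding_map (topo (tangent_bundle (total B))) (topo (tangent_bundle euc)) F"
    using placementD(10) by (simp add: diff_embedding_def)
  then have "inj_on F (carr (tangent_bundle (total B)))"
    unfolding embedding_map_def by (rule homeomorphic_imp_injective_map)
  then show ?thesis
    using assms in_carr_tangent_bundle[OF differentiable_total] inj_onD by metis
qed

lemma \<phi>bar_continuous: "continuous_map (topo (base B)) (topo euc) \<phi>bar"
  using placementD(4) by (simp add: smooth_map_def)

lemma \<phi>bar_C1:
  assumes "c \<in> atlas (base B)"
  shows "C1_on (cmap c ` cdom c) (local_rep c std_chart \<phi>bar)"
proof -
  have "\<forall>c\<in>atlas (base B). \<forall>d\<in>atlas euc. Ck_on 1 (cmap c ` (cdom c \<inter> \<phi>bar -` cdom d)) (local_rep c d \<phi>bar)"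
    by (insert placementD(4)[unfolded smooth_map_def]) (elim conjE, assumption)
  from bspec[OF bspec[OF this assms] std_chart_in_atlas]
  show ?thesis by (simp only: C1_on_def fst_conv vimage_UNIV Int_UNIV_right)
qed

lemma Fbar_linear:
  assumes "p \<in> carr (base B)"
  shows "tlinear (tspace (base B) p) (tspace euc (\<phi>bar p)) Fbar"
proof -
  obtain c where c: "c \<in> charts_at (base B) p"
    using charts_at_nonempty[OF differentiable_base assms] by blast
  note D = charts_atD[OF differentiable_base c]
  show ?thesis
    by (rule tlinear_tmap[OF differentiable_base euc_differentiable \<phi>bar_continuous c std_chart_charts_at
          C1_on_derivative[OF \<phi>bar_C1[OF D(1)] imageI[OF D(2)]]])
qed

lemmas proj_base = proj_in_base[OF B]

lemma Fbar_in:
  "X \<in> carr (total B) \<Longrightarrow> U \<in> tspace (base B) (proj B X) \<Longrightarrow> Fbar U \<in> tspace euc (fst (\<phi> X))"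
  using tlinearD(1)[OF Fbar_linear[OF proj_base]] by (simp add: fst_\<phi>)

text \<open>The first component is \<open>\<phi>\<close> because \<open>F\<close> sends vectors at p
  to vectors at \<open>\<phi> p\<close>. Base point and components are obtained together as C^1
  functions of the coordinates.\<close>

lemma F_smooth:
  assumes c: "c \<in> atlas (total B)"
  shows "C1_on (cmap c ` cdom c \<times> UNIV) (\<lambda>z. (\<phi> (inv_into (cdom c) (cmap c) (fst z)),
    std_coords (F (tvec (total B) c (inv_into (cdom c) (cmap c) (fst z)) (snd z)))))"
proof -
  let ?C = "tangent_chart (total B) c"
  let ?D = "tangent_chart (euc :: (_, (real^3) \<times> (real^3)) manifold_data) std_chart"
  have ch: "is_chart (topo (total B)) c"
    using differentiable_total c by (simp add: differentiable_manifold_def)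
  have op: "open (cmap c ` cdom c \<times> (UNIV :: ('b \<times> (real^3)) set))"
    using ch by (simp add: is_chart_def open_Times)
  have D: "?D \<in> atlas (tangent_bundle euc)"
    unfolding atlas_tangent_bundle by (rule imageI[OF std_chart_in_atlas])
  have C: "?C \<in> atlas (tangent_bundle (total B))"
    unfolding atlas_tangent_bundle by (rule imageI[OF c])
  have "\<forall>c\<in>atlas (tangent_bundle (total B)). \<forall>d\<in>atlas (tangent_bundle euc).
      Ck_on 1 (cmap c ` (cdom c \<inter> F -` cdom d)) (local_rep c d F)"
    by (insert placementD(1)[unfolded smooth_map_def]) (elim conjE, assumption)
  from bspec[OF bspec[OF this C] D]
  have *: "C1_on (cmap ?C ` (cdom ?C \<inter> F -` cdom ?D)) (local_rep ?C ?D F)"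
    unfolding C1_on_def .
  have rep: "(cmap c p, v) \<in> cmap ?C ` (cdom ?C \<inter> F -` cdom ?D)"
    "local_rep ?C ?D F (cmap c p, v) = (\<phi> p, std_coords (F (tvec (total B) c p v)))"
    if p: "p \<in> cdom c" for p v
  proof -
    note cp = in_atlas_charts_at[OF c p]
    note FV = F_in[OF charts_atD(5)[OF differentiable_total cp] tvec_in_tspace[OF differentiable_total cp, of v]]
    have "F (tvec (total B) c p v) \<in> cdom ?D"
      using FV by (simp add: in_cdom_tangent_chart tspaceD(1)[OF FV])
    then show "(cmap c p, v) \<in> cmap ?C ` (cdom ?C \<inter> F -` cdom ?D)"
      by (intro image_eqI[of _ _ "tvec (total B) c p v"])
        (simp_all add: cmap_tangent_chart_tvec[OF differentiable_total c p] tvec_in_cdom[OF differentiable_total c p])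
    show "local_rep ?C ?D F (cmap c p, v) = (\<phi> p, std_coords (F (tvec (total B) c p v)))"
      unfolding local_rep_tangent_chart[OF differentiable_total c p] cmap_tangent_chart
      by (simp add: tspaceD(1)[OF FV])
  qed
  have "C1_on (cmap c ` cdom c \<times> UNIV) (local_rep ?C ?D F)"
    by (rule C1_on_subset[OF *]) (use rep(1) in auto)
  then show ?thesis
  proof (rule C1_on_cong[OF op, rotated])
    fix z :: "('b \<times> (real^3)) \<times> ('b \<times> (real^3))" assume "z \<in> cmap c ` cdom c \<times> UNIV"
    then obtain p v where pv: "p \<in> cdom c" "z = (cmap c p, v)" by auto
    show "local_rep ?C ?D F z = (\<phi> (inv_into (cdom c) (cmap c) (fst z)),
        std_coords (F (tvec (total B) c (inv_into (cdom c) (cmap c) (fst z)) (snd z))))"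
      by (simp add: pv(2) rep(2)[OF pv(1)] inv_into_f_f[OF is_chart_inj[OF ch] pv(1)])
  qed
qed

text \<open>Evaluating on zero vectors isolates the base point.\<close>

lemma \<phi>_C1:
  assumes c: "c \<in> atlas (total B)"
  shows "C1_on (cmap c ` cdom c) (\<lambda>x. \<phi> (inv_into (cdom c) (cmap c) x))"
proof -
  have "C1_on (cmap c ` cdom c) (\<lambda>x. (x, 0 :: 'b \<times> (real^3)))"
    by (intro C1_on_Pair C1_on_id C1_on_const)
  from C1_on_fst[OF C1_on_compose[OF this F_smooth[OF c]]] show ?thesis by auto
qed

lemma F_components_C1:
  assumes c: "c \<in> atlas (total B)" and f: "C1_on S f" "f ` S \<subseteq> cmap c ` cdom c" and v: "C1_on S v"
  shows "C1_on S (\<lambda>x. std_coords (F (tvec (total B) c (inv_into (cdom c) (cmap c) (f x)) (v x))))"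
proof -
  from C1_on_snd[OF C1_on_compose[OF C1_on_Pair[OF f(1) v] F_smooth[OF c]]] f(2)
  show ?thesis by auto
qed

section \<open>The placement in trivialising coordinates\<close>

lemma F_components_linear:
  assumes "c \<in> charts_at (total B) X"
  shows "linear (\<lambda>v. std_coords (F (tvec (total B) c X v)))"
proof (rule linearI)
  note T = differentiable_total
  note F = tlinearD[OF F_linear[OF charts_atD(5)[OF T assms]]]
  show "std_coords (F (tvec (total B) c X (v + w))) =
      std_coords (F (tvec (total B) c X v)) + std_coords (F (tvec (total B) c X w))" for v w
    by (simp add: tvec_add[OF T assms] F(2) tvec_in_tspace[OF T assms])
  show "std_coords (F (tvec (total B) c X (r *\<^sub>R v))) = r *\<^sub>R std_coords (F (tvec (total B) c X v))" for r v
    by (simp add: tvec_scale[OF T assms] F(3) tvec_in_tspace[OF T assms])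
qed

text \<open>Coordinate form of \<open>tproj \<circ> F = Fbar \<circ> tproj\<close>. Both the block
  triangular shape of \<open>F\<close> and the smoothness of \<open>Fbar\<close> rest on it.\<close>

lemma F_fst_components:
  assumes triv: "trivialising B c \<psi>" and X: "X \<in> cdom (affine_chart B c \<psi>)"
  shows "fst (std_coords (F (tvec (total B) (affine_chart B c \<psi>) X v))) =
    std_coords (Fbar (tvec (base B) c (proj B X) (fst v)))"
proof -
  note cX = in_atlas_charts_at[OF affine_chart_image(1)[OF B triv] X]
  note V = tvec_in_tspace[OF differentiable_total cX, of v]
  have cX': "X \<in> carr (total B)" using X by (simp add: in_cdom_affine_chart)
  have "fst (std_coords (F (tvec (total B) (affine_chart B c \<psi>) X v))) =
      std_coords (tproj ambient_bundle (F (tvec (total B) (affine_chart B c \<psi>) X v)))"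
    by (rule std_coords_tproj_ambient[OF F_in[OF cX' V], symmetric])
  then show ?thesis
    by (simp add: tproj_F[OF cX' V] tproj_trivialising[OF B triv X V] snd_tvec[OF differentiable_total cX])
qed

text \<open>Vectors with zero base component go to vectors with zero base component, so what is left
  of the injective \<open>F\<close> is an injective endomorphism of R^3.\<close>

lemma F_vertical:
  assumes triv: "trivialising B c \<psi>" and X: "X \<in> cdom (affine_chart B c \<psi>)"
  shows "linear (\<lambda>w. snd (std_coords (F (tvec (total B) (affine_chart B c \<psi>) X (0, w)))))"
    and "inj (\<lambda>w. snd (std_coords (F (tvec (total B) (affine_chart B c \<psi>) X (0, w)))))"
    and "fst (std_coords (F (tvec (total B) (affine_chart B c \<psi>) X (0, w)))) = 0"
proof -
  let ?a = "affine_chart B c \<psi>"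
  let ?H = "\<lambda>v. std_coords (F (tvec (total B) ?a X v))"
  note cX = in_atlas_charts_at[OF affine_chart_image(1)[OF B triv] X]
  note V = tvec_in_tspace[OF differentiable_total cX]
  have X': "X \<in> carr (total B)" using X by (simp add: in_cdom_affine_chart)
  have H: "linear ?H" by (rule F_components_linear[OF cX])
  have fst0: "fst (?H (0, w)) = 0" for w
  proof -
    \<comment> \<open>Both sides depend only on the base component of the argument, which is
      0.\<close>
    have "fst (?H (0, w)) = fst (?H 0)"
      unfolding F_fst_components[OF triv X] by simp
    then show ?thesis using linear_0[OF H] by simp
  qed
  then show "fst (?H (0, w)) = 0" .
  show lin: "linear (\<lambda>w. snd (?H (0, w)))"
  proof (rule linearI)
    show "snd (?H (0, v + w)) = snd (?H (0, v)) + snd (?H (0, w))" for v w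
      using linear_add[OF H, of "(0, v)" "(0, w)"] by simp
    show "snd (?H (0, r *\<^sub>R v)) = r *\<^sub>R snd (?H (0, v))" for r v
      using linear_cmul[OF H, of r "(0, v)"] by simp
  qed
  show "inj (\<lambda>w. snd (?H (0, w)))"
  proof (rule injI)
    fix v w assume "snd (?H (0, v)) = snd (?H (0, w))"
    then have "?H (0, v) = ?H (0, w)" by (simp add: prod_eq_iff fst0)
    then have "F (tvec (total B) ?a X (0, v)) = F (tvec (total B) ?a X (0, w))"
      by (rule tspace_euc_eqI[OF F_in[OF X' V] F_in[OF X' V]])
    from F_inj[OF V V this] snd_tvec[OF differentiable_total cX]
    show "v = w" by (metis snd_conv)
  qed
qed

text \<open>Any lift of \<open>U\<close> already has the right image on the base, by
  \<open>eq\<close>. A vertical correction matches the fibre component, since an injective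
  endomorphism of R^3 is onto.\<close>

lemma F_lift:
  assumes X: "X \<in> carr (total B)" and W: "W \<in> tspace euc (\<phi> X)"
    and U: "U \<in> tspace (base B) (proj B X)" and eq: "tproj ambient_bundle W = Fbar U"
  obtains V where "V \<in> tspace (total B) X" "F V = W" "tproj B V = U"
proof -
  obtain c \<psi> where triv: "trivialising B c \<psi>" and a: "X \<in> cdom (affine_chart B c \<psi>)"
    and cX: "affine_chart B c \<psi> \<in> charts_at (total B) X" and cp: "c \<in> charts_at (base B) (proj B X)"
    using trivialising_at[OF B X] .
  let ?a = "affine_chart B c \<psi>"
  let ?H = "\<lambda>v. std_coords (F (tvec (total B) ?a X v))"
  have H: "linear ?H" by (rule F_components_linear[OF cX])
  have "surj (\<lambda>w. snd (?H (0, w)))"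
    by (rule linear_injective_imp_surjective[OF F_vertical(1,2)[OF triv a]]) (rule refl)
  \<comment> \<open>\<open>w\<close> makes up the difference between the fibre component of
    \<open>W\<close> and that of the image of the lift with vertical part 0.\<close>
  from surjD[OF this, of "snd (std_coords W) - snd (?H (snd U c, 0))"]
  obtain w where w: "snd (std_coords W) - snd (?H (snd U c, 0)) = snd (?H (0, w))" ..
  let ?V = "tvec (total B) ?a X (snd U c, w)"
  have V: "?V \<in> tspace (total B) X" by (rule tvec_in_tspace[OF differentiable_total cX])
  have "snd (?H (snd U c, w)) = snd (std_coords W)"
    using linear_add[OF H, of "(snd U c, 0)" "(0, w)"] by (simp add: w[symmetric])
  moreover have "fst (?H (snd U c, w)) = fst (std_coords W)"
    using std_coords_tproj_ambient[OF W]
    by (simp add: F_fst_components[OF triv a] tvec_snd[OF differentiable_base U cp] eq)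
  ultimately have "F ?V = W"
    by (intro tspace_euc_eqI[OF F_in[OF X V] W]) (simp add: prod_eq_iff)
  moreover have "tproj B ?V = U"
    by (simp add: tproj_trivialising[OF B triv a V] snd_tvec[OF differentiable_total cX]
        tvec_snd[OF differentiable_base U cp])
  ultimately show ?thesis using that V by blast
qed

text \<open>Let \<open>V\<close> lift \<open>U\<close>. As \<open>Fbar U = Fbar U'\<close>, the
  vector \<open>F V\<close> also has a preimage over \<open>U'\<close>; injectivity of
  \<open>F\<close> makes the two preimages equal, and so their projections.\<close>

lemma Fbar_inj:
  assumes X: "X \<in> carr (total B)" and U: "U \<in> tspace (base B) (proj B X)"
    and U': "U' \<in> tspace (base B) (proj B X)" and eq: "Fbar U = Fbar U'"
  shows "U = U'"
proof -
  obtain c \<psi> where triv: "trivialising B c \<psi>" and a: "X \<in> cdom (affine_chart B c \<psi>)"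
    and cX: "affine_chart B c \<psi> \<in> charts_at (total B) X" and cp: "c \<in> charts_at (base B) (proj B X)"
    using trivialising_at[OF B X] .
  let ?V = "tvec (total B) (affine_chart B c \<psi>) X (snd U c, 0)"
  have V: "?V \<in> tspace (total B) X" by (rule tvec_in_tspace[OF differentiable_total cX])
  have tV: "tproj B ?V = U"
    by (simp add: tproj_trivialising[OF B triv a V] snd_tvec[OF differentiable_total cX]
        tvec_snd[OF differentiable_base U cp])
  have "tproj ambient_bundle (F ?V) = Fbar U'" by (simp add: tproj_F[OF X V] tV eq)
  from F_lift[OF X F_in[OF X V] U' this]
  obtain V' where V': "V' \<in> tspace (total B) X" "F V' = F ?V" "tproj B V' = U'" .
  from F_inj[OF V'(1) V V'(2)] V'(3) tV show ?thesis by simp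
qed

section \<open>Pull-backs\<close>

private lemmas T = differentiable_total and D = differentiable_base

text \<open>Differentiating \<open>\<phi>bar\<close> would use up its only derivative.
  \<open>Fbar\<close> is read instead as the base component of \<open>F\<close> on vectors with
  components (v, 0). This requires trivialising coordinates, hence the restriction of
  \<open>c\<close> around each point.\<close>

lemma Fbar_components_C1:
  assumes c: "c \<in> atlas (base B)"
  shows "C1_on (cmap c ` cdom c) (\<lambda>x. std_coords (Fbar (tvec (base B) c (inv_into (cdom c) (cmap c) x) v)))"
proof (rule C1_on_locally)
  fix x0 assume "x0 \<in> cmap c ` cdom c"
  then obtain p where p: "p \<in> cdom c" "x0 = cmap c p" by blast
  obtain U \<psi> where triv: "trivialising B (cdom c \<inter> U, cmap c) \<psi>" and "p \<in> U"
    using trivialising_restriction[OF B c p(1)] .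
  let ?c = "(cdom c \<inter> U, cmap c)"
  let ?a = "affine_chart B ?c \<psi>"
  \<comment> \<open>The zero section in these coordinates: the point with base coordinates x and
    fibre coordinate 0.\<close>
  let ?X = "\<lambda>x. inv_into (cdom ?a) (cmap ?a) (x, 0)"
  have inj: "inj_on (cmap c) (cdom c)"
    using is_chart_inj D c by (metis differentiable_manifold_def)
  have c': "?c \<in> atlas (base B)" by (rule trivialising_atlas[OF triv])
  have op: "open (cmap c ` (cdom c \<inter> U))"
    using D c' by (auto simp: differentiable_manifold_def is_chart_def)
  have img: "cmap ?a ` cdom ?a = (cmap c ` (cdom c \<inter> U)) \<times> UNIV"
    using affine_chart_image(2)[OF B triv] by simp
  have "C1_on (cmap c ` (cdom c \<inter> U)) (\<lambda>x. fst (std_coords (F (tvec (total B) ?a (?X x) (v, 0)))))"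
    by (intro C1_on_fst F_components_C1[OF affine_chart_image(1)[OF B triv]] C1_on_Pair C1_on_id
        C1_on_const) (auto simp: img)
  then have "C1_on (cmap c ` (cdom c \<inter> U))
      (\<lambda>x. std_coords (Fbar (tvec (base B) c (inv_into (cdom c) (cmap c) x) v)))"
  proof (rule C1_on_cong[OF op, rotated])
    fix x assume x: "x \<in> cmap c ` (cdom c \<inter> U)"
    then obtain q where q: "q \<in> cdom c" "q \<in> U" "x = cmap c q" by blast
    have x0: "(x, 0) \<in> cmap ?a ` cdom ?a" using x by (simp add: img)
    have X: "?X x \<in> cdom ?a" "cmap ?a (?X x) = (x, 0)"
      using inv_into_into[OF x0] f_inv_into_f[OF x0] by simp_all
    have "proj B (?X x) \<in> cdom c" using X(1) by (simp add: in_cdom_affine_chart)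
    moreover have "cmap c (proj B (?X x)) = cmap c q" using X(2) q(3) by (simp add: cmap_affine_chart)
    ultimately have pX: "proj B (?X x) = q" using inj_onD[OF inj] q(1) by blast
    have "tvec (base B) ?c q v = tvec (base B) c q v"
      by (rule tvec_same_coordinates[OF D in_atlas_charts_at[OF c'] in_atlas_charts_at[OF c q(1)]])
        (simp_all add: q)
    then show "fst (std_coords (F (tvec (total B) ?a (?X x) (v, 0)))) =
        std_coords (Fbar (tvec (base B) c (inv_into (cdom c) (cmap c) x) v))"
      using F_fst_components[OF triv X(1), of "(v, 0)"] inv_into_f_f[OF inj q(1)]
      by (simp add: pX[unfolded q(3)] q(3))
  qed
  moreover have "x0 \<in> cmap c ` (cdom c \<inter> U)" using p \<open>p \<in> U\<close> by blast
  ultimately show "\<exists>T. open T \<and> x0 \<in> T \<and> C1_on T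
      (\<lambda>x. std_coords (Fbar (tvec (base B) c (inv_into (cdom c) (cmap c) x) v)))"
    using op by blast
qed

section \<open>Pull-backs of the metrics\<close>

lemma \<phi>bar_inv_C1:
  "c \<in> atlas (base B) \<Longrightarrow> C1_on (cmap c ` cdom c) (\<lambda>x. \<phi>bar (inv_into (cdom c) (cmap c) x))"
  using \<phi>bar_C1[of c] by (simp add: local_rep_def comp_def)

lemma pullback_metric_total:
  "pseudo_metric euc g \<Longrightarrow> pseudo_metric (total B) (pullback_metric F g)"
  by (rule pseudo_metric_pullback[OF T _ F_linear \<phi>_C1])
    (auto intro!: F_components_C1 C1_on_id C1_on_const)

text \<open>Definiteness comes from injectivity of \<open>Fbar\<close>, which is known at the
  projections of points of \<open>B\<close>; the projection is onto, so these are all points of the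
  base.\<close>

lemma pullback_metric_base:
  assumes g: "riemannian_metric euc g"
  shows "riemannian_metric (base B) (pullback_metric Fbar g)"
  unfolding riemannian_metric_def
proof (intro conjI ballI impI)
  have g': "pseudo_metric euc g" using g by (simp add: riemannian_metric_def)
  show "pseudo_metric (base B) (pullback_metric Fbar g)"
    by (rule pseudo_metric_pullback[OF D g' Fbar_linear \<phi>bar_inv_C1 Fbar_components_C1])
  fix p u assume p: "p \<in> carr (base B)" and u: "u \<in> tspace (base B) p" "u \<noteq> tzero p"
  then obtain X where X: "X \<in> carr (total B)" "p = proj B X"
    unfolding affine_bundleD(4)[OF B, symmetric] by blast
  note Fb = tlinearD[OF Fbar_linear[OF p]]
  have "Fbar u \<noteq> tzero (\<phi>bar p)"
  proof
    assume "Fbar u = tzero (\<phi>bar p)"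
    also have "\<dots> = Fbar (tscale 0 u)"
      unfolding Fb(3)[OF u(1)] by (simp only: tscale_zero tspaceD(1)[OF Fb(1)[OF u(1)]])
    finally have "u = tscale 0 u"
      using Fbar_inj[OF X(1), of u "tscale 0 u"] u(1) tscale_in_tspace[OF D u(1)]
      by (simp add: X(2))
    then show False using u by (simp add: tscale_zero tspaceD(1)[OF u(1)])
  qed
  then show "0 < pullback_metric Fbar g u u"
    using g Fb(1)[OF u(1)] by (simp add: riemannian_metric_def pullback_metric_def)
qed

section \<open>Pull-backs of the connection and the solder form\<close>

context
  fixes \<epsilon> \<kappa>
  assumes \<kappa>: "projectable_form ambient_bundle \<epsilon> \<kappa>"
begin

private abbreviation K :: "'a \<Rightarrow> ('p, 'b) tvector \<Rightarrow> ('a, 'b \<times> (real^3)) tvector" where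
  "K \<equiv> pullback_form B F \<phi> Fbar \<kappa>"

text \<open>\<open>inv_into\<close> is meaningful once \<open>\<kappa> (\<phi> X) (Fbar U)\<close>
  is in the image of \<open>F\<close> at \<open>X\<close>. It lies over \<epsilon> times
  \<open>Fbar U\<close>, the image of \<epsilon> times \<open>U\<close>, so it has a lift, and this
  lift projects to \<epsilon> times \<open>U\<close>.\<close>

lemma pullback_form_spec:
  assumes X: "X \<in> carr (total B)" and U: "U \<in> tspace (base B) (proj B X)"
  shows "K X U \<in> tspace (total B) X" "F (K X U) = \<kappa> (\<phi> X) (Fbar U)" "tproj B (K X U) = tscale \<epsilon> U"
proof -
  note FU = Fbar_in[OF X U]
  have W: "\<kappa> (\<phi> X) (Fbar U) \<in> tspace euc (\<phi> X)"
    by (rule tlinearD(1)[OF projectable_form_ambient(1)[OF \<kappa>] FU])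
  have "tproj ambient_bundle (\<kappa> (\<phi> X) (Fbar U)) = Fbar (tscale \<epsilon> U)"
    by (simp add: projectable_form_ambient(2)[OF \<kappa> FU]
        tlinearD(3)[OF Fbar_linear[OF proj_in_base[OF B X]] U])
  from F_lift[OF X W tscale_in_tspace[OF D U] this]
  obtain V where V: "V \<in> tspace (total B) X" "F V = \<kappa> (\<phi> X) (Fbar U)" "tproj B V = tscale \<epsilon> U" .
  have "inj_on F (tspace (total B) X)" by (rule inj_onI) (rule F_inj)
  then have "K X U = V" unfolding pullback_form_def using V(1,2) by (intro inv_into_f_eq)
  then show "K X U \<in> tspace (total B) X" "F (K X U) = \<kappa> (\<phi> X) (Fbar U)" "tproj B (K X U) = tscale \<epsilon> U"
    using V by simp_all
qed

text \<open>Both sides of each identity agree after applying the injective \<open>F\<close>.\<close>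

lemma pullback_form_linear:
  assumes X: "X \<in> carr (total B)"
  shows "tlinear (tspace (base B) (proj B X)) (tspace (total B) X) (K X)"
  unfolding tlinear_def
proof (intro conjI ballI allI)
  note spec = pullback_form_spec[OF X]
    and add = tadd_in_tspace[OF D] and scale = tscale_in_tspace[OF D]
    and \<kappa>l = tlinearD[OF projectable_form_ambient(1)[OF \<kappa>, of "\<phi> X"]]
    and Fl = tlinearD[OF F_linear[OF X]]
    and Fb = tlinearD[OF Fbar_linear[OF proj_in_base[OF B X]]] and Fbi = Fbar_in[OF X]
  show "K X ` tspace (base B) (proj B X) \<subseteq> tspace (total B) X" using spec(1) by blast
  fix u assume u: "u \<in> tspace (base B) (proj B X)"
  show "K X (tadd u w) = tadd (K X u) (K X w)" if w: "w \<in> tspace (base B) (proj B X)" for w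
    by (rule F_inj[OF spec(1)[OF add[OF u w]] tadd_in_tspace[OF T spec(1)[OF u] spec(1)[OF w]]])
      (simp add: spec u w add Fl(2) Fb(2) \<kappa>l(2) Fbi)
  show "K X (tscale r u) = tscale r (K X u)" for r
    by (rule F_inj[OF spec(1)[OF scale[OF u]] tscale_in_tspace[OF T spec(1)[OF u]]])
      (simp add: spec u scale Fl(3) Fb(3) \<kappa>l(3) Fbi)
qed

text \<open>In trivialising coordinates, the pull-back is obtained by inverting the vertical block of \<open>F\<close>.\<close>

lemma pullback_form_components:
  fixes v :: 'b
  assumes triv: "trivialising B c \<psi>" and X: "X \<in> cdom (affine_chart B c \<psi>)"
  defines "a \<equiv> affine_chart B c \<psi>" and "u \<equiv> tvec (base B) c (proj B X) v"
  shows "fst (snd (K X u) a) = \<epsilon> *\<^sub>R v"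
    and "snd (std_coords (F (tvec (total B) a X (0, snd (snd (K X u) a))))) =
      snd (std_coords (\<kappa> (\<phi> X) (Fbar u))) - \<epsilon> *\<^sub>R snd (std_coords (F (tvec (total B) a X (v, 0))))"
proof -
  have X': "X \<in> carr (total B)" "proj B X \<in> cdom c" using X by (simp_all add: in_cdom_affine_chart)
  have cX: "a \<in> charts_at (total B) X"
    unfolding a_def by (rule in_atlas_charts_at[OF affine_chart_image(1)[OF B triv] X])
  have cp: "c \<in> charts_at (base B) (proj B X)"
    by (rule in_atlas_charts_at[OF trivialising_atlas[OF triv] X'(2)])
  have u: "u \<in> tspace (base B) (proj B X)" unfolding u_def by (rule tvec_in_tspace[OF D cp])
  note spec = pullback_form_spec[OF X'(1) u]
  have "tvec (base B) c (proj B X) (fst (snd (K X u) a)) = tscale \<epsilon> u"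
    using tproj_trivialising[OF B triv X spec(1)] spec(3) by (simp add: a_def)
  from arg_cong[OF this, of "\<lambda>u. snd u c"]
  show 1: "fst (snd (K X u) a) = \<epsilon> *\<^sub>R v"
    by (simp add: snd_tvec[OF D cp] u_def)
  let ?H = "\<lambda>v. std_coords (F (tvec (total B) a X v))"
  have H: "linear ?H" by (rule F_components_linear[OF cX])
  \<comment> \<open>Splitting off the base part, whose value is already known, leaves the vertical
    part as the unknown of a linear equation.\<close>
  have "snd (K X u) a = \<epsilon> *\<^sub>R (v, 0) + (0, snd (snd (K X u) a))"
    by (simp add: prod_eq_iff 1)
  then have e1: "?H (snd (K X u) a) = \<epsilon> *\<^sub>R ?H (v, 0) + ?H (0, snd (snd (K X u) a))"
    using linear_add[OF H] linear_cmul[OF H] by metis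
  have e2: "?H (snd (K X u) a) = std_coords (\<kappa> (\<phi> X) (Fbar u))"
    by (simp add: tvec_snd[OF T spec(1) cX] spec(2))
  show "snd (?H (0, snd (snd (K X u) a))) =
      snd (std_coords (\<kappa> (\<phi> X) (Fbar u))) - \<epsilon> *\<^sub>R snd (?H (v, 0))"
    unfolding trans[OF e2[symmetric] e1] by simp
qed

lemma pullback_form_smooth:
  "smooth_map 1 (fibre_product B) (tangent_bundle (total B)) (\<lambda>(X, U). K X U)"
proof (rule smooth_map_fibre_product_tangentI[OF B pullback_form_spec(1)])
  fix c \<psi> assume triv: "trivialising B c \<psi>"
  let ?a = "affine_chart B c \<psi>"
  let ?S = "(cmap c ` cdom c \<times> (UNIV :: (real^3) set)) \<times> (UNIV :: 'b set)"
  let ?C = "fibre_product_chart B c \<psi>" and ?D = "tangent_chart (total B) ?a"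
  \<comment> \<open>The coordinates \<open>z\<close> are ((x, y), v); \<open>X z\<close> is the
    point and \<open>u z\<close> the base vector that they describe.\<close>
  define X where "X z = inv_into (cdom ?a) (cmap ?a) (fst z)" for z :: "('b \<times> (real^3)) \<times> 'b"
  define u where "u z = tvec (base B) c (proj B (X z)) (snd z)" for z
  define H where "H z v = std_coords (F (tvec (total B) ?a (X z) v))" for z v
  define w where "w z = snd (snd (K (X z) (u z)) ?a)" for z
  note at = affine_chart_image(1)[OF B triv] and img = affine_chart_image(2)[OF B triv]
  have op: "open ?S"
    using D trivialising_atlas[OF triv]
    by (auto simp: differentiable_manifold_def is_chart_def intro!: open_Times)
  have X: "X z \<in> cdom ?a" "cmap ?a (X z) = fst z" if "z \<in> ?S" for z
  proof -
    have "fst z \<in> cmap ?a ` cdom ?a" unfolding img using that by auto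
    then show "X z \<in> cdom ?a" "cmap ?a (X z) = fst z"
      unfolding X_def by (rule inv_into_into, rule f_inv_into_f)
  qed
  have fst_S: "C1_on ?S fst" "fst ` ?S \<subseteq> cmap ?a ` cdom ?a"
    using C1_on_fst[OF C1_on_id] unfolding img by auto
  have H: "C1_on ?S (\<lambda>z. H z (v z))" if "C1_on ?S v" for v
    unfolding H_def X_def by (rule F_components_C1[OF at fst_S that])
  have \<phi>: "C1_on ?S (\<lambda>z. \<phi> (X z))"
    unfolding X_def by (rule C1_on_compose[OF fst_S(1) \<phi>_C1[OF at] fst_S(2)])
  have v: "C1_on ?S (\<lambda>z. (snd z, 0))"
    by (intro C1_on_Pair C1_on_snd C1_on_id C1_on_const)
  \<comment> \<open>\<open>Fbar (u z)\<close> is expressed through the base component of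
    \<open>F\<close>, in which form it is a C^1 function of all coordinates at once.\<close>
  have "C1_on ?S (\<lambda>z. std_coords (\<kappa> (\<phi> (X z)) (tvec euc std_chart (fst (\<phi> (X z))) (fst (H z (snd z, 0))))))"
    using C1_on_compose[OF C1_on_Pair[OF \<phi> C1_on_fst[OF H[OF v]]] projectable_form_ambient(3)[OF \<kappa>]]
    by simp
  then have k: "C1_on ?S (\<lambda>z. std_coords (\<kappa> (\<phi> (X z)) (Fbar (u z))))"
  proof (rule C1_on_cong[OF op, rotated])
    fix z assume "z \<in> ?S"
    note X = X[OF this]
    have cp: "c \<in> charts_at (base B) (proj B (X z))"
      using in_atlas_charts_at[OF trivialising_atlas[OF triv]] X(1) by (simp add: in_cdom_affine_chart)
    have "Fbar (u z) \<in> tspace euc (fst (\<phi> (X z)))"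
      unfolding u_def using X(1) by (intro Fbar_in tvec_in_tspace[OF D cp]) (simp add: in_cdom_affine_chart)
    from tvec_std_coords[OF this] F_fst_components[OF triv X(1), of "(snd z, 0)"]
    show "std_coords (\<kappa> (\<phi> (X z)) (tvec euc std_chart (fst (\<phi> (X z))) (fst (H z (snd z, 0))))) =
        std_coords (\<kappa> (\<phi> (X z)) (Fbar (u z)))"
      by (simp add: H_def u_def)
  qed
  have w: "C1_on ?S w"
  proof (rule C1_on_linear_solution[OF op])
    show "linear (\<lambda>b. snd (H z (0, b)))" "inj (\<lambda>b. snd (H z (0, b)))" if "z \<in> ?S" for z
      unfolding H_def by (rule F_vertical[OF triv X(1)[OF that]])+
    show "C1_on ?S (\<lambda>z. snd (H z (0, b)))" for b
      by (intro C1_on_snd H C1_on_const)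
    show "C1_on ?S (\<lambda>z. snd (std_coords (\<kappa> (\<phi> (X z)) (Fbar (u z)))) - \<epsilon> *\<^sub>R snd (H z (snd z, 0)))"
      by (intro C1_on_diff C1_on_scaleR C1_on_const C1_on_snd[OF k] C1_on_snd[OF H[OF v]])
    show "snd (H z (0, w z)) = snd (std_coords (\<kappa> (\<phi> (X z)) (Fbar (u z)))) - \<epsilon> *\<^sub>R snd (H z (snd z, 0))"
      if "z \<in> ?S" for z
      unfolding H_def w_def u_def by (rule pullback_form_components(2)[OF triv X(1)[OF that]])
  qed
  have "C1_on ?S (\<lambda>z. (fst z, (\<epsilon> *\<^sub>R snd z, w z)))"
    by (intro C1_on_Pair C1_on_scaleR C1_on_const C1_on_fst C1_on_snd C1_on_id w)
  then show "C1_on ?S (local_rep ?C ?D (\<lambda>(X, U). K X U))"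
  proof (rule C1_on_cong[OF op, rotated])
    fix z assume z: "z \<in> ?S"
    note X = X[OF z]
    have X': "X z \<in> carr (total B)" using X(1) by (simp add: in_cdom_affine_chart)
    have cp: "c \<in> charts_at (base B) (proj B (X z))"
      using in_atlas_charts_at[OF trivialising_atlas[OF triv]] X(1) by (simp add: in_cdom_affine_chart)
    have u: "u z \<in> tspace (base B) (proj B (X z))" unfolding u_def by (rule tvec_in_tspace[OF D cp])
    have x: "(X z, u z) \<in> cdom ?C" "cmap ?C (X z, u z) = z"
      using X u by (simp_all add: fibre_product_chart_def u_def snd_tvec[OF D cp])
    from local_rep_eq[OF fibre_product_chart_inj[OF B triv] x(1), of ?D "\<lambda>(X, U). K X U"]
    have "local_rep ?C ?D (\<lambda>(X, U). K X U) z = (cmap ?a (X z), snd (K (X z) (u z)) ?a)"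
      by (simp only: x(2) prod.case cmap_tangent_chart tspaceD(1)[OF pullback_form_spec(1)[OF X' u]])
    then show "(fst z, (\<epsilon> *\<^sub>R snd z, w z)) = local_rep ?C ?D (\<lambda>(X, U). K X U) z"
      using pullback_form_components(1)[OF triv X(1), of "snd z"]
      by (simp add: X(2) w_def u_def prod_eq_iff)
  qed
qed

end

text \<open>Since \<open>F\<close> and the tangent map of \<open>\<phi>\<close> agree on vertical vectors, the vertical block of \<open>F\<close>
  is the linear part of \<open>\<phi>\<close> on the fibre, and hence constant along the fibre.\<close>

lemma F_vertical_affine:
  assumes triv: "trivialising B c \<psi>" and p: "p \<in> cdom c"
  obtains l h where "linear l" "affine_map h" "\<And>X. X \<in> fibre B p \<Longrightarrow> snd (\<phi> X) = h (\<psi> X)"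
    "\<And>X w. X \<in> fibre B p \<Longrightarrow>
      snd (std_coords (F (tvec (total B) (affine_chart B c \<psi>) X (0, w)))) = l w"
proof -
  let ?a = "affine_chart B c \<psi>"
  let ?R = "local_rep ?a std_chart \<phi>"
  obtain U where U: "(U, \<psi>) \<in> trivs B" "cdom c \<subseteq> U" using triv by (auto simp: trivialising_def)
  have "\<exists>h. affine_map h \<and> (\<forall>X\<in>fibre B p. snd (\<phi> X) = h (\<psi> X))"
    using placementD(6) U p unfolding affine_on_fibres_def by fastforce
  then obtain h where h: "affine_map h" "\<And>X. X \<in> fibre B p \<Longrightarrow> snd (\<phi> X) = h (\<psi> X)" by blast
  then obtain l b where l: "linear l" "\<And>y. h y = l y + b" unfolding affine_map_def by blast
  note at = affine_chart_image(1)[OF B triv]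
  have inj: "inj_on (cmap c) (cdom c)"
    by (rule charts_atD(4)[OF D in_atlas_charts_at[OF trivialising_atlas[OF triv] p]])
  have "snd (std_coords (F (tvec (total B) ?a X (0, w)))) = l w" if X: "X \<in> fibre B p" for X w
  proof -
    have X': "X \<in> carr (total B)" "proj B X = p" using X by (simp_all add: fibre_def)
    have a: "X \<in> cdom ?a" using X' p by (simp add: in_cdom_affine_chart)
    note cX = in_atlas_charts_at[OF at a]
    have cp: "c \<in> charts_at (base B) p" by (rule in_atlas_charts_at[OF trivialising_atlas[OF triv] p])
    let ?V = "tvec (total B) ?a X (0, w)"
    have V: "?V \<in> tspace (total B) X" by (rule tvec_in_tspace[OF T cX])
    have "tvec (base B) c p 0 = tzero p"
      by (rule tspace_eqI[OF D tvec_in_tspace[OF D cp] tzero_in_tspace[OF D charts_atD(5)[OF D cp]] cp])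
        (simp add: snd_tvec[OF D cp])
    then have "?V \<in> vertical B X"
      using tproj_trivialising[OF B triv a V] V
      by (simp add: vertical_def X'(2) snd_tvec[OF T cX])
    then have FV: "F ?V = tmap (total B) euc \<phi> ?V" using placementD(8) X'(1) by blast
    have "C1_on (cmap ?a ` cdom ?a) ?R"
      using \<phi>_C1[OF at] by (simp add: local_rep_def comp_def)
    from C1_on_derivative[OF this imageI[OF a]]
    obtain R' where R': "(?R has_derivative R') (at (cmap ?a X))" ..
    have \<phi>: "continuous_map (topo (total B)) (topo euc) \<phi>"
      using placementD(3) by (simp add: smooth_map_def)
    have "F ?V = tvec euc std_chart (\<phi> X) (R' (0, w))"
      unfolding FV tmap_eq_tvec[OF T euc_differentiable \<phi> cX std_chart_charts_at R' V]
      by (simp add: snd_tvec[OF T cX])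
    then have FV': "std_coords (F ?V) = R' (0, w)" by simp
    have "(?R has_derivative R') (at (cmap c p, \<psi> X))"
      using R' by (simp add: cmap_affine_chart X'(2))
    \<comment> \<open>Fixing the base coordinates restricts the representative of
      \<open>\<phi>\<close> to the fibre.\<close>
    from has_derivative_compose[OF has_derivative_Pair[OF has_derivative_const has_derivative_ident] this]
    have d: "((\<lambda>y. snd (?R (cmap c p, y))) has_derivative (\<lambda>w. snd (R' (0, w)))) (at (\<psi> X))"
      by (rule has_derivative_snd)
    have "snd (?R (cmap c p, y)) = l y + b" for y
    proof -
      have "(cmap c p, y) \<in> cmap ?a ` cdom ?a"
        unfolding affine_chart_image(2)[OF B triv] using p by blast
      then obtain Y where Y: "Y \<in> cdom ?a" "(cmap c p, y) = cmap ?a Y" by blast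
      have "proj B Y = p"
        using inj_onD[OF inj, of "proj B Y" p] Y p by (simp add: in_cdom_affine_chart cmap_affine_chart)
      then have "Y \<in> fibre B p" using Y(1) by (simp add: fibre_def in_cdom_affine_chart)
      moreover have "\<psi> Y = y" using Y(2) by (simp add: cmap_affine_chart)
      moreover have "?R (cmap c p, y) = \<phi> Y"
        unfolding Y(2) local_rep_eq[OF charts_atD(4)[OF T cX] Y(1)] by simp
      ultimately show ?thesis using h(2)[of Y] l(2)[of y] by simp
    qed
    then have eq: "(\<lambda>y. snd (?R (cmap c p, y))) = (\<lambda>y. l y + b)" by (rule ext)
    \<comment> \<open>On the fibre \<open>\<phi>\<close> is affine with linear part
      \<open>l\<close>, independent of the point; uniqueness of derivatives identifies
      \<open>l\<close> with the vertical block of \<open>F\<close>.\<close>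
    have "((\<lambda>y. l y + b) has_derivative l) (at (\<psi> X))"
      by (rule has_derivative_add_const[OF linear_imp_has_derivative[OF l(1)]])
    from fun_cong[OF has_derivative_unique[OF d[unfolded eq] this], of w]
    show ?thesis by (simp add: FV')
  qed
  then show ?thesis using that[OF l(1) h] by blast
qed

text \<open>As the block \<open>l\<close> is the same at all points of the fibre, a single left
  inverse \<open>l'\<close> solves the system along the whole fibre, and applying it to an affine
  right-hand side gives an affine map again.\<close>

lemma pullback_form_vertically_affine:
  assumes \<kappa>: "projectable_form ambient_bundle \<epsilon> \<kappa>"
  shows "vertically_affine B (pullback_form B F \<phi> Fbar \<kappa>)"
  unfolding vertically_affine_def
proof (intro allI impI, elim conjE)
  fix c \<psi> p v assume triv: "trivialising B c \<psi>" and p: "p \<in> cdom c"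
  let ?a = "affine_chart B c \<psi>"
  let ?u = "tvec (base B) c p v"
  let ?K = "pullback_form B F \<phi> Fbar \<kappa>"
  let ?H = "\<lambda>X v. std_coords (F (tvec (total B) ?a X v))"
  show "\<exists>h. affine_map h \<and> (\<forall>X\<in>fibre B p. snd (?K X ?u) ?a = h (\<psi> X))"
  proof (cases "fibre B p = {}")
    case True
    then show ?thesis using affine_map_const by blast
  next
    case False
    \<comment> \<open>A point of the fibre is needed to read off injectivity of \<open>l\<close>
      from that of the vertical block.\<close>
    then obtain X0 where X0: "X0 \<in> fibre B p" by blast
    have fib: "X \<in> carr (total B)" "proj B X = p" "X \<in> cdom ?a" if "X \<in> fibre B p" for X
      using that p by (simp_all add: fibre_def in_cdom_affine_chart)
    have cp: "c \<in> charts_at (base B) p" by (rule in_atlas_charts_at[OF trivialising_atlas[OF triv] p])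
    obtain l h1 where l: "linear l" "affine_map h1" "\<And>X. X \<in> fibre B p \<Longrightarrow> snd (\<phi> X) = h1 (\<psi> X)"
      "\<And>X w. X \<in> fibre B p \<Longrightarrow> snd (?H X (0, w)) = l w"
      using F_vertical_affine[OF triv p] by metis
    have "inj l" using F_vertical(2)[OF triv fib(3)[OF X0]] by (simp add: l(4)[OF X0])
    then obtain l' where l': "linear l'" "l' \<circ> l = id"
      using linear_injective_left_inverse[OF l(1)] by blast
    obtain h2 where h2: "affine_map h2"
      "\<And>y. std_coords (\<kappa> (\<phi>bar p, y) (tvec euc std_chart (\<phi>bar p) (std_coords (Fbar ?u)))) = h2 y"
      using projectable_form_ambient(4)[OF \<kappa>] by metis
    have "\<exists>h. affine_map h \<and> (\<forall>X\<in>fibre B p. ?H X (v, 0) = h (\<psi> X))"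
      using mp[OF spec[OF spec[OF spec[OF spec[OF spec[OF spec[OF placementD(9), of c], of \<psi>],
        of std_chart], of snd], of p], of "(v, 0)"]] triv p trivialising_ambient
      by (simp add: affine_chart_ambient)
    then obtain h3 where h3: "affine_map h3" "\<And>X. X \<in> fibre B p \<Longrightarrow> ?H X (v, 0) = h3 (\<psi> X)" by blast
    \<comment> \<open>\<open>h2 \<circ> h1\<close> gives the components of \<open>\<kappa>\<close>
      at \<open>\<phi> X\<close>, and \<open>h3\<close> those of \<open>F\<close> on (v, 0). The
      minus sign is moved into the factor \<open>- \<epsilon>\<close> so that closure under sums and
      linear maps applies.\<close>
    let ?h = "\<lambda>y. (\<epsilon> *\<^sub>R v, l' (snd (h2 (h1 y)) + (- \<epsilon>) *\<^sub>R snd (h3 y)))"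
    have "affine_map ?h"
      by (intro affine_map_Pair affine_map_const affine_map_comp[OF affine_map_linear[OF l'(1)]]
          affine_map_add affine_map_comp[OF affine_map_linear[OF linear_snd]]
          affine_map_comp[OF affine_map_linear[OF linear_scale_self]] affine_map_comp[OF h2(1) l(2)] h3(1))
    moreover have "snd (?K X ?u) ?a = ?h (\<psi> X)" if X: "X \<in> fibre B p" for X
    proof -
      note fib = fib[OF X]
      have u: "?u \<in> tspace (base B) (proj B X)" using tvec_in_tspace[OF D cp] by (simp add: fib)
      have "\<phi> X = (\<phi>bar p, h1 (\<psi> X))"
        using fst_\<phi>[OF fib(1)] l(3)[OF X] by (simp add: prod_eq_iff fib(2))
      moreover have "tvec euc std_chart (\<phi>bar p) (std_coords (Fbar ?u)) = Fbar ?u"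
        using tvec_std_coords[OF Fbar_in[OF fib(1) u]] fst_\<phi>[OF fib(1)] by (simp add: fib(2))
      ultimately have \<kappa>X: "std_coords (\<kappa> (\<phi> X) (Fbar ?u)) = h2 (h1 (\<psi> X))"
        using h2(2)[of "h1 (\<psi> X)"] by simp
      note comp = pullback_form_components[OF \<kappa> triv fib(3), of v, unfolded fib(2)]
      have "l (snd (snd (?K X ?u) ?a)) = snd (h2 (h1 (\<psi> X))) - \<epsilon> *\<^sub>R snd (h3 (\<psi> X))"
        using comp(2) by (simp add: l(4)[OF X] \<kappa>X h3(2)[OF X])
      from arg_cong[OF this, of l'] have "snd (snd (?K X ?u) ?a) = l' (snd (h2 (h1 (\<psi> X))) - \<epsilon> *\<^sub>R snd (h3 (\<psi> X)))"
        using fun_cong[OF l'(2), of "snd (snd (?K X ?u) ?a)"] by simp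
      then show ?thesis by (simp add: prod_eq_iff comp(1))
    qed
    ultimately show ?thesis by blast
  qed
qed

lemma projectable_form_pullback:
  "projectable_form ambient_bundle \<epsilon> \<kappa> \<Longrightarrow> projectable_form B \<epsilon> (pullback_form B F \<phi> Fbar \<kappa>)"
  unfolding projectable_form_def[of B]
  using pullback_form_smooth pullback_form_linear pullback_form_spec(3)
    pullback_form_vertically_affine by simp

text \<open>A pulled-back vector remembers its base point \<open>X\<close>; at that point
  injectivity of \<open>\<theta>\<close> and then of \<open>Fbar\<close> recovers the
  argument.\<close>

lemma solder_form_pullback:
  assumes \<theta>: "solder_form ambient_bundle \<theta>"
  shows "solder_form B (pullback_form B F \<phi> Fbar \<theta>)"
  unfolding solder_form_iff
proof
  have proj: "projectable_form ambient_bundle 0 \<theta>"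
    and inj: "inj_on (\<lambda>(a, u). \<theta> a u) (carr (fibre_product ambient_bundle))"
    using \<theta> by (simp_all add: solder_form_iff)
  show "projectable_form B 0 (pullback_form B F \<phi> Fbar \<theta>)"
    by (rule projectable_form_pullback[OF proj])
  show "inj_on (\<lambda>(X, U). pullback_form B F \<phi> Fbar \<theta> X U) (carr (fibre_product B))"
  proof (rule inj_onI, clarify)
    fix X U X' U'
    assume XU: "(X, U) \<in> carr (fibre_product B)" "(X', U') \<in> carr (fibre_product B)"
      and eq: "pullback_form B F \<phi> Fbar \<theta> X U = pullback_form B F \<phi> Fbar \<theta> X' U'"
    note 1 = carr_fibre_productD[OF XU(1)] and 2 = carr_fibre_productD[OF XU(2)]
    note s1 = pullback_form_spec[OF proj 1] and s2 = pullback_form_spec[OF proj 2]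
    have X: "X' = X" using tspaceD(1)[OF s1(1)] tspaceD(1)[OF s2(1)] eq by simp
    have "\<theta> (\<phi> X) (Fbar U) = \<theta> (\<phi> X) (Fbar U')" using s1(2) s2(2) eq by (simp add: X)
    moreover have "(\<phi> X, Fbar U) \<in> carr (fibre_product ambient_bundle)"
      "(\<phi> X, Fbar U') \<in> carr (fibre_product ambient_bundle)"
      using Fbar_in[OF 1] Fbar_in[OF 2] X
      by (auto intro!: carr_fibre_productI simp: euc_differentiable)
    ultimately have "Fbar U = Fbar U'" using inj_onD[OF inj, of "(\<phi> X, Fbar U)" "(\<phi> X, Fbar U')"] by simp
    then have "U = U'" using Fbar_inj[OF 1, of U'] 2(2) X by simp
    with X show "X = X' \<and> U = U'" by simp
  qed
qed

end

section \<open>Splitting of ambient vectors\<close>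

lemma solder_form_onto_vertical:
  assumes \<theta>: "solder_form ambient_bundle \<theta>"
    and W: "W \<in> tspace euc a" "fst (std_coords W) = 0"
  obtains s where "s \<in> tspace euc (fst a)" "\<theta> a s = W"
proof -
  have proj: "projectable_form ambient_bundle 0 \<theta>"
    and inj: "inj_on (\<lambda>(a, u). \<theta> a u) (carr (fibre_product ambient_bundle))"
    using \<theta> by (simp_all add: solder_form_iff)
  note \<theta>l = tlinearD[OF projectable_form_ambient(1)[OF proj]]
  let ?t = "\<lambda>v. tvec euc std_chart (fst a) v"
  let ?L = "\<lambda>v. snd (std_coords (\<theta> a (?t v)))"
  have vert: "fst (std_coords (\<theta> a (?t v))) = 0" for v
    using std_coords_tproj_ambient[OF \<theta>l(1)[OF tvec_euc[of "fst a" v]]]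
      projectable_form_ambient(2)[OF proj tvec_euc[of "fst a" v]] by simp
  have "linear ?L"
    by (rule linearI) (simp_all add: tvec_add[OF euc_differentiable std_chart_charts_at]
        tvec_scale[OF euc_differentiable std_chart_charts_at] \<theta>l(2,3) tvec_euc)
  moreover have "inj ?L"
  proof (rule injI)
    fix v w assume "?L v = ?L w"
    then have "\<theta> a (?t v) = \<theta> a (?t w)"
      by (intro tspace_euc_eqI[OF \<theta>l(1)[OF tvec_euc] \<theta>l(1)[OF tvec_euc]]) (simp add: prod_eq_iff vert)
    moreover have "(a, ?t v) \<in> carr (fibre_product ambient_bundle)" for v
      by (rule carr_fibre_productI) (simp_all add: euc_differentiable tvec_euc)
    ultimately have "?t v = ?t w" using inj_onD[OF inj, of "(a, ?t v)" "(a, ?t w)"] by simp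
    from arg_cong[OF this, of std_coords] show "v = w" by simp
  qed
  ultimately have "surj ?L" by (rule linear_injective_imp_surjective) (rule refl)
  from surjD[OF this, of "snd (std_coords W)"] obtain v where "snd (std_coords W) = ?L v" ..
  then have "\<theta> a (?t v) = W"
    by (intro tspace_euc_eqI[OF \<theta>l(1)[OF tvec_euc] W(1)]) (simp add: prod_eq_iff vert W(2))
  then show ?thesis using that[OF tvec_euc] by blast
qed

text \<open>Subtracting from \<open>W\<close> the horizontal lift of its projection leaves a
  vertical vector, which the solder form reaches.\<close>

lemma ambient_decomposition:
  assumes \<theta>: "solder_form ambient_bundle \<theta>" and \<gamma>: "connection ambient_bundle \<gamma>"
    and W: "W \<in> tspace euc a"
  obtains s where "s \<in> tspace euc (fst a)" "W = tadd (\<theta> a s) (\<gamma> a (tproj ambient_bundle W))"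
proof -
  have \<gamma>': "projectable_form ambient_bundle 1 \<gamma>" using \<gamma> by (simp add: connection_iff)
  let ?t = "tproj ambient_bundle W"
  have t: "?t \<in> tspace euc (fst a)" by (simp add: tproj_ambient[OF W] tvec_euc)
  have \<gamma>t: "\<gamma> a ?t \<in> tspace euc a" by (rule tlinearD(1)[OF projectable_form_ambient(1)[OF \<gamma>'] t])
  have "tdiff W (\<gamma> a ?t) \<in> tspace euc a"
    unfolding tdiff_eq by (intro tadd_in_tspace tscale_in_tspace euc_differentiable W \<gamma>t)
  moreover have "fst (std_coords (tdiff W (\<gamma> a ?t))) = 0"
    using std_coords_tproj_ambient[OF W] std_coords_tproj_ambient[OF \<gamma>t]
      projectable_form_ambient(2)[OF \<gamma>' t] by simp
  ultimately obtain s where s: "s \<in> tspace euc (fst a)" "\<theta> a s = tdiff W (\<gamma> a ?t)"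
    by (rule solder_form_onto_vertical[OF \<theta>])
  have "W = tadd (\<theta> a s) (\<gamma> a ?t)" by (simp add: s(2) prod_eq_iff fun_eq_iff)
  with s(1) show ?thesis by (rule that)
qed

section \<open>The kernel of the pulled-back pseudo-metric\<close>

theorem mainTheorem7:
  fixes B :: "('a, 'p, 'b::euclidean_space, real^3) bundle_data"
    and F :: "('a, 'b \<times> (real^3)) tvector \<Rightarrow> ((real^3) \<times> (real^3), (real^3) \<times> (real^3)) tvector"
    and \<phi> :: "'a \<Rightarrow> (real^3) \<times> (real^3)"
    and \<phi>bar :: "'p \<Rightarrow> real^3"
    and Fbar :: "('p, 'b) tvector \<Rightarrow> (real^3, real^3) tvector"
  assumes "affine_bundle B"
    and "DIM('b) \<in> {1, 2, 3}"
    and "first_order_placement B ambient_bundle F \<phi> \<phi>bar"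
    and "Fbar = tmap (base B) (base ambient_bundle) \<phi>bar"
    and "connection ambient_bundle \<gamma>"
    and "solder_form ambient_bundle \<theta>"
    and "riemannian_metric (base ambient_bundle) g"
    and "pseudo_metric (total ambient_bundle) gE"
    and "compatible ambient_bundle gE g \<gamma> \<theta>"
    and "\<Gamma> = pullback_form B F \<phi> Fbar \<gamma>"
    and "\<Theta> = pullback_form B F \<phi> Fbar \<theta>"
    and "G = pullback_metric Fbar g"
    and "GB = pullback_metric F gE"
  shows "compatible B GB G \<Gamma> \<Theta> \<and>
    (\<forall>X \<in> carr (total B).
       metric_kernel (total B) GB X = horizontal B (\<lambda>X U. tdiff (\<Gamma> X U) (\<Theta> X U)) X)"
proof -
  note B = assms(1) and P = assms(3)
  note T = affine_bundle_differentiable(1)[OF B] and D = affine_bundle_differentiable(2)[OF B]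
    and E = euc_differentiable
  have Fbar: "Fbar = tmap (base B) euc \<phi>bar" using assms(4) by simp
  have \<gamma>: "projectable_form ambient_bundle 1 \<gamma>" and \<theta>: "projectable_form ambient_bundle 0 \<theta>"
    using assms(5,6) by (simp_all add: connection_iff solder_form_iff)
  have g: "riemannian_metric euc g" "pseudo_metric euc g"
    using assms(7) by (simp_all add: riemannian_metric_def)
  have compat: "gE (tadd (\<theta> a u) (\<gamma> a w)) (tadd (\<theta> a u') (\<gamma> a w')) = g (tadd u w) (tadd u' w')"
    if "u \<in> tspace euc (fst a)" "w \<in> tspace euc (fst a)" "u' \<in> tspace euc (fst a)" "w' \<in> tspace euc (fst a)"
    for a u w u' w'
    using assms(9) that by (cases a) (simp add: compatible_def)
  have \<Gamma>: "\<Gamma> X U \<in> tspace (total B) X" "F (\<Gamma> X U) = \<gamma> (\<phi> X) (Fbar U)"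
    and \<Theta>: "\<Theta> X U \<in> tspace (total B) X" "F (\<Theta> X U) = \<theta> (\<phi> X) (Fbar U)"
    if "X \<in> carr (total B)" "U \<in> tspace (base B) (proj B X)" for X U
    using pullback_form_spec[OF B P \<gamma> that] pullback_form_spec[OF B P \<theta> that]
    by (simp_all add: assms(10,11) Fbar)
  have "compatible B GB G \<Gamma> \<Theta>"
    unfolding compatible_def
  proof (intro conjI ballI)
    show "pseudo_metric (total B) GB"
      using pullback_metric_total[OF B P] assms(8) by (simp add: assms(13))
    show "riemannian_metric (base B) G"
      using pullback_metric_base[OF B P g(1)] by (simp add: assms(12) Fbar)
    show "connection B \<Gamma>"
      using projectable_form_pullback[OF B P \<gamma>] by (simp add: connection_iff assms(10) Fbar)
    show "solder_form B \<Theta>"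
      using solder_form_pullback[OF B P assms(6)] by (simp add: assms(11) Fbar)
    fix X u w u' w'
    assume X: "X \<in> carr (total B)"
      and u: "u \<in> tspace (base B) (proj B X)" "w \<in> tspace (base B) (proj B X)"
      "u' \<in> tspace (base B) (proj B X)" "w' \<in> tspace (base B) (proj B X)"
    note Fb = Fbar_in[OF B P X, folded Fbar]
      and Fbl = tlinearD(2)[OF Fbar_linear[OF B P proj_in_base[OF B X]], folded Fbar]
    \<comment> \<open>By linearity of \<open>F\<close> and \<open>Fbar\<close> this is compatibility
      of the ambient data at \<open>\<phi> X\<close>, with all four vectors pushed forward by
      \<open>Fbar\<close>.\<close>
    show "GB (tadd (\<Theta> X u) (\<Gamma> X w)) (tadd (\<Theta> X u') (\<Gamma> X w')) = G (tadd u w) (tadd u' w')"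
      using compat[OF Fb[OF u(1)] Fb[OF u(2)] Fb[OF u(3)] Fb[OF u(4)]]
      by (simp add: assms(12,13) pullback_metric_def tlinearD(2)[OF F_linear[OF B P X]] \<Gamma> \<Theta> X u Fbl)
  qed
  moreover have "metric_kernel (total B) GB X = horizontal B (\<lambda>X U. tdiff (\<Gamma> X U) (\<Theta> X U)) X"
    if X: "X \<in> carr (total B)" for X
  proof -
    note Fl = tlinearD[OF F_linear[OF B P X]]
      and Fb = Fbar_in[OF B P X, folded Fbar]
      and Fbl = tlinearD[OF Fbar_linear[OF B P proj_in_base[OF B X]], folded Fbar]
      and tl = tlinearD[OF tproj_linear[OF B X]]
      and \<gamma>l = tlinearD[OF projectable_form_ambient(1)[OF \<gamma>, of "\<phi> X"]]
      and \<theta>l = tlinearD[OF projectable_form_ambient(1)[OF \<theta>, of "\<phi> X"]]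
    \<comment> \<open>For w = \<open>Fbar U\<close>, the difference of \<open>\<gamma>\<close> w and
      \<open>\<theta>\<close> w is rewritten as the sum of \<open>\<theta>\<close> (- w) and
      \<open>\<gamma>\<close> w, the shape in which compatibility applies.\<close>
    have in_T: "tdiff (\<Gamma> X U) (\<Theta> X U) \<in> tspace (total B) X"
      and F_diff: "F (tdiff (\<Gamma> X U) (\<Theta> X U)) =
        tadd (\<theta> (\<phi> X) (tscale (-1) (Fbar U))) (\<gamma> (\<phi> X) (Fbar U))"
      if U: "U \<in> tspace (base B) (proj B X)" for U
    proof -
      note s = tscale_in_tspace[OF T \<Theta>(1)[OF X U], of "-1"]
      show "tdiff (\<Gamma> X U) (\<Theta> X U) \<in> tspace (total B) X"
        unfolding tdiff_eq by (rule tadd_in_tspace[OF T \<Gamma>(1)[OF X U] s])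
      have "F (tdiff (\<Gamma> X U) (\<Theta> X U)) =
          tadd (\<gamma> (\<phi> X) (Fbar U)) (tscale (-1) (\<theta> (\<phi> X) (Fbar U)))"
        by (simp add: tdiff_eq Fl(2)[OF \<Gamma>(1)[OF X U] s] Fl(3)[OF \<Theta>(1)[OF X U]] \<Gamma>(2) \<Theta>(2) X U)
      also have "\<dots> = tadd (\<theta> (\<phi> X) (tscale (-1) (Fbar U))) (\<gamma> (\<phi> X) (Fbar U))"
        using tspaceD(1)[OF \<gamma>l(1)[OF Fb[OF U]]] tspaceD(1)[OF \<theta>l(1)[OF Fb[OF U]]]
        by (simp add: \<theta>l(3)[OF Fb[OF U]] prod_eq_iff fun_eq_iff)
      finally show "F (tdiff (\<Gamma> X U) (\<Theta> X U)) =
        tadd (\<theta> (\<phi> X) (tscale (-1) (Fbar U))) (\<gamma> (\<phi> X) (Fbar U))" .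
    qed
    show ?thesis
    proof (intro equalityI subsetI)
      fix Z assume "Z \<in> metric_kernel (total B) GB X"
      then have Z: "Z \<in> tspace (total B) X"
        and ker: "\<And>V. V \<in> tspace (total B) X \<Longrightarrow> gE (F Z) (F V) = 0"
        by (simp_all add: metric_kernel_def assms(13) pullback_metric_def)
      let ?U = "tproj B Z"
      have U: "?U \<in> tspace (base B) (proj B X)" by (rule tl(1)[OF Z])
      note t = Fb[OF U]
      obtain s where s: "s \<in> tspace euc (fst (\<phi> X))"
        "F Z = tadd (\<theta> (\<phi> X) s) (\<gamma> (\<phi> X) (tproj ambient_bundle (F Z)))"
        using ambient_decomposition[OF assms(6,5) F_in[OF B P X Z]] .
      have FZ: "F Z = tadd (\<theta> (\<phi> X) s) (\<gamma> (\<phi> X) (Fbar ?U))"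
        using s(2) unfolding tproj_F[OF B P X Z, folded Fbar] .
      \<comment> \<open>Compatibility sees \<open>F Z\<close> only through the sum of its two
        arguments. Testing against \<open>\<theta>\<close> of this same sum produces
        \<open>g ?r ?r\<close>.\<close>
      let ?r = "tadd s (Fbar ?U)"
      have r: "?r \<in> tspace euc (fst (\<phi> X))" by (rule tadd_in_tspace[OF E s(1) t])
      note r0 = tscale_in_tspace[OF E r, of 0]
      \<comment> \<open>\<open>\<theta> (\<phi> X) ?r\<close> lies over a zero vector, which is the
        image of a zero vector. It is therefore in the image of \<open>F\<close>, whether or not
        \<open>?r\<close> is in the image of \<open>Fbar\<close>.\<close>
      have "tproj ambient_bundle (\<theta> (\<phi> X) ?r) = tscale 0 ?r"
        by (rule projectable_form_ambient(2)[OF \<theta> r])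
      also have "\<dots> = tscale 0 (Fbar ?U)"
        using tspaceD(1)[OF s(1)] tspaceD(1)[OF t] by (simp add: tscale_zero)
      also have "\<dots> = Fbar (tscale 0 ?U)" by (rule Fbl(3)[OF U, symmetric])
      finally have eq: "tproj ambient_bundle (\<theta> (\<phi> X) ?r) = Fbar (tscale 0 ?U)" .
      obtain V where V: "V \<in> tspace (total B) X" "F V = \<theta> (\<phi> X) ?r"
        using F_lift[OF B P, folded Fbar, OF X \<theta>l(1)[OF r] tscale_in_tspace[OF D U] eq] .
      \<comment> \<open>A zero horizontal part is added to bring the test vector into the shape that
        compatibility requires.\<close>
      have "\<theta> (\<phi> X) ?r = tadd (\<theta> (\<phi> X) ?r) (\<gamma> (\<phi> X) (tscale 0 ?r))"
        unfolding \<gamma>l(3)[OF r] by (simp add: prod_eq_iff fun_eq_iff)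
      then have "gE (F Z) (F V) = g ?r (tadd ?r (tscale 0 ?r))"
        unfolding V(2) FZ using compat[OF s(1) t r r0] by simp
      also have "tadd ?r (tscale 0 ?r) = ?r" by (simp add: prod_eq_iff fun_eq_iff)
      finally have "g ?r ?r = 0" using ker[OF V(1)] by simp
      then have r_zero: "?r = tzero (fst (\<phi> X))"
        using g(1) r unfolding riemannian_metric_def by fastforce
      have "snd s c = - snd (Fbar ?U) c" for c
        using arg_cong[OF r_zero, of "\<lambda>u. snd u c"] by (simp add: eq_neg_iff_add_eq_0)
      then have "s = tscale (-1) (Fbar ?U)"
        using tspaceD(1)[OF s(1)] tspaceD(1)[OF t] by (simp add: prod_eq_iff fun_eq_iff)
      then have "F Z = F (tdiff (\<Gamma> X ?U) (\<Theta> X ?U))" using FZ F_diff[OF U] by simp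
      then have "Z = tdiff (\<Gamma> X ?U) (\<Theta> X ?U)" by (rule F_inj[OF B P Z in_T[OF U]])
      then show "Z \<in> horizontal B (\<lambda>X U. tdiff (\<Gamma> X U) (\<Theta> X U)) X"
        unfolding horizontal_def using U by blast
    next
      fix Z assume "Z \<in> horizontal B (\<lambda>X U. tdiff (\<Gamma> X U) (\<Theta> X U)) X"
      then obtain U where U: "U \<in> tspace (base B) (proj B X)" and Z: "Z = tdiff (\<Gamma> X U) (\<Theta> X U)"
        unfolding horizontal_def by blast
      note t = Fb[OF U]
      have "gE (F Z) (F V) = 0" if V: "V \<in> tspace (total B) X" for V
      proof -
        have t': "tproj ambient_bundle (F V) \<in> tspace euc (fst (\<phi> X))"
          by (simp add: tproj_ambient[OF F_in[OF B P X V]] tvec_euc)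
        obtain s where s: "s \<in> tspace euc (fst (\<phi> X))"
          "F V = tadd (\<theta> (\<phi> X) s) (\<gamma> (\<phi> X) (tproj ambient_bundle (F V)))"
          using ambient_decomposition[OF assms(6,5) F_in[OF B P X V]] .
        let ?r = "tadd s (tproj ambient_bundle (F V))"
        \<comment> \<open>The first argument becomes - w + w for w = \<open>Fbar U\<close>, so
          \<open>F Z\<close> is orthogonal to every ambient vector at
          \<open>\<phi> X\<close>.\<close>
        have "gE (F Z) (F V) = g (tadd (tscale (-1) (Fbar U)) (Fbar U)) ?r"
          unfolding Z F_diff[OF U]
          by (subst s(2)) (rule compat[OF tscale_in_tspace[OF E t] t s(1) t'])
        also have "tadd (tscale (-1) (Fbar U)) (Fbar U) = tscale 0 (Fbar U)"
          by (simp add: prod_eq_iff fun_eq_iff)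
        also have "g (tscale 0 (Fbar U)) ?r = 0"
          using pseudo_metricD(3)[OF g(2) t tadd_in_tspace[OF E s(1) t'], of 0] by simp
        finally show ?thesis .
      qed
      then show "Z \<in> metric_kernel (total B) GB X"
        using in_T[OF U] by (simp add: metric_kernel_def assms(13) pullback_metric_def Z)
    qed
  qed
  ultimately show ?thesis by blast
qed

end
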